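(* Let $T\in(0,\infty)$ and let $(A,B,K,C)$ on $X$ and $(\widetilde A,\widetilde B,\widetilde K,\widetilde C)$ on $\widetilde X$ be two exponentially stable Ornstein-Uhlenbeck systems with the same output space $\mathcal H$, driven by the same $\mathbb R^d$-valued square-integrable mean-zero Lévy process $(M_t)_{t\ge0}$ (the second one playing the role of a reduced system). Let $u,\widetilde u\in L^2_{\operatorname{ad}}(\Omega_T,\mathbb R^m)$. Let $Y$ be the output of the first system with control $u$ and initial state $Z_0=\xi=B_{\operatorname{in}}v$, and let $\widetilde Y$ be the output of the second system with control $\widetilde u$ and initial state $\widetilde Z_0=0$. Define $$\widetilde Y^{(0)}_t=\widetilde C^{(0)}\widetilde T^{(0)}_t\widetilde B_{\operatorname{in}}v+\widetilde Y_t,$$ where $(\widetilde T^{(0)}_t)_{t\ge0}$ is an exponentially stable $C_0$-semigroup generated by some operator $\widetilde A^{(0)}$ on a Hilbert space $\widetilde X^{(0)}$, and $\widetilde B_{\operatorname{in}}:\mathbb R^k\to\widetilde X^{(0)}$, $\widetilde C^{(0)}:\widetilde X^{(0)}\to\mathcal H$ are additional (bounded linear) input and output operators. Then $$\begin{aligned}\|Y-\widetilde Y^{(0)}\|_{L^2(\Omega_T)}\le{}&\sqrt{2T}\,\big(1\vee\|u\|_{L^2(\Omega_T)}\big)\Big(\operatorname{tr}\big(C\mathscr P^{\operatorname{ou}}C^*-2C\mathscr P^{\operatorname{ou}}_g\widetilde C^*+\widetilde C\widetilde{\mathscr P}^{\operatorname{ou}}\widetilde C^*\big)\Big)^{1/2}\\&+\|v\|_{L^2(\Omega)}\Big(\operatorname{tr}\big(CP_0C^*-2CP_{0,g}\widetilde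 C^{(0)*}+\widetilde C^{(0)}\widetilde P_0\widetilde C^{(0)*}\big)\Big)^{1/2}\\&+\sqrt T\big(\operatorname{tr}(\widetilde C\widetilde P_1\widetilde C^* )\big)^{1/2}\|u-\widetilde u\|_{L^2(\Omega_T)},\end{aligned}$$ where $P_0,P_{0,g},\widetilde P_0$ are the solutions of $$AP_0+P_0A^*=-B_{\operatorname{in}}B_{\operatorname{in}}^*,\quad AP_{0,g}+P_{0,g}\widetilde A^{(0)*}=-B_{\operatorname{in}}\widetilde B_{\operatorname{in}}^*,\quad \widetilde A^{(0)}\widetilde P_0+\widetilde P_0\widetilde A^{(0)*}=-\widetilde B_{\operatorname{in}}\widetilde B_{\operatorname{in}}^*.$$
   Context: $(\Omega,\mathcal F,\mathbb P)$ is a fixed probability space; all Hilbert spaces are (real and) separable. $(M_t)_{t\ge0}$ is an $\mathbb R^d$-valued square-integrable mean-zero Lévy process with induced filtration $(\mathcal F_t)$. An Ornstein-Uhlenbeck (OU) system $(A,B,K,C)$ on $X$ consists of the generator $A$ of a $C_0$-semigroup $(T_t)_{t\ge0}$ on $X$ and bounded linear maps $B:\mathbb R^m\to X$, $K:\mathbb R^d\to X$, $C:X\to\mathcal H$. A semigroup is exponentially stable if $\|T_t\|\le\nu e^{-\omega t}$ for all $t\ge0$, for some $\omega>0,\nu\ge1$; a system is exponentially stable if its semigroup is. Given a control $u$ and initial state $\xi\in L^2(\Omega,\mathcal F_0,X)$, the state $Z$ is the mild solution of $\mathrm dZ_t=AZ_t\,\mathrm dt+Bu_t\,\mathrm dt+K\,\mathrm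 dM_t$, $Z_0=\xi$, and the output is $$Y_t=CZ_t=CT_t\xi+\int_0^tCT_{t-s}K\,\mathrm dM_s+\int_0^tCT_{t-s}Bu_s\,\mathrm ds.$$ The second system has semigroup $(\widetilde T_t)$. Initial states: $B_{\operatorname{in}}:\mathbb R^k\to X$, $B_{\operatorname{in}}v=\sum_{i=1}^k\langle v,\widehat e_i\rangle\phi_i$, with $(\widehat e_i)$ the standard basis of $\mathbb R^k$ and $(\phi_i)_{i=1}^k$ an orthonormal family in $L^2(\Omega,\mathcal F_0,X)$; since $\mathcal F_0$ is generated by $M_0=0$, the $\phi_i$ are regarded as deterministic vectors of $X$. Here $v\in L^2(\Omega,\mathcal F_0,\mathbb R^k)$. $\Omega_T:=\Omega\times(0,T)$, $\|f\|_{L^2(\Omega_T)}^2=\mathbb E\int_0^T\|f(t)\|^2\,\mathrm dt$, $L^2_{\operatorname{ad}}$ denotes adapted processes in $L^2$; $a\vee b=\max(a,b)$. Let $B_1:=B$, $B_2:=K\sqrt{\mathbb E(M_1M_1^* )}$, $\widetilde B_1:=\widetilde B$, $\widetilde B_2:=\widetilde K\sqrt{\mathbb E(M_1M_1^* )}$. For $i\in\{1,2\}$ (integrals in the weak sense) $$P_i:=\int_0^\infty T_sB_iB_i^*T_s^*\,\mathrm ds,\quad P_{i,g}:=\int_0^\infty T_sB_i\widetilde B_i^*\widetilde T_s^*\,\mathrm ds,\quad \widetilde P_i:=\int_0^\infty\widetilde T_s\widetilde B_i\widetilde B_i^*\widetilde T_s^*\,\mathrm ds,$$ and $\mathscr P^{\operatorname{ou}}:=P_1+P_2$,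 $\mathscr P^{\operatorname{ou}}_g:=P_{1,g}+P_{2,g}$, $\widetilde{\mathscr P}^{\operatorname{ou}}:=\widetilde P_1+\widetilde P_2$. Lyapunov equations are understood weakly on the domains of the adjoints of the generators; explicitly $P_0=\int_0^\infty T_sB_{\operatorname{in}}B_{\operatorname{in}}^*T_s^*\,\mathrm ds$, $P_{0,g}=\int_0^\infty T_sB_{\operatorname{in}}\widetilde B_{\operatorname{in}}^*\widetilde T_s^{(0)*}\,\mathrm ds$, $\widetilde P_0=\int_0^\infty\widetilde T^{(0)}_s\widetilde B_{\operatorname{in}}\widetilde B_{\operatorname{in}}^*\widetilde T^{(0)*}_s\,\mathrm ds$. *)

theory Defs
  imports "HOL-Probability.Probability"
begin

text \<open>
  A real separable Hilbert space is a type of sort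
  \<open>{real_inner, banach, second_countable_topology}\<close>. Operators are plain functions, assumed
  or shown to be bounded linear where necessary; Hilbert space adjoints of bounded operators are
  taken with the library's \<open>adjoint\<close>.
\<close>

text \<open>Only the values \<open>S t\<close> with \<open>t \<ge> 0\<close> matter.\<close>

definition c0_semigroup :: "(real \<Rightarrow> 'x::real_normed_vector \<Rightarrow> 'x) \<Rightarrow> bool" where
  "c0_semigroup S \<longleftrightarrow>
     (\<forall>t\<ge>0. bounded_linear (S t)) \<and>
     (\<forall>x. S 0 x = x) \<and>
     (\<forall>s\<ge>0. \<forall>t\<ge>0. \<forall>x. S (s + t) x = S s (S t x)) \<and>
     (\<forall>x. ((\<lambda>t. S t x) \<longlongrightarrow> x) (at_right 0))"

text \<open>Unbounded operators are represented by their graphs.\<close>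

definition generator :: "(real \<Rightarrow> 'x::real_normed_vector \<Rightarrow> 'x) \<Rightarrow> ('x \<times> 'x) set" where
  "generator S = {(x, y). ((\<lambda>h. (S h x - x) /\<^sub>R h) \<longlongrightarrow> y) (at_right 0)}"

definition exponentially_stable :: "(real \<Rightarrow> 'x::real_normed_vector \<Rightarrow> 'x) \<Rightarrow> bool" where
  "exponentially_stable S \<longleftrightarrow>
     (\<exists>\<omega>>0. \<exists>\<nu>\<ge>1. \<forall>t\<ge>0. onorm (S t) \<le> \<nu> * exp (- \<omega> * t))"

text \<open>The graph of the adjoint; for a densely defined operator it is single-valued.\<close>

definition adjoint_graph :: "('x::real_inner \<times> 'x) set \<Rightarrow> ('x \<times> 'x) set" where
  "adjoint_graph A = {(x, z). \<forall>(a, b)\<in>A. b \<bullet> x = a \<bullet> z}"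

text \<open>
  Weak form of \<open>A P + P A'\<^sup>* = - G G'\<^sup>*\<close>, tested with \<open>x\<close> in the domain of \<open>A\<^sup>*\<close> and \<open>y\<close> in the
  domain of \<open>A'\<^sup>*\<close>; below, \<open>x'\<close> is \<open>A\<^sup>* x\<close> and \<open>y'\<close> is \<open>A'\<^sup>* y\<close>.
\<close>

definition lyapunov_solution ::
  "('x::real_inner \<times> 'x) set \<Rightarrow> ('y::real_inner \<times> 'y) set \<Rightarrow>
   ('a::real_inner \<Rightarrow> 'x) \<Rightarrow> ('a \<Rightarrow> 'y) \<Rightarrow> ('y \<Rightarrow> 'x) \<Rightarrow> bool" where
  "lyapunov_solution A A' G G' P \<longleftrightarrow>
     bounded_linear P \<and>
     (\<forall>(x, x')\<in>adjoint_graph A. \<forall>(y, y')\<in>adjoint_graph A'.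
        P y \<bullet> x' + P y' \<bullet> x = - (G (adjoint G' y) \<bullet> x))"

definition weak_operator_integral ::
  "(real \<Rightarrow> 'y::real_inner \<Rightarrow> 'x::real_inner) \<Rightarrow> 'y \<Rightarrow> 'x" where
  "weak_operator_integral F = (THE P. bounded_linear P \<and>
     (\<forall>y x. set_integrable lborel {0..} (\<lambda>s. F s y \<bullet> x) \<and>
            P y \<bullet> x = (LBINT s:{0..}. F s y \<bullet> x)))"

text \<open>\<open>\<integral>\<^sub>0\<^sup>\<infinity> S\<^sub>s G G'\<^sup>* S'\<^sub>s\<^sup>* ds\<close>\<close>

definition gramian ::
  "(real \<Rightarrow> 'x::real_inner \<Rightarrow> 'x) \<Rightarrow> ('a::real_inner \<Rightarrow> 'x) \<Rightarrow>
   (real \<Rightarrow> 'y::real_inner \<Rightarrow> 'y) \<Rightarrow> ('a \<Rightarrow> 'y) \<Rightarrow> 'y \<Rightarrow> 'x" where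
  "gramian S G S' G' =
     weak_operator_integral (\<lambda>s y. S s (G (adjoint G' (adjoint (S' s) y))))"

definition hilbert_basis :: "'h::real_inner set \<Rightarrow> bool" where
  "hilbert_basis E \<longleftrightarrow>
     (\<forall>e\<in>E. norm e = 1) \<and> (\<forall>e\<in>E. \<forall>f\<in>E. e \<noteq> f \<longrightarrow> e \<bullet> f = 0) \<and> closure (span E) = UNIV"

text \<open>
  For a trace-class operator the diagonal sum converges and is the same for every orthonormal
  basis; \<open>trace_operator\<close> is this common value.
\<close>

definition trace_operator :: "('h::real_inner \<Rightarrow> 'h) \<Rightarrow> real" where
  "trace_operator R = (THE r. \<forall>E. hilbert_basis E \<longrightarrow> ((\<lambda>e. R e \<bullet> e) has_sum r) E)"

text \<open>
  Stochastic continuity is required instead of right-continuous paths with left limits: every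
  such process has a version with the latter property.
\<close>

definition levy_process :: "'w measure \<Rightarrow> (real \<Rightarrow> 'w \<Rightarrow> real ^ 'd) \<Rightarrow> bool" where
  "levy_process M L \<longleftrightarrow>
     (\<forall>t\<ge>0. L t \<in> borel_measurable M) \<and>
     (AE \<omega> in M. L 0 \<omega> = 0) \<and>
     (\<forall>n::nat. \<forall>p::nat \<Rightarrow> real. 0 \<le> p 0 \<and> (\<forall>i<n. p i \<le> p (Suc i)) \<longrightarrow>
        prob_space.indep_vars M (\<lambda>_. borel) (\<lambda>i \<omega>. L (p (Suc i)) \<omega> - L (p i) \<omega>) {..<n}) \<and>
     (\<forall>s\<ge>0. \<forall>t\<ge>s. distr M borel (\<lambda>\<omega>. L t \<omega> - L s \<omega>) = distr M borel (L (t - s))) \<and>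
     (\<forall>t\<ge>0. \<forall>\<epsilon>>0.
        ((\<lambda>s. measure M {\<omega> \<in> space M. norm (L s \<omega> - L t \<omega>) > \<epsilon>}) \<longlongrightarrow> 0) (at t within {0..}))"

definition square_integrable_mean_zero :: "'w measure \<Rightarrow> (real \<Rightarrow> 'w \<Rightarrow> real ^ 'd) \<Rightarrow> bool" where
  "square_integrable_mean_zero M L \<longleftrightarrow>
     (\<forall>t\<ge>0. integrable M (\<lambda>\<omega>. (norm (L t \<omega>))\<^sup>2) \<and> (\<integral>\<omega>. L t \<omega> \<partial>M) = 0)"

definition induced_filtration ::
  "'w measure \<Rightarrow> (real \<Rightarrow> 'w \<Rightarrow> real ^ 'd) \<Rightarrow> real \<Rightarrow> 'w measure" where
  "induced_filtration M L t =
     sigma (space M) {L s -` U \<inter> space M | s U. 0 \<le> s \<and> s \<le> t \<and> U \<in> sets borel}"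

text \<open>\<open>E(M\<^sub>1 M\<^sub>1\<^sup>*)\<close>\<close>

definition covariance :: "'w measure \<Rightarrow> (real \<Rightarrow> 'w \<Rightarrow> real ^ 'd) \<Rightarrow> real ^ 'd ^ 'd" where
  "covariance M L = (\<chi> i j. \<integral>\<omega>. (L 1 \<omega> $ i) * (L 1 \<omega> $ j) \<partial>M)"

text \<open>The positive semidefinite square root, which is unique.\<close>

definition psd_sqrt :: "real ^ 'd ^ 'd \<Rightarrow> real ^ 'd ^ 'd" where
  "psd_sqrt Q = (SOME R. transpose R = R \<and> (\<forall>x. 0 \<le> (R *v x) \<bullet> x) \<and> R ** R = Q)"

text \<open>\<open>K \<surd>(E(M\<^sub>1 M\<^sub>1\<^sup>*))\<close>\<close>

definition noise_input ::
  "'w measure \<Rightarrow> (real \<Rightarrow> 'w \<Rightarrow> real ^ 'd) \<Rightarrow> (real ^ 'd \<Rightarrow> 'x) \<Rightarrow> real ^ 'd \<Rightarrow> 'x" where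
  "noise_input M L K = (\<lambda>x. K (psd_sqrt (covariance M L) *v x))"

definition L2_fun :: "'a measure \<Rightarrow> ('a \<Rightarrow> 'b::real_normed_vector) \<Rightarrow> bool" where
  "L2_fun N f \<longleftrightarrow> f \<in> borel_measurable N \<and> integrable N (\<lambda>x. (norm (f x))\<^sup>2)"

definition L2_norm :: "'a measure \<Rightarrow> ('a \<Rightarrow> 'b::real_normed_vector) \<Rightarrow> real" where
  "L2_norm N f = sqrt (\<integral>x. (norm (f x))\<^sup>2 \<partial>N)"

text \<open>\<open>\<Omega>\<^sub>T = \<Omega> \<times> (0, T)\<close> with the product measure\<close>

definition Omega_T :: "'w measure \<Rightarrow> real \<Rightarrow> ('w \<times> real) measure" where
  "Omega_T M T = M \<Otimes>\<^sub>M restrict_space lborel {0<..<T}"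

definition L2_proc :: "'w measure \<Rightarrow> real \<Rightarrow> (real \<Rightarrow> 'w \<Rightarrow> 'b::real_normed_vector) \<Rightarrow> bool" where
  "L2_proc M T f \<longleftrightarrow> L2_fun (Omega_T M T) (\<lambda>(\<omega>, t). f t \<omega>)"

definition L2_proc_norm ::
  "'w measure \<Rightarrow> real \<Rightarrow> (real \<Rightarrow> 'w \<Rightarrow> 'b::real_normed_vector) \<Rightarrow> real" where
  "L2_proc_norm M T f = L2_norm (Omega_T M T) (\<lambda>(\<omega>, t). f t \<omega>)"

definition L2_adapted ::
  "'w measure \<Rightarrow> (real \<Rightarrow> 'w \<Rightarrow> real ^ 'd) \<Rightarrow> real \<Rightarrow> (real \<Rightarrow> 'w \<Rightarrow> 'b::real_normed_vector) \<Rightarrow> bool"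
  where
  "L2_adapted M L T f \<longleftrightarrow>
     L2_proc M T f \<and> (\<forall>t\<in>{0<..<T}. f t \<in> borel_measurable (induced_filtration M L t))"

text \<open>
  A list of triples \<open>(a, b, \<Phi>)\<close> represents the step function
  \<open>s \<mapsto> \<Sum> indicator (a, b] s \<cdot> \<Phi>\<close> on \<open>[0, t]\<close>; its integral against \<open>L\<close> is
  \<open>\<Sum> \<Phi> (L\<^sub>b - L\<^sub>a)\<close>.
\<close>

definition steps_on :: "real \<Rightarrow> (real \<times> real \<times> ('v::real_normed_vector \<Rightarrow> 'x::real_normed_vector)) list \<Rightarrow> bool"
  where
  "steps_on t ps \<longleftrightarrow> (\<forall>(a, b, \<Phi>)\<in>set ps. 0 \<le> a \<and> a \<le> b \<and> b \<le> t \<and> bounded_linear \<Phi>)"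

definition step_value :: "(real \<times> real \<times> ('v \<Rightarrow> 'x::real_vector)) list \<Rightarrow> real \<Rightarrow> 'v \<Rightarrow> 'x" where
  "step_value ps s x = (\<Sum>(a, b, \<Phi>)\<leftarrow>ps. indicator {a<..b} s *\<^sub>R \<Phi> x)"

definition step_integral ::
  "(real \<Rightarrow> 'w \<Rightarrow> 'v::real_vector) \<Rightarrow> (real \<times> real \<times> ('v \<Rightarrow> 'x::real_vector)) list \<Rightarrow> 'w \<Rightarrow> 'x" where
  "step_integral L ps \<omega> = (\<Sum>(a, b, \<Phi>)\<leftarrow>ps. \<Phi> (L b \<omega> - L a \<omega>))"

text \<open>
  \<open>I\<close> is a version of \<open>\<integral>\<^sub>0\<^sup>t F(s) dL\<^sub>s\<close>: the Ito integral, i.e. the isometric extension from step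
  functions, which converge to \<open>F\<close> in \<open>L\<^sup>2\<close> for the Hilbert-Schmidt norm while their integrals
  converge to \<open>I\<close> in \<open>L\<^sup>2(\<Omega>)\<close>. By the Ito isometry \<open>I\<close> is determined up to null sets.
\<close>

definition is_stochastic_integral ::
  "'w measure \<Rightarrow> (real \<Rightarrow> 'w \<Rightarrow> real ^ 'd) \<Rightarrow> real \<Rightarrow>
   (real \<Rightarrow> real ^ 'd \<Rightarrow> 'x::real_normed_vector) \<Rightarrow> ('w \<Rightarrow> 'x) \<Rightarrow> bool" where
  "is_stochastic_integral M L t F I \<longleftrightarrow>
     (\<forall>x. (\<lambda>s. F s x) \<in> borel_measurable (restrict_space lborel {0..t})) \<and>
     I \<in> borel_measurable M \<and>
     (\<exists>ps :: nat \<Rightarrow> (real \<times> real \<times> (real ^ 'd \<Rightarrow> 'x)) list.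
        (\<forall>n. steps_on t (ps n)) \<and>
        ((\<lambda>n. \<integral>\<^sup>+s\<in>{0..t}. ennreal (\<Sum>b\<in>Basis. (norm (F s b - step_value (ps n) s b))\<^sup>2) \<partial>lborel)
            \<longlonglongrightarrow> 0) \<and>
        ((\<lambda>n. \<integral>\<^sup>+\<omega>. ennreal ((norm (I \<omega> - step_integral L (ps n) \<omega>))\<^sup>2) \<partial>M) \<longlonglongrightarrow> 0))"

text \<open>\<open>S\<close> is the semigroup generated by \<open>A\<close>.\<close>

definition ou_system ::
  "('x::real_normed_vector \<times> 'x) set \<Rightarrow> (real \<Rightarrow> 'x \<Rightarrow> 'x) \<Rightarrow> (real ^ 'm \<Rightarrow> 'x) \<Rightarrow>
   (real ^ 'd \<Rightarrow> 'x) \<Rightarrow> ('x \<Rightarrow> 'h::real_normed_vector) \<Rightarrow> bool" where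
  "ou_system A S B K C \<longleftrightarrow>
     c0_semigroup S \<and> A = generator S \<and> bounded_linear B \<and> bounded_linear K \<and> bounded_linear C"

text \<open>
  \<open>Z\<close> is a jointly measurable mild solution on \<open>[0, T]\<close> of
  \<open>dZ = A Z dt + B u dt + K dL\<close>, \<open>Z\<^sub>0 = \<xi>\<close>. The identity determines every \<open>Z\<^sub>t\<close> up to null sets;
  adaptedness is not imposed separately, since each \<open>Z\<^sub>t\<close> is already a.s. equal to a random
  variable measurable for the induced filtration when \<open>u\<close> and \<open>\<xi>\<close> are adapted.
\<close>

definition mild_solution ::
  "'w measure \<Rightarrow> (real \<Rightarrow> 'w \<Rightarrow> real ^ 'd) \<Rightarrow> real \<Rightarrow>
   (real \<Rightarrow> 'x::{real_inner, banach, second_countable_topology} \<Rightarrow> 'x) \<Rightarrow> (real ^ 'm \<Rightarrow> 'x) \<Rightarrow>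
   (real ^ 'd \<Rightarrow> 'x) \<Rightarrow> (real \<Rightarrow> 'w \<Rightarrow> real ^ 'm) \<Rightarrow> ('w \<Rightarrow> 'x) \<Rightarrow> (real \<Rightarrow> 'w \<Rightarrow> 'x) \<Rightarrow> bool" where
  "mild_solution M L T S B K u \<xi> Z \<longleftrightarrow>
     (\<lambda>(\<omega>, t). Z t \<omega>) \<in> borel_measurable (M \<Otimes>\<^sub>M restrict_space lborel {0..T}) \<and>
     (\<forall>t\<in>{0..T}. \<exists>I. is_stochastic_integral M L t (\<lambda>s x. S (t - s) (K x)) I \<and>
        (AE \<omega> in M. Z t \<omega> = S t (\<xi> \<omega>) + I \<omega> + (LBINT s:{0<..<t}. S (t - s) (B (u s \<omega>)))))"

definition ou_output ::
  "'w measure \<Rightarrow> (real \<Rightarrow> 'w \<Rightarrow> real ^ 'd) \<Rightarrow> real \<Rightarrow>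
   (real \<Rightarrow> 'x::{real_inner, banach, second_countable_topology} \<Rightarrow> 'x) \<Rightarrow> (real ^ 'm \<Rightarrow> 'x) \<Rightarrow>
   (real ^ 'd \<Rightarrow> 'x) \<Rightarrow> ('x \<Rightarrow> 'h) \<Rightarrow> (real \<Rightarrow> 'w \<Rightarrow> real ^ 'm) \<Rightarrow> ('w \<Rightarrow> 'x) \<Rightarrow>
   (real \<Rightarrow> 'w \<Rightarrow> 'h) \<Rightarrow> bool" where
  "ou_output M L T S B K C u \<xi> Y \<longleftrightarrow>
     (\<exists>Z. mild_solution M L T S B K u \<xi> Z \<and> (\<forall>t\<in>{0..T}. \<forall>\<omega>\<in>space M. Y t \<omega> = C (Z t \<omega>)))"

definition initial_input :: "('k::finite \<Rightarrow> 'x::real_vector) \<Rightarrow> real ^ 'k \<Rightarrow> 'x" where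
  "initial_input \<phi> v = (\<Sum>i\<in>UNIV. (v $ i) *\<^sub>R \<phi> i)"

definition orthonormal_family :: "('k \<Rightarrow> 'x::real_inner) \<Rightarrow> bool" where
  "orthonormal_family \<phi> \<longleftrightarrow> (\<forall>i j. \<phi> i \<bullet> \<phi> j = (if i = j then 1 else 0))"

end

theory Submission
  imports Defs
begin

text \<open>
  Write \<open>\<Gamma>\<^sub>G(r) = C S\<^sub>r G - C' S'\<^sub>r G'\<close> for the difference of the impulse responses of the two systems
  to matching inputs \<open>G\<close>, \<open>G'\<close>. By variation of constants the output error at time \<open>t\<close> splits
  almost surely into four terms:
  \<^item> the response \<open>\<Gamma>(t) v\<close> to the initial state, for the pair of inputs \<open>Bin\<close>, \<open>Bin'\<close>, where the
    second system consists of \<open>S0\<close> and \<open>C0\<close>;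
  \<^item> the noise \<open>\<integral>\<^sub>0\<^sup>t \<Gamma>(t - s) dL\<^sub>s\<close>, for the pair \<open>K\<close>, \<open>K'\<close>;
  \<^item> the control convolution \<open>\<integral>\<^sub>0\<^sup>t \<Gamma>(t - s) u\<^sub>s ds\<close>, for the pair \<open>B\<close>, \<open>B'\<close>;
  \<^item> the convolution \<open>\<integral>\<^sub>0\<^sup>t C' S'\<^sub>t\<^sub>-\<^sub>s B' (u\<^sub>s - u'\<^sub>s) ds\<close>, which accounts for the change of control.

  Each term is bounded in mean square by the energy of its impulse response, i.e. by
  \<open>\<integral>\<^sub>0\<^sup>\<infinity> \<parallel>\<Gamma>(r)\<parallel>\<^sup>2 dr\<close> with the Hilbert-Schmidt norm: the first term directly, the convolutions by the
  Cauchy-Schwarz inequality in time (\<open>convolution_mean_square\<close>), the noise by the Ito isometry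
  (\<open>stochastic_integral_bound\<close>), where replacing \<open>K\<close> by \<open>K R\<close>, with \<open>R\<close> the square root of the
  covariance of \<open>L\<^sub>1\<close>, reduces the isometry to that of a standard Brownian motion. Integration over \<open>(0, T)\<close> costs a factor
  \<open>T\<close> for the last three terms, and Minkowski's inequality adds the bounds. Finally
  \<open>a + b \<le> sqrt (2 (a\<^sup>2 + b\<^sup>2))\<close> merges the control term and the noise term.

  The traces in the bound are these energies. Expanding \<open>\<parallel>\<Gamma>(r)\<^sup>* e\<parallel>\<^sup>2\<close> for a unit vector \<open>e\<close> and
  integrating gives the quadratic form at \<open>e\<close> of the operator under the trace, because the Gramians
  are weak integrals over time; Parseval's identity and dominated convergence sum this over an
  orthonormal basis (\<open>has_trace_error\<close>). For the Gramians of the initial state one has to know that a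
  solution of the weak Lyapunov equation is the weak integral
  (\<open>lyapunov_solution_is_gramian\<close>): along the adjoint semigroups the derivative of
  \<open>P S'\<^sub>t\<^sup>* y \<bullet> S\<^sub>t\<^sup>* x\<close> is minus the integrand, and the expression vanishes at infinity.
\<close>

section \<open>Hilbert spaces: adjoints, orthonormal bases and traces\<close>

lemma linear_coefficient_zero:
  fixes c n :: real
  assumes "\<And>t. 0 \<le> 2 * t * c + t\<^sup>2 * n" and "0 \<le> n"
  shows "c = 0"
proof (cases "n = 0")
  case True
  with assms(1)[of "- c"] show ?thesis by (simp add: algebra_simps flip: power2_eq_square)
next
  case False
  then have n: "n > 0" using assms(2) by simp
  have "0 \<le> 2 * (- c / n) * c + (- c / n)\<^sup>2 * n" by (rule assms(1))
  also have "\<dots> = - (c\<^sup>2 / n)"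
    using n by (simp add: field_simps power2_eq_square)
  finally show ?thesis using n by (simp add: divide_le_0_iff)
qed

text \<open>
  The representing vector minimizes \<open>x \<bullet> x - 2 f x\<close>. By the parallelogram identity every minimizing
  sequence is Cauchy, and the first variation at the minimizer vanishes.
\<close>
theorem riesz_representation:
  fixes f :: "'a::{real_inner, banach} \<Rightarrow> real"
  assumes "bounded_linear f"
  shows "\<exists>z. \<forall>x. f x = x \<bullet> z"
proof -
  interpret f: bounded_linear f by fact
  obtain K where K: "\<And>x. norm (f x) \<le> norm x * K"
    using f.bounded by blast
  define q where "q x = x \<bullet> x - 2 * f x" for x
  have q_lower: "- K\<^sup>2 \<le> q x" for x
  proof -
    have "f x \<le> norm x * K" using K[of x] by simp
    moreover have "0 \<le> (norm x - K)\<^sup>2" by simp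
    ultimately show ?thesis
      by (simp add: q_def power2_eq_square algebra_simps dot_square_norm)
  qed
  define m where "m = Inf (range q)"
  have bdd: "bdd_below (range q)" using q_lower by (intro bdd_belowI[of _ "- K\<^sup>2"]) auto
  have m_le: "m \<le> q x" for x unfolding m_def using bdd by (intro cInf_lower) auto
  have "\<exists>x. q x < m + 1 / real (Suc n)" for n
  proof -
    have "m < m + 1 / real (Suc n)" by simp
    then show ?thesis
      unfolding m_def using cInf_lessD[of "range q" "Inf (range q) + 1 / real (Suc n)"] by auto
  qed
  then obtain X where X: "\<And>n. q (X n) < m + 1 / real (Suc n)" by metis
  have par: "(norm (x - y))\<^sup>2 \<le> 2 * (q x - m) + 2 * (q y - m)" for x y
  proof -
    have "4 * q ((1/2) *\<^sub>R (x + y)) + (norm (x - y))\<^sup>2 = 2 * q x + 2 * q y"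
      by (simp add: q_def f.add f.scaleR inner_add inner_diff inner_commute power2_norm_eq_inner
          field_simps)
    with m_le[of "(1/2) *\<^sub>R (x + y)"] show ?thesis by argo
  qed
  have "Cauchy X"
  proof (rule metric_CauchyI)
    fix e :: real assume e: "e > 0"
    obtain N where N: "1 / real (Suc N) < e\<^sup>2 / 4"
      using e by (metis nat_approx_posE zero_less_divide_iff zero_less_numeral zero_less_power)
    have "dist (X i) (X j) < e" if "i \<ge> N" "j \<ge> N" for i j
    proof -
      have "1 / real (Suc i) \<le> 1 / real (Suc N)" "1 / real (Suc j) \<le> 1 / real (Suc N)"
        using that by (auto intro!: divide_left_mono)
      then have "(norm (X i - X j))\<^sup>2 < e\<^sup>2"
        using par[of "X i" "X j"] X[of i] X[of j] N by argo
      then show ?thesis using e by (simp add: dist_norm power2_less_imp_less)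
    qed
    then show "\<exists>N. \<forall>i\<ge>N. \<forall>j\<ge>N. dist (X i) (X j) < e" by blast
  qed
  then obtain z where z: "X \<longlonglongrightarrow> z" by (auto simp: Cauchy_convergent_iff convergent_def)
  have "(\<lambda>n. q (X n)) \<longlonglongrightarrow> q z"
    unfolding q_def by (intro tendsto_intros f.tendsto z)
  moreover have "(\<lambda>n. m + 1 / real (Suc n)) \<longlonglongrightarrow> m"
    using tendsto_add[OF tendsto_const[of m] LIMSEQ_Suc[OF lim_1_over_n]] by simp
  ultimately have "q z \<le> m"
    by (rule LIMSEQ_le) (use X in \<open>auto intro: less_imp_le\<close>)
  then have qz: "q z \<le> q x" for x using m_le[of x] by linarith
  have "z \<bullet> x - f x = 0" for x
  proof (rule linear_coefficient_zero)
    show "0 \<le> 2 * t * (z \<bullet> x - f x) + t\<^sup>2 * (x \<bullet> x)" for t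
      using qz[of "z + t *\<^sub>R x"]
      by (simp add: q_def f.add f.scaleR algebra_simps power2_eq_square inner_commute)
  qed simp
  then show ?thesis by (metis eq_iff_diff_eq_0 inner_commute)
qed

text \<open>The defining property of the adjoint on a Hilbert space, by Riesz representation.\<close>
lemma inner_adjoint:
  fixes f :: "'a::{real_inner, banach} \<Rightarrow> 'b::real_inner"
  assumes "bounded_linear f"
  shows "x \<bullet> adjoint f y = f x \<bullet> y"
proof -
  have "\<forall>y. \<exists>z. \<forall>x. f x \<bullet> y = x \<bullet> z"
    using riesz_representation[OF bounded_linear_inner_left_comp[OF assms]] by blast
  then have "\<exists>g. \<forall>x y. f x \<bullet> y = x \<bullet> g y"
    by (metis (no_types))
  then have "\<forall>x y. f x \<bullet> y = x \<bullet> adjoint f y"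
    unfolding adjoint_def by (rule someI_ex)
  then show ?thesis by simp
qed

lemma adjoint_inner:
  fixes f :: "'a::{real_inner, banach} \<Rightarrow> 'b::real_inner"
  assumes "bounded_linear f"
  shows "adjoint f y \<bullet> x = y \<bullet> f x"
  using inner_adjoint[OF assms] by (metis inner_commute)

lemma norm_le_if_inner_le:
  fixes x :: "'a::real_inner"
  assumes "\<And>y. \<bar>x \<bullet> y\<bar> \<le> c * norm y" and "0 \<le> c"
  shows "norm x \<le> c"
proof (cases "x = 0")
  case False
  have "norm x * norm x \<le> c * norm x"
    using assms(1)[of x] by (simp add: dot_square_norm power2_eq_square)
  with False show ?thesis by simp
qed (use assms in simp)

lemma
  fixes f :: "'a::{real_inner, banach} \<Rightarrow> 'b::real_inner"
  assumes f: "bounded_linear f"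
  shows norm_adjoint_le: "norm (adjoint f y) \<le> onorm f * norm y"
    and bounded_linear_adjoint: "bounded_linear (adjoint f)"
proof -
  show *: "norm (adjoint f y) \<le> onorm f * norm y" for y
  proof (rule norm_le_if_inner_le)
    fix x
    have "\<bar>adjoint f y \<bullet> x\<bar> = \<bar>y \<bullet> f x\<bar>" by (simp add: adjoint_inner[OF f])
    also have "\<dots> \<le> norm y * norm (f x)" by (rule Cauchy_Schwarz_ineq2)
    also have "\<dots> \<le> norm y * (onorm f * norm x)"
      by (intro mult_left_mono onorm f) auto
    finally show "\<bar>adjoint f y \<bullet> x\<bar> \<le> onorm f * norm y * norm x" by (simp add: ac_simps)
  qed (simp add: onorm_pos_le f)
  show "bounded_linear (adjoint f)"
  proof (rule bounded_linear_intro)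
    show "adjoint f (x + y) = adjoint f x + adjoint f y" for x y
      by (rule vector_eq_ldot[THEN iffD1])
        (simp add: inner_adjoint[OF f] inner_add_right)
    show "adjoint f (r *\<^sub>R x) = r *\<^sub>R adjoint f x" for r x
      by (rule vector_eq_ldot[THEN iffD1]) (simp add: inner_adjoint[OF f])
    show "norm (adjoint f x) \<le> norm x * onorm f" for x using *[of x] by (simp add: ac_simps)
  qed
qed

definition orthonormal_set :: "'h::real_inner set \<Rightarrow> bool" where
  "orthonormal_set E \<longleftrightarrow> (\<forall>e\<in>E. norm e = 1) \<and> (\<forall>e\<in>E. \<forall>f\<in>E. e \<noteq> f \<longrightarrow> e \<bullet> f = 0)"

lemma hilbert_basis_orthonormal: "hilbert_basis E \<Longrightarrow> orthonormal_set E"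
  by (simp add: hilbert_basis_def orthonormal_set_def)

lemma inner_orthonormal_sum:
  assumes "orthonormal_set E" "finite E" "f \<in> E"
  shows "(\<Sum>e\<in>E. c e *\<^sub>R e) \<bullet> f = c f"
proof -
  have "(\<Sum>e\<in>E. c e *\<^sub>R e) \<bullet> f = (\<Sum>e\<in>E. if e = f then c f else 0)"
    unfolding inner_sum_left using assms
    by (intro sum.cong) (auto simp: orthonormal_set_def dot_square_norm)
  then show ?thesis using assms by simp
qed

lemma gram_schmidt_step:
  assumes "finite E" "orthonormal_set E"
  shows "\<exists>F. finite F \<and> orthonormal_set F \<and> E \<subseteq> F \<and> x \<in> span F"
proof -
  define p where "p = (\<Sum>e\<in>E. (x \<bullet> e) *\<^sub>R e)"
  define r where "r = x - p"
  have p: "p \<in> span E" unfolding p_def by (intro span_sum span_scale span_base)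
  have r: "r \<bullet> e = 0" if "e \<in> E" for e
    using inner_orthonormal_sum[OF assms(2,1) that] by (simp add: r_def p_def inner_diff_left)
  show ?thesis
  proof (cases "r = 0")
    case True
    with p assms show ?thesis by (intro exI[of _ E]) (auto simp: r_def)
  next
    case False
    let ?F = "insert (r /\<^sub>R norm r) E"
    have "p \<in> span ?F" using p span_mono[of E ?F] by auto
    moreover have "norm r *\<^sub>R (r /\<^sub>R norm r) \<in> span ?F" by (intro span_scale span_base) simp
    ultimately have "p + norm r *\<^sub>R (r /\<^sub>R norm r) \<in> span ?F" by (rule span_add)
    moreover have "x = p + norm r *\<^sub>R (r /\<^sub>R norm r)" using False by (simp add: r_def)
    ultimately have "x \<in> span ?F" by simp
    moreover have "orthonormal_set ?F"
      using assms(2) r False unfolding orthonormal_set_def by (auto simp: inner_commute)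
    ultimately show ?thesis using assms by (intro exI[of _ ?F]) auto
  qed
qed

text \<open>Gram-Schmidt orthonormalization of a countable dense set.\<close>
theorem hilbert_basis_exists:
  "\<exists>E :: 'h::{real_inner, second_countable_topology} set. hilbert_basis E"
proof -
  obtain D :: "'h set" where D: "countable D" "\<And>X. open X \<Longrightarrow> X \<noteq> {} \<Longrightarrow> \<exists>d\<in>D. d \<in> X"
    using countable_dense_setE by metis
  have "D \<noteq> {}" using D(2)[of UNIV] by auto
  then have rD: "range (from_nat_into D) = D" using D(1) by (simp add: range_from_nat_into)
  have "\<exists>F. \<forall>n. (finite (F n) \<and> orthonormal_set (F n)) \<and>
          (F n \<subseteq> F (Suc n) \<and> from_nat_into D n \<in> span (F (Suc n)))"
  proof (rule dependent_nat_choice)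
    show "\<exists>F :: 'h set. finite F \<and> orthonormal_set F"
      by (rule exI[of _ "{}"]) (simp add: orthonormal_set_def)
  qed (use gram_schmidt_step in blast)
  then obtain F where F: "\<And>n. finite (F n)" "\<And>n. orthonormal_set (F n)"
     "\<And>n. F n \<subseteq> F (Suc n)" "\<And>n. from_nat_into D n \<in> span (F (Suc n))" by auto
  define E where "E = (\<Union>n. F n)"
  have mono: "F i \<subseteq> F j" if "i \<le> j" for i j
    using that F(3) by (rule lift_Suc_mono_le[rotated])
  have "orthonormal_set E"
  proof -
    have "norm e = 1" if "e \<in> E" for e using that F(2) by (auto simp: E_def orthonormal_set_def)
    moreover have "e \<bullet> f = 0" if ef: "e \<in> E" "f \<in> E" "e \<noteq> f" for e f
    proof -
      obtain i j where "e \<in> F i" "f \<in> F j" using ef by (auto simp: E_def)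
      then have "e \<in> F (max i j)" "f \<in> F (max i j)" using mono[of i "max i j"] mono[of j "max i j"] by auto
      then show ?thesis using F(2)[of "max i j"] ef(3) by (auto simp: orthonormal_set_def)
    qed
    ultimately show ?thesis by (auto simp: orthonormal_set_def)
  qed
  moreover have "closure (span E) = UNIV"
  proof -
    have "D \<subseteq> span E"
    proof
      fix d assume "d \<in> D"
      then obtain n where "d = from_nat_into D n" using rD by auto
      then show "d \<in> span E" using F(4)[of n] span_mono[of "F (Suc n)" E] by (auto simp: E_def)
    qed
    moreover have "closure D = UNIV"
      using D(2) by (auto simp: closure_iff_nhds_not_empty) blast
    ultimately show ?thesis using closure_mono by blast
  qed
  ultimately show ?thesis by (auto simp: hilbert_basis_def orthonormal_set_def)
qed

text \<open>
  Distinct orthonormal vectors have distance \<open>sqrt 2\<close>, so the balls of radius \<open>1/2\<close> around them are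
  disjoint open sets.
\<close>
lemma orthonormal_set_countable:
  fixes E :: "'h::{real_inner, second_countable_topology} set"
  assumes "orthonormal_set E"
  shows "countable E"
proof -
  have "dist e f \<ge> 1" if "e \<in> E" "f \<in> E" "e \<noteq> f" for e f
  proof -
    have "(dist e f)\<^sup>2 = 2"
      using that assms
      by (auto simp: dist_norm power2_norm_eq_inner inner_diff orthonormal_set_def inner_commute
          norm_eq_1)
    then show ?thesis by (smt (verit) power_le_one zero_le_dist)
  qed
  then have disj: "ball e (1/2) \<inter> ball f (1/2) = {}" if "e \<in> E" "f \<in> E" "e \<noteq> f" for e f
    using that by (intro disjoint_ballI) auto
  have "countable ((\<lambda>e. ball e (1/2)) ` E)"
    using disj by (intro countable_disjoint_open_subsets) (auto simp: disjoint_def)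
  moreover have "inj_on (\<lambda>e. ball e (1/2)) E"
  proof (rule inj_onI)
    fix e f assume "e \<in> E" "f \<in> E" "ball e (1/2) = ball f (1/2)"
    then show "e = f" using disj[of e f] by (metis centre_in_ball Int_absorb empty_iff half_gt_zero_iff zero_less_one)
  qed
  ultimately show ?thesis by (rule countable_image_inj_on)
qed

lemma has_sum_nonnegI:
  fixes f :: "'a \<Rightarrow> real"
  assumes nonneg: "\<And>e. e \<in> E \<Longrightarrow> 0 \<le> f e"
    and upper: "\<And>F. finite F \<Longrightarrow> F \<subseteq> E \<Longrightarrow> sum f F \<le> r"
    and approx: "\<And>\<epsilon>. \<epsilon> > 0 \<Longrightarrow> \<exists>F. finite F \<and> F \<subseteq> E \<and> r - \<epsilon> < sum f F"
  shows "(f has_sum r) E"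
  unfolding has_sum_def
proof (rule tendstoI)
  fix \<epsilon> :: real assume "\<epsilon> > 0"
  then obtain F where F: "finite F" "F \<subseteq> E" "r - \<epsilon> < sum f F" using approx by blast
  show "eventually (\<lambda>G. dist (sum f G) r < \<epsilon>) (finite_subsets_at_top E)"
    unfolding eventually_finite_subsets_at_top
  proof (intro exI[of _ F] conjI allI impI F(1,2))
    fix G assume G: "finite G \<and> F \<subseteq> G \<and> G \<subseteq> E"
    then have "sum f F \<le> sum f G" by (intro sum_mono2) (use nonneg in auto)
    moreover have "sum f G \<le> r" using G upper by auto
    ultimately show "dist (sum f G) r < \<epsilon>" using F(3) by (auto simp: dist_real_def)
  qed
qed

text \<open>
  For \<open>c e = x \<bullet> e\<close> this yields Bessel's inequality, and it shows that these coefficients give the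
  best approximation of \<open>x\<close>.
\<close>
lemma norm_diff_orthonormal_sum:
  assumes "finite E" "orthonormal_set E"
  shows "(norm (x - (\<Sum>e\<in>E. c e *\<^sub>R e)))\<^sup>2 = (norm x)\<^sup>2 - (\<Sum>e\<in>E. (x \<bullet> e)\<^sup>2) + (\<Sum>e\<in>E. (x \<bullet> e - c e)\<^sup>2)"
proof -
  define p where "p = (\<Sum>e\<in>E. c e *\<^sub>R e)"
  have "p \<bullet> p = (\<Sum>e\<in>E. c e * (p \<bullet> e))"
    by (subst (2) p_def) (simp add: inner_sum_right)
  also have "\<dots> = (\<Sum>e\<in>E. (c e)\<^sup>2)"
    unfolding p_def using inner_orthonormal_sum[OF assms(2,1)] by (simp add: power2_eq_square)
  finally have pp: "p \<bullet> p = (\<Sum>e\<in>E. (c e)\<^sup>2)" .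
  have xp: "x \<bullet> p = (\<Sum>e\<in>E. c e * (x \<bullet> e))" by (simp add: p_def inner_sum_right)
  have "(norm (x - p))\<^sup>2 = (norm x)\<^sup>2 - 2 * (x \<bullet> p) + p \<bullet> p"
    by (simp add: power2_norm_eq_inner inner_diff inner_commute)
  then show ?thesis
    unfolding p_def[symmetric] pp xp
    by (simp add: power2_diff sum.distrib sum_subtractf sum_distrib_left algebra_simps)
qed

text \<open>
  Density of the span gives, for every \<open>\<epsilon>\<close>, a finite part of the basis that already captures
  \<open>(norm x)\<^sup>2\<close> up to \<open>\<epsilon>\<close>, because the orthogonal projection is the best approximation.
\<close>
lemma parseval:
  assumes E: "hilbert_basis E"
  shows "((\<lambda>e. (x \<bullet> e)\<^sup>2) has_sum (norm x)\<^sup>2) E"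
proof (rule has_sum_nonnegI)
  note orth = hilbert_basis_orthonormal[OF E]
  have sub: "orthonormal_set F" if "F \<subseteq> E" for F
    using orth that by (auto simp: orthonormal_set_def)
  show "(\<Sum>e\<in>F. (x \<bullet> e)\<^sup>2) \<le> (norm x)\<^sup>2" if "finite F" "F \<subseteq> E" for F
    using norm_diff_orthonormal_sum[OF that(1) sub[OF that(2)], of x "\<lambda>e. x \<bullet> e"]
    by (smt (verit) sum.neutral zero_le_power2 zero_eq_power2 right_minus_eq)
  fix \<epsilon> :: real assume \<epsilon>: "\<epsilon> > 0"
  have "x \<in> closure (span E)" using E by (simp add: hilbert_basis_def)
  then obtain y where y: "y \<in> span E" "dist y x < sqrt \<epsilon>"
    using \<epsilon> unfolding closure_approachable by (metis real_sqrt_gt_zero)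
  then obtain F c where F: "finite F" "F \<subseteq> E" "y = (\<Sum>e\<in>F. c e *\<^sub>R e)"
    unfolding span_explicit by auto
  have "(norm (x - y))\<^sup>2 < (sqrt \<epsilon>)\<^sup>2"
    using y(2) by (intro power_strict_mono) (auto simp: dist_norm norm_minus_commute)
  then have "(norm (x - y))\<^sup>2 < \<epsilon>" using \<epsilon> by simp
  moreover have "0 \<le> (\<Sum>e\<in>F. (x \<bullet> e - c e)\<^sup>2)" by (rule sum_nonneg) simp
  ultimately have "(norm x)\<^sup>2 - \<epsilon> < (\<Sum>e\<in>F. (x \<bullet> e)\<^sup>2)"
    using norm_diff_orthonormal_sum[OF F(1) sub[OF F(2)], of x c]
    unfolding F(3) by argo
  with F show "\<exists>F. finite F \<and> F \<subseteq> E \<and> (norm x)\<^sup>2 - \<epsilon> < (\<Sum>e\<in>F. (x \<bullet> e)\<^sup>2)" by blast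
qed simp

text \<open>
  A relational form of \<open>trace_operator\<close>, which is evidently additive. It determines the value of the
  definite description because a basis exists.
\<close>
definition has_trace :: "('h::real_inner \<Rightarrow> 'h) \<Rightarrow> real \<Rightarrow> bool" where
  "has_trace R r \<longleftrightarrow> (\<forall>E. hilbert_basis E \<longrightarrow> ((\<lambda>e. R e \<bullet> e) has_sum r) E)"

lemma trace_operator_eqI:
  fixes R :: "'h::{real_inner, second_countable_topology} \<Rightarrow> 'h"
  assumes "has_trace R r"
  shows "trace_operator R = r"
  unfolding trace_operator_def
proof (rule the_equality)
  show "\<forall>E. hilbert_basis E \<longrightarrow> ((\<lambda>e. R e \<bullet> e) has_sum r) E"
    using assms by (simp add: has_trace_def)
  fix r' assume r': "\<forall>E. hilbert_basis E \<longrightarrow> ((\<lambda>e. R e \<bullet> e) has_sum r') E"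
  obtain E :: "'h set" where "hilbert_basis E" using hilbert_basis_exists by blast
  then show "r' = r" using r' assms by (auto simp: has_trace_def intro: has_sum_unique)
qed

lemma has_trace_add:
  assumes "has_trace R r" "has_trace Q q"
  shows "has_trace (\<lambda>h. R h + Q h) (r + q)"
  using assms by (auto simp: has_trace_def inner_add_left intro: has_sum_add)

text \<open>A countable index set makes the finite partial sums a sequence, to which dominated
  convergence applies.\<close>
lemma has_sum_integral_nonneg:
  fixes g :: "'e \<Rightarrow> 'a \<Rightarrow> real"
  assumes E: "countable E"
    and meas: "\<And>e. e \<in> E \<Longrightarrow> g e \<in> borel_measurable N"
    and nonneg: "\<And>e s. e \<in> E \<Longrightarrow> 0 \<le> g e s"
    and sum: "\<And>s. s \<in> space N \<Longrightarrow> ((\<lambda>e. g e s) has_sum h s) E"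
    and h: "integrable N h"
  shows "((\<lambda>e. \<integral>s. g e s \<partial>N) has_sum (\<integral>s. h s \<partial>N)) E"
proof (rule has_sum_nonnegI)
  have partial_le: "(\<Sum>e\<in>F. g e s) \<le> h s" if "finite F" "F \<subseteq> E" "s \<in> space N" for F s
    using has_sum_mono2[OF has_sum_finite[OF that(1)] sum[OF that(3)] that(2)] nonneg by auto
  have int: "integrable N (\<lambda>s. \<Sum>e\<in>F. g e s)" if F: "finite F" "F \<subseteq> E" for F
  proof (rule Bochner_Integration.integrable_bound[OF h])
    show "(\<lambda>s. \<Sum>e\<in>F. g e s) \<in> borel_measurable N" using F meas by (intro borel_measurable_sum) auto
    show "AE s in N. norm (\<Sum>e\<in>F. g e s) \<le> norm (h s)"
      using partial_le[OF F] nonneg F by (intro AE_I2) (smt (verit) real_norm_def subsetD sum_nonneg)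
  qed
  have int1: "integrable N (g e)" if "e \<in> E" for e using int[of "{e}"] that by simp
  have swap: "(\<Sum>e\<in>F. \<integral>s. g e s \<partial>N) = (\<integral>s. (\<Sum>e\<in>F. g e s) \<partial>N)" if "F \<subseteq> E" for F
    using that int1 by (intro Bochner_Integration.integral_sum[symmetric]) auto
  show "0 \<le> (\<integral>s. g e s \<partial>N)" if "e \<in> E" for e using nonneg that by simp
  show "(\<Sum>e\<in>F. \<integral>s. g e s \<partial>N) \<le> (\<integral>s. h s \<partial>N)" if "finite F" "F \<subseteq> E" for F
    unfolding swap[OF that(2)] by (intro integral_mono int h partial_le that)
  fix \<epsilon> :: real assume \<epsilon>: "\<epsilon> > 0"
  define F where "F n = {e \<in> E. to_nat_on E e < n}" for n :: nat
  have F: "finite (F n)" "F n \<subseteq> E" for n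
  proof -
    have "inj_on (to_nat_on E) (F n)" using inj_on_to_nat_on[OF E] by (rule inj_on_subset) (auto simp: F_def)
    moreover have "finite (to_nat_on E ` F n)" by (rule finite_subset[of _ "{..<n}"]) (auto simp: F_def)
    ultimately show "finite (F n)" by (rule finite_imageD[rotated])
  qed (auto simp: F_def)
  have top: "filterlim F (finite_subsets_at_top E) sequentially"
    unfolding filterlim_iff eventually_finite_subsets_at_top
  proof safe
    fix P X assume X: "finite X" "X \<subseteq> E" "\<forall>Y. finite Y \<and> X \<subseteq> Y \<and> Y \<subseteq> E \<longrightarrow> P Y"
    show "\<forall>\<^sub>F n in sequentially. P (F n)"
    proof (rule eventually_sequentiallyI)
      fix n assume "Suc (Max (insert 0 (to_nat_on E ` X))) \<le> n"
      moreover have "to_nat_on E e \<le> Max (insert 0 (to_nat_on E ` X))" if "e \<in> X" for e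
        using that X(1) by (intro Max_ge) auto
      ultimately have "X \<subseteq> F n" using X(2) by (force simp: F_def)
      then show "P (F n)" using X(3) F by blast
    qed
  qed
  have "(\<lambda>n. \<integral>s. (\<Sum>e\<in>F n. g e s) \<partial>N) \<longlonglongrightarrow> (\<integral>s. h s \<partial>N)"
  proof (rule integral_dominated_convergence[where w = h])
    show "AE s in N. (\<lambda>n. \<Sum>e\<in>F n. g e s) \<longlonglongrightarrow> h s"
      using sum unfolding has_sum_def by (intro AE_I2 filterlim_compose[OF _ top])
    show "AE s in N. norm (\<Sum>e\<in>F n. g e s) \<le> h s" for n
      using partial_le[OF F[of n]] nonneg F(2)[of n] by (intro AE_I2) (auto simp: subset_iff sum_nonneg)
  qed (use F int h in auto)
  then have "\<forall>\<^sub>F n in sequentially. (\<integral>s. h s \<partial>N) - \<epsilon> < (\<integral>s. (\<Sum>e\<in>F n. g e s) \<partial>N)"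
    using \<epsilon> by (intro order_tendstoD(1)[where y = "\<integral>s. h s \<partial>N"]) auto
  then obtain n where "(\<integral>s. h s \<partial>N) - \<epsilon> < (\<integral>s. (\<Sum>e\<in>F n. g e s) \<partial>N)"
    by (auto simp: eventually_sequentially)
  with F[of n] show "\<exists>F. finite F \<and> F \<subseteq> E \<and> (\<integral>s. h s \<partial>N) - \<epsilon> < (\<Sum>e\<in>F. \<integral>s. g e s \<partial>N)"
    using swap[OF F(2)[of n]] by auto
qed

section \<open>Semigroups, the Lyapunov equation and Gramians\<close>

locale stable_semigroup =
  fixes S :: "real \<Rightarrow> 'x::{real_inner, banach} \<Rightarrow> 'x"
  assumes c0: "c0_semigroup S" and stable: "exponentially_stable S"
begin

lemma bounded_linear_semigroup: "0 \<le> t \<Longrightarrow> bounded_linear (S t)"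
  using c0 by (simp add: c0_semigroup_def)

lemmas linear_semigroup = bounded_linear.linear[OF bounded_linear_semigroup]

lemma semigroup_0: "S 0 x = x"
  using c0 by (simp add: c0_semigroup_def)

lemma semigroup_plus: "0 \<le> s \<Longrightarrow> 0 \<le> t \<Longrightarrow> S (s + t) x = S s (S t x)"
  using c0 by (simp add: c0_semigroup_def)

lemma decay:
  obtains \<omega> \<nu> where "\<omega> > 0" "\<nu> \<ge> 1" "\<And>t x. 0 \<le> t \<Longrightarrow> norm (S t x) \<le> \<nu> * exp (- \<omega> * t) * norm x"
proof -
  obtain \<omega> \<nu> where *: "\<omega> > 0" "\<nu> \<ge> 1" "\<And>t. 0 \<le> t \<Longrightarrow> onorm (S t) \<le> \<nu> * exp (- \<omega> * t)"
    using stable by (auto simp: exponentially_stable_def)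
  have "norm (S t x) \<le> \<nu> * exp (- \<omega> * t) * norm x" if "0 \<le> t" for t x
    using onorm[OF bounded_linear_semigroup[OF that], of x] *(3)[OF that]
    by (meson mult_right_mono norm_ge_zero order_trans)
  with * that show thesis by blast
qed

lemma bounded_semigroup:
  obtains \<nu> where "\<nu> \<ge> 1" "\<And>t x. 0 \<le> t \<Longrightarrow> norm (S t x) \<le> \<nu> * norm x"
proof -
  obtain \<omega> \<nu> where *: "\<omega> > 0" "\<nu> \<ge> 1" "\<And>t x. 0 \<le> t \<Longrightarrow> norm (S t x) \<le> \<nu> * exp (- \<omega> * t) * norm x"
    using decay by metis
  have "norm (S t x) \<le> \<nu> * norm x" if "0 \<le> t" for t x
  proof -
    have "\<nu> * exp (- \<omega> * t) \<le> \<nu> * 1" using * that by (intro mult_left_mono) auto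
    then show ?thesis using *(3)[OF that, of x] by (smt (verit) mult_right_mono norm_ge_zero)
  qed
  with * that show thesis by blast
qed

lemma continuous_orbit: "continuous_on {0..} (\<lambda>t. S t x)"
proof -
  obtain \<nu> where \<nu>: "\<nu> \<ge> 1" "\<And>t x. 0 \<le> t \<Longrightarrow> norm (S t x) \<le> \<nu> * norm x"
    using bounded_semigroup by metis
  have lim: "((\<lambda>t. S t x) \<longlongrightarrow> x) (at_right 0)" using c0 by (simp add: c0_semigroup_def)
  show ?thesis
    unfolding continuous_on_iff
  proof (intro ballI allI impI)
    fix t e :: real assume t: "t \<in> {0..}" and e: "e > 0"
    have "eventually (\<lambda>h. dist (S h x) x < e / \<nu>) (at_right 0)"
      using lim e \<nu>(1) by (intro tendstoD) auto
    then obtain d where d: "d > 0" "\<And>h. 0 < h \<Longrightarrow> h < d \<Longrightarrow> dist (S h x) x < e / \<nu>"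
      unfolding eventually_at_right_field by blast
    have main: "dist (S (s + h) x) (S s x) < e" if "0 \<le> s" "0 \<le> h" "h < d" for s h
    proof (cases "h = 0")
      case False
      have "S (s + h) x - S s x = S s (S h x - x)"
        using that by (simp add: semigroup_plus linear_diff[OF linear_semigroup])
      then have "dist (S (s + h) x) (S s x) \<le> \<nu> * dist (S h x) x"
        using \<nu>(2)[OF that(1)] by (simp add: dist_norm)
      also have "\<dots> < \<nu> * (e / \<nu>)"
        using d(2)[of h] that False \<nu>(1) by (intro mult_strict_left_mono) auto
      finally show ?thesis using \<nu>(1) by simp
    qed (use e in simp)
    have "dist (S s x) (S t x) < e" if s: "s \<in> {0..}" "dist s t < d" for s
    proof (cases "s \<le> t")
      case True
      then show ?thesis using main[of s "t - s"] s by (simp add: dist_commute dist_real_def)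
    next
      case False
      then show ?thesis using main[of t "s - t"] s t by (simp add: dist_real_def)
    qed
    with d(1) show "\<exists>d>0. \<forall>s\<in>{0..}. dist s t < d \<longrightarrow> dist (S s x) (S t x) < e" by blast
  qed
qed

lemma continuous_orbit_Icc: "0 \<le> a \<Longrightarrow> continuous_on {a..b} (\<lambda>t. S t x)"
  by (rule continuous_on_subset[OF continuous_orbit]) auto

text \<open>
  \<open>J t = \<integral>\<^sub>0\<^sup>t S\<^sub>s ds\<close>, which maps into the domain of the generator, and whose adjoint maps into the
  domain of the adjoint of the generator.
\<close>
definition J :: "real \<Rightarrow> 'x \<Rightarrow> 'x" where
  "J t a = integral {0..t} (\<lambda>s. S s a)"

lemma orbit_integrable: "0 \<le> a \<Longrightarrow> (\<lambda>t. S t x) integrable_on {a..b}"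
  by (intro integrable_continuous_real continuous_orbit_Icc)

lemma norm_J_le:
  assumes "\<And>t x. 0 \<le> t \<Longrightarrow> norm (S t x) \<le> \<nu> * norm x" "0 \<le> t"
  shows "norm (J t a) \<le> \<nu> * t * norm a"
proof -
  have "norm (J t a) \<le> (\<nu> * norm a) * (t - 0)"
    unfolding J_def using assms continuous_orbit_Icc[of 0]
    by (intro integral_bound) auto
  then show ?thesis by (simp add: ac_simps)
qed

lemma bounded_linear_J:
  assumes "0 \<le> t"
  shows "bounded_linear (J t)"
proof -
  obtain \<nu> where \<nu>: "\<nu> \<ge> 1" "\<And>t x. 0 \<le> t \<Longrightarrow> norm (S t x) \<le> \<nu> * norm x"
    using bounded_semigroup by metis
  show ?thesis
  proof (rule bounded_linear_intro)
    show "J t (x + y) = J t x + J t y" for x y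
    proof -
      have "J t (x + y) = integral {0..t} (\<lambda>s. S s x + S s y)"
        unfolding J_def
        by (intro integral_cong) (simp add: linear_add[OF linear_semigroup])
      then show ?thesis by (simp add: J_def integral_add orbit_integrable)
    qed
    show "J t (r *\<^sub>R x) = r *\<^sub>R J t x" for r x
    proof -
      have "J t (r *\<^sub>R x) = integral {0..t} (\<lambda>s. r *\<^sub>R S s x)"
        unfolding J_def
        by (intro integral_cong) (simp add: linear_scale[OF linear_semigroup])
      then show ?thesis by (simp add: J_def)
    qed
    show "norm (J t x) \<le> norm x * (\<nu> * t)" for x
      using norm_J_le[OF \<nu>(2) assms, of x] by (simp add: ac_simps)
  qed
qed

lemma semigroup_J:
  assumes "0 \<le> h" "0 \<le> t"
  shows "S h (J t a) = J (t + h) a - J h a"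
proof -
  have "S h (J t a) = integral {0..t} (\<lambda>s. S h (S s a))"
    unfolding J_def using integral_linear[OF orbit_integrable bounded_linear_semigroup[OF assms(1)], of 0 t a]
    by (simp add: o_def)
  also have "\<dots> = integral {0..t} ((\<lambda>s. S s a) \<circ> (+) h)"
    by (intro integral_cong) (simp add: semigroup_plus assms)
  also have "\<dots> = integral {h..t + h} (\<lambda>s. S s a)"
    by (simp only: integral_shift_Icc_real) simp
  also have "\<dots> = J (t + h) a - J h a"
    using Henstock_Kurzweil_Integration.integral_combine[of 0 h "t + h" "\<lambda>s. S s a"] assms
    by (simp add: J_def orbit_integrable algebra_simps)
  finally show ?thesis .
qed

text \<open>
  Both sides equal \<open>J (t + h) a - J t a - J h a\<close>. Dividing by \<open>h\<close> and letting \<open>h\<close> tend to \<open>0\<close>, the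
  left side becomes the generator applied to \<open>J t a\<close> and the right side becomes \<open>S t a - a\<close>.
\<close>
lemma semigroup_J_commute:
  assumes "0 \<le> h" "0 \<le> t"
  shows "S h (J t a) - J t a = S t (J h a) - J h a"
  using assms by (simp add: semigroup_J add.commute)

lemma J_semigroup:
  assumes "0 \<le> h" "0 \<le> t"
  shows "J t (S h a) = S h (J t a)"
proof -
  have "S h (J t a) = integral {0..t} (\<lambda>s. S h (S s a))"
    unfolding J_def using integral_linear[OF orbit_integrable bounded_linear_semigroup[OF assms(1)], of 0 t a]
    by (simp add: o_def)
  also have "\<dots> = J t (S h a)"
    unfolding J_def
    by (intro integral_cong) (metis add.commute assms(1) atLeastAtMost_iff semigroup_plus)
  finally show ?thesis ..
qed

lemma J_has_vector_derivative:
  "t \<in> {0..N} \<Longrightarrow> ((\<lambda>t. J t a) has_vector_derivative S t a) (at t within {0..N})"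
  unfolding J_def by (rule integral_has_vector_derivative[OF continuous_orbit_Icc]) auto

lemma J_0: "J 0 a = 0"
  by (simp add: J_def)

lemma J_average_tendsto: "((\<lambda>h. J h a /\<^sub>R h) \<longlongrightarrow> a) (at_right 0)"
proof -
  have "((\<lambda>h. (1 / \<bar>h\<bar>) *\<^sub>R (J h a - h *\<^sub>R a)) \<longlongrightarrow> 0) (at_right 0)"
    using J_has_vector_derivative[of 0 1 a]
    by (simp add: has_vector_derivative_def has_derivative_within J_0 semigroup_0 at_within_Icc_at_right)
  moreover have "\<forall>\<^sub>F h in at_right 0. (1 / \<bar>h\<bar>) *\<^sub>R (J h a - h *\<^sub>R a) = J h a /\<^sub>R h - a"
    using eventually_at_right_less[of 0]
    by eventually_elim (simp add: scaleR_diff_right divide_inverse_commute)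
  ultimately have "((\<lambda>h. J h a /\<^sub>R h - a) \<longlongrightarrow> 0) (at_right 0)"
    by (rule Lim_transform_eventually)
  then show ?thesis by (rule LIM_zero_cancel)
qed

lemma generator_J:
  assumes "0 \<le> t"
  shows "(J t a, S t a - a) \<in> generator S"
proof -
  have "((\<lambda>h. S t (J h a /\<^sub>R h) - J h a /\<^sub>R h) \<longlongrightarrow> S t a - a) (at_right 0)"
    by (intro tendsto_intros J_average_tendsto bounded_linear.tendsto[OF bounded_linear_semigroup] assms)
  moreover have "\<forall>\<^sub>F h in at_right 0. S t (J h a /\<^sub>R h) - J h a /\<^sub>R h = (S h (J t a) - J t a) /\<^sub>R h"
    using eventually_at_right_less[of 0]
  proof eventually_elim
    case (elim h)
    have "(S h (J t a) - J t a) /\<^sub>R h = (S t (J h a) - J h a) /\<^sub>R h"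
      using elim assms semigroup_J_commute[of h t] by simp
    then show ?case
      by (simp add: linear_scale[OF linear_semigroup[OF assms]] scaleR_diff_right)
  qed
  ultimately show ?thesis
    unfolding generator_def by (auto elim: Lim_transform_eventually)
qed

lemma adjoint_graph_J:
  assumes t: "0 \<le> t"
  shows "(adjoint (J t) z, adjoint (S t) z - z) \<in> adjoint_graph (generator S)"
  unfolding adjoint_graph_def
proof (safe)
  fix a b assume ab: "(a, b) \<in> generator S"
  note bl = bounded_linear_semigroup[OF t] bounded_linear_J[OF t]
  have lim': "((\<lambda>h. ((S h a - a) /\<^sub>R h) \<bullet> adjoint (J t) z) \<longlongrightarrow> b \<bullet> adjoint (J t) z) (at_right 0)"
    using ab by (intro tendsto_intros) (simp add: generator_def)
  have lim: "((\<lambda>h. (J h a /\<^sub>R h) \<bullet> (adjoint (S t) z - z)) \<longlongrightarrow> a \<bullet> (adjoint (S t) z - z)) (at_right 0)"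
    by (intro tendsto_intros J_average_tendsto)
  have "\<forall>\<^sub>F h in at_right 0.
    ((S h a - a) /\<^sub>R h) \<bullet> adjoint (J t) z = (J h a /\<^sub>R h) \<bullet> (adjoint (S t) z - z)"
    using eventually_at_right_less[of 0]
  proof eventually_elim
    case (elim h)
    have "(S h a - a) \<bullet> adjoint (J t) z = (J t (S h a) - J t a) \<bullet> z"
      by (simp add: inner_adjoint[OF bl(2)] linear_diff[OF bounded_linear.linear[OF bl(2)]])
    also have "\<dots> = (S t (J h a) - J h a) \<bullet> z"
      using semigroup_J_commute[of h t a] J_semigroup[of h t a] elim t by simp
    also have "\<dots> = J h a \<bullet> (adjoint (S t) z - z)"
      by (simp add: inner_diff inner_adjoint[OF bl(1)])
    finally show ?case by simp
  qed
  with lim' have "((\<lambda>h. (J h a /\<^sub>R h) \<bullet> (adjoint (S t) z - z)) \<longlongrightarrow> b \<bullet> adjoint (J t) z) (at_right 0)"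
    by (rule Lim_transform_eventually)
  with lim show "b \<bullet> adjoint (J t) z = a \<bullet> (adjoint (S t) z - z)"
    by (intro tendsto_unique[OF trivial_limit_at_right_real])
qed

text \<open>
  The domain of the adjoint of the generator is weakly dense: it contains the vectors
  \<open>J h\<^sup>* x\<close>, whose averages over \<open>h\<close> tend weakly to \<open>x\<close>.
\<close>
lemma adjoint_domain_dense:
  assumes f: "bounded_linear f" and 0: "\<And>x x'. (x, x') \<in> adjoint_graph (generator S) \<Longrightarrow> f x = (0::real)"
  shows "f x = 0"
proof -
  obtain z where z: "\<And>x. f x = x \<bullet> z" using riesz_representation[OF f] by blast
  have "x \<bullet> J h z = 0" if "0 \<le> h" for h
    using 0[OF adjoint_graph_J[OF that, of x]]
    by (simp add: z adjoint_inner[OF bounded_linear_J[OF that]])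
  then have "\<forall>\<^sub>F h in at_right 0. x \<bullet> (J h z /\<^sub>R h) = 0"
    using eventually_at_right_less[of 0] by (auto elim!: eventually_mono)
  moreover have "((\<lambda>h. x \<bullet> (J h z /\<^sub>R h)) \<longlongrightarrow> x \<bullet> z) (at_right 0)"
    by (intro tendsto_intros J_average_tendsto)
  ultimately have "((\<lambda>h. 0) \<longlongrightarrow> x \<bullet> z) (at_right (0::real))"
    by (rule Lim_transform_eventually[rotated])
  then show ?thesis by (simp add: z tendsto_const_iff)
qed

lemma generator_semigroup:
  assumes t: "0 \<le> t" and ab: "(a, b) \<in> generator S"
  shows "(S t a, S t b) \<in> generator S"
proof -
  have "((\<lambda>h. S t ((S h a - a) /\<^sub>R h)) \<longlongrightarrow> S t b) (at_right 0)"
    using ab by (intro bounded_linear.tendsto[OF bounded_linear_semigroup[OF t]]) (simp add: generator_def)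
  moreover have "\<forall>\<^sub>F h in at_right 0. S t ((S h a - a) /\<^sub>R h) = (S h (S t a) - S t a) /\<^sub>R h"
    using eventually_at_right_less[of 0]
  proof eventually_elim
    case (elim h)
    have "S h (S t a) = S t (S h a)" using elim t by (metis add.commute less_imp_le semigroup_plus)
    then show ?case
      by (simp add: linear_scale[OF linear_semigroup[OF t]]
          linear_diff[OF linear_semigroup[OF t]])
  qed
  ultimately show ?thesis
    unfolding generator_def by (auto elim: Lim_transform_eventually)
qed

lemma adjoint_graph_semigroup:
  assumes "0 \<le> t" "(x, x') \<in> adjoint_graph (generator S)"
  shows "(adjoint (S t) x, adjoint (S t) x') \<in> adjoint_graph (generator S)"
  using assms generator_semigroup[OF assms(1)]
  by (fastforce simp: adjoint_graph_def inner_adjoint[OF bounded_linear_semigroup])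

text \<open>
  Against a vector in the domain of the adjoint generator every orbit is differentiable, also those
  that start outside the domain of the generator.
\<close>
lemma orbit_inner_adjoint_domain:
  assumes "0 \<le> t" "(x, x') \<in> adjoint_graph (generator S)"
  shows "S t a \<bullet> x = a \<bullet> x + J t a \<bullet> x'"
  using assms generator_J[OF assms(1), of a] by (fastforce simp: adjoint_graph_def inner_diff_left)

lemma orbit_inner_derivative:
  assumes "t \<in> {0..N}" "(x, x') \<in> adjoint_graph (generator S)"
  shows "((\<lambda>t. S t a \<bullet> x) has_real_derivative S t a \<bullet> x') (at t within {0..N})"
proof -
  have D: "((\<lambda>t. a \<bullet> x + J t a \<bullet> x') has_vector_derivative 0 + S t a \<bullet> x') (at t within {0..N})"
    by (intro has_vector_derivative_add has_vector_derivative_const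
        bounded_linear.has_vector_derivative[OF bounded_linear_inner_left] J_has_vector_derivative assms)
  have "((\<lambda>t. S t a \<bullet> x) has_vector_derivative 0 + S t a \<bullet> x') (at t within {0..N})"
    by (rule has_vector_derivative_transform[OF assms(1) _ D])
      (use orbit_inner_adjoint_domain[OF _ assms(2)] in auto)
  then show ?thesis by (simp add: has_real_derivative_iff_has_vector_derivative)
qed

text \<open>
  Orbits of the adjoint semigroup that start in the domain of the adjoint generator are norm
  continuous, which here replaces strong continuity of the adjoint semigroup.
\<close>
lemma adjoint_orbit_lipschitz:
  assumes x: "(x, x') \<in> adjoint_graph (generator S)"
  shows "\<exists>c\<ge>0. \<forall>s\<ge>0. \<forall>t\<ge>0. norm (adjoint (S t) x - adjoint (S s) x) \<le> c * \<bar>t - s\<bar>"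
proof -
  obtain \<nu> where \<nu>: "\<nu> \<ge> 1" "\<And>t x. 0 \<le> t \<Longrightarrow> norm (S t x) \<le> \<nu> * norm x"
    using bounded_semigroup by metis
  have main: "norm (adjoint (S (s + h)) x - adjoint (S s) x) \<le> \<nu> * \<nu> * norm x' * h"
    if "0 \<le> s" "0 \<le> h" for s h
  proof (rule norm_le_if_inner_le)
    fix a
    have "(adjoint (S (s + h)) x - adjoint (S s) x) \<bullet> a = (S (s + h) a - S s a) \<bullet> x"
      using that by (simp add: inner_diff_left adjoint_inner[OF bounded_linear_semigroup]) (simp add: inner_commute)
    also have "\<dots> = (J (s + h) a - J s a) \<bullet> x'"
      using that by (simp add: orbit_inner_adjoint_domain[OF _ x] inner_diff_left)
    also have "\<dots> = S s (J h a) \<bullet> x'" using that by (simp add: semigroup_J add.commute)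
    also have "\<bar>\<dots>\<bar> \<le> norm (S s (J h a)) * norm x'" by (rule Cauchy_Schwarz_ineq2)
    also have "\<dots> \<le> (\<nu> * (\<nu> * h * norm a)) * norm x'"
    proof (rule mult_right_mono)
      have "norm (S s (J h a)) \<le> \<nu> * norm (J h a)" using \<nu>(2) that by simp
      also have "\<dots> \<le> \<nu> * (\<nu> * h * norm a)"
        using norm_J_le[OF \<nu>(2) that(2)] \<nu>(1) by (intro mult_left_mono) auto
      finally show "norm (S s (J h a)) \<le> \<nu> * (\<nu> * h * norm a)" .
    qed simp
    finally show "\<bar>(adjoint (S (s + h)) x - adjoint (S s) x) \<bullet> a\<bar> \<le> \<nu> * \<nu> * norm x' * h * norm a"
      by (simp add: ac_simps)
  qed (use \<nu> that in simp)
  have "norm (adjoint (S t) x - adjoint (S s) x) \<le> (\<nu> * \<nu> * norm x') * \<bar>t - s\<bar>" if "s \<ge> 0" "t \<ge> 0" for s t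
  proof (cases "s \<le> t")
    case True
    then show ?thesis using main[of s "t - s"] that by simp
  next
    case False
    then show ?thesis using main[of t "s - t"] that by (simp add: norm_minus_commute)
  qed
  moreover have "0 \<le> \<nu> * \<nu> * norm x'" using \<nu> by simp
  ultimately show ?thesis by blast
qed

end

lemma has_real_derivative_zero_if_quadratic:
  fixes r :: "real \<Rightarrow> real"
  assumes t: "t \<in> U" and r: "\<And>s. s \<in> U \<Longrightarrow> \<bar>r s\<bar> \<le> c * (s - t)\<^sup>2"
  shows "(r has_real_derivative 0) (at t within U)"
proof -
  have rt: "r t = 0" using r[OF t] by simp
  have "((\<lambda>s. (r s - r t) / (s - t)) \<longlongrightarrow> 0) (at t within U)"
  proof (rule Lim_null_comparison)
    show "\<forall>\<^sub>F s in at t within U. norm ((r s - r t) / (s - t)) \<le> c * \<bar>s - t\<bar>"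
      unfolding eventually_at_filter
    proof (rule eventuallyI, safe)
      fix s assume "s \<in> U" "s \<noteq> t"
      then show "norm ((r s - r t) / (s - t)) \<le> c * \<bar>s - t\<bar>"
        using r[of s] by (simp add: rt divide_le_eq power2_eq_square abs_mult[symmetric] mult.assoc)
    qed
    show "((\<lambda>s. c * \<bar>s - t\<bar>) \<longlongrightarrow> 0) (at t within U)"
      by (rule tendsto_eq_intros refl | simp)+
  qed
  then show ?thesis by (simp add: has_field_derivative_iff)
qed

lemma set_integrable_exp_decay:
  assumes "\<omega> > (0::real)"
  shows "set_integrable lborel {0..} (\<lambda>s. exp (- \<omega> * s))"
  unfolding set_integrable_def
proof (rule integrableI_nonneg)
  have "((\<lambda>x. - exp (- \<omega> * x) / \<omega>) \<longlongrightarrow> 0) at_top"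
    using assms by real_asymp
  then have "(\<integral>\<^sup>+x. ennreal (exp (- \<omega> * x)) * indicator {0..} x \<partial>lborel) = ennreal (0 - (- exp (- \<omega> * 0) / \<omega>))"
    using assms by (intro nn_integral_FTC_atLeast) (auto intro!: derivative_eq_intros)
  moreover have "(\<integral>\<^sup>+x. ennreal (exp (- \<omega> * x)) * indicator {0..} x \<partial>lborel) =
    (\<integral>\<^sup>+x. ennreal (indicator {0..} x *\<^sub>R exp (- \<omega> * x)) \<partial>lborel)"
    by (intro nn_integral_cong) (auto split: split_indicator)
  ultimately show "(\<integral>\<^sup>+x. ennreal (indicator {0..} x *\<^sub>R exp (- \<omega> * x)) \<partial>lborel) < \<infinity>"
    by (metis ennreal_less_top infinity_ennreal_def)
qed auto

lemma set_integrable_atLeast_bound: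
  fixes f :: "real \<Rightarrow> real"
  assumes cont: "continuous_on {0..} f" and \<omega>: "\<omega> > 0"
    and bound: "\<And>s. 0 \<le> s \<Longrightarrow> \<bar>f s\<bar> \<le> c * exp (- \<omega> * s)"
  shows "set_integrable lborel {0..} f"
proof (rule set_integrable_bound)
  show "set_integrable lborel {0..} (\<lambda>s. c * exp (- \<omega> * s))"
    by (intro set_integrable_mult_right set_integrable_exp_decay \<omega>)
  show "set_borel_measurable lborel {0..} f"
    using borel_measurable_continuous_on_indicator[OF _ cont]
    by (simp add: set_borel_measurable_def)
  show "AE s in lborel. s \<in> {0..} \<longrightarrow> norm (f s) \<le> norm (c * exp (- \<omega> * s))"
    using bound by (intro AE_I2) (auto intro: order_trans[OF _ abs_ge_self])
qed

text \<open>
  The integrand \<open>S\<^sub>s G G'\<^sup>* S'\<^sub>s\<^sup>* y \<bullet> x\<close>, expanded in the standard basis of the finite-dimensional input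
  space so that no adjoints occur and continuity in \<open>s\<close> is evident.
\<close>
definition gramian_kernel ::
  "(real \<Rightarrow> 'x::real_inner \<Rightarrow> 'x) \<Rightarrow> ('a::euclidean_space \<Rightarrow> 'x) \<Rightarrow>
   (real \<Rightarrow> 'y::real_inner \<Rightarrow> 'y) \<Rightarrow> ('a \<Rightarrow> 'y) \<Rightarrow> 'y \<Rightarrow> 'x \<Rightarrow> real \<Rightarrow> real" where
  "gramian_kernel S G S' G' y x s = (\<Sum>b\<in>Basis. (S s (G b) \<bullet> x) * (S' s (G' b) \<bullet> y))"

definition is_gramian ::
  "(real \<Rightarrow> 'x::real_inner \<Rightarrow> 'x) \<Rightarrow> ('a::euclidean_space \<Rightarrow> 'x) \<Rightarrow>
   (real \<Rightarrow> 'y::real_inner \<Rightarrow> 'y) \<Rightarrow> ('a \<Rightarrow> 'y) \<Rightarrow> ('y \<Rightarrow> 'x) \<Rightarrow> bool" where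
  "is_gramian S G S' G' P \<longleftrightarrow> bounded_linear P \<and>
     (\<forall>y x. P y \<bullet> x = (LBINT s:{0..}. gramian_kernel S G S' G' y x s))"

lemma linear_adjoint_expand:
  fixes G :: "'a::euclidean_space \<Rightarrow> 'x::real_inner" and G' :: "'a \<Rightarrow> 'y::real_inner"
  assumes "linear G" "linear G'"
  shows "G (adjoint G' y) = (\<Sum>b\<in>Basis. (G' b \<bullet> y) *\<^sub>R G b)"
proof -
  have "G (adjoint G' y) = G (\<Sum>b\<in>Basis. (adjoint G' y \<bullet> b) *\<^sub>R b)"
    by (simp add: euclidean_representation)
  also have "\<dots> = (\<Sum>b\<in>Basis. (G' b \<bullet> y) *\<^sub>R G b)"
    using assms
    by (simp add: linear_sum linear_scale adjoint_inner linear_conv_bounded_linear inner_commute[of _ y])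
  finally show ?thesis .
qed

locale stable_pair = S: stable_semigroup S + S': stable_semigroup S'
  for S :: "real \<Rightarrow> 'x::{real_inner, banach} \<Rightarrow> 'x" and S' :: "real \<Rightarrow> 'y::{real_inner, banach} \<Rightarrow> 'y" +
  fixes G :: "'a::euclidean_space \<Rightarrow> 'x" and G' :: "'a \<Rightarrow> 'y"
  assumes G: "bounded_linear G" and G': "bounded_linear G'"
begin

abbreviation "k \<equiv> gramian_kernel S G S' G'"

lemma gramian_kernel_eq:
  assumes "0 \<le> s"
  shows "S s (G (adjoint G' (adjoint (S' s) y))) \<bullet> x = k y x s"
proof -
  note l = bounded_linear.linear
  show ?thesis
    using l[OF S.bounded_linear_semigroup[OF assms]]
    by (simp add: linear_adjoint_expand[OF l[OF G] l[OF G']] linear_sum linear_scale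
        inner_adjoint[OF S'.bounded_linear_semigroup[OF assms]] inner_sum_left gramian_kernel_def ac_simps)
qed

lemma continuous_gramian_kernel: "continuous_on {0..} (k y x)"
  unfolding gramian_kernel_def
  by (intro continuous_intros S.continuous_orbit S'.continuous_orbit)

lemma gramian_kernel_bound:
  "\<exists>c\<ge>0. \<exists>\<omega>>0. \<forall>y x s. 0 \<le> s \<longrightarrow> \<bar>k y x s\<bar> \<le> c * norm y * norm x * exp (- \<omega> * s)"
proof -
  obtain \<omega> \<nu> where 1: "\<omega> > 0" "\<nu> \<ge> 1" "\<And>t x. 0 \<le> t \<Longrightarrow> norm (S t x) \<le> \<nu> * exp (- \<omega> * t) * norm x"
    using S.decay by metis
  obtain \<nu>' where 2: "\<nu>' \<ge> 1" "\<And>t x. 0 \<le> t \<Longrightarrow> norm (S' t x) \<le> \<nu>' * norm x"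
    using S'.bounded_semigroup by metis
  define c where "c = (\<Sum>b\<in>(Basis :: 'a set). \<nu> * norm (G b) * (\<nu>' * norm (G' b)))"
  have "\<bar>k y x s\<bar> \<le> c * norm y * norm x * exp (- \<omega> * s)" if s: "0 \<le> s" for y x s
  proof -
    have "\<bar>(S s (G b) \<bullet> x) * (S' s (G' b) \<bullet> y)\<bar> \<le>
        (\<nu> * exp (- \<omega> * s) * norm (G b) * norm x) * (\<nu>' * norm (G' b) * norm y)" for b
      unfolding abs_mult
    proof (rule mult_mono)
      show "\<bar>S s (G b) \<bullet> x\<bar> \<le> \<nu> * exp (- \<omega> * s) * norm (G b) * norm x"
        using Cauchy_Schwarz_ineq2[of "S s (G b)" x] 1(3)[OF s, of "G b"]
        by (meson mult_right_mono norm_ge_zero order_trans)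
      show "\<bar>S' s (G' b) \<bullet> y\<bar> \<le> \<nu>' * norm (G' b) * norm y"
        using Cauchy_Schwarz_ineq2[of "S' s (G' b)" y] 2(2)[OF s, of "G' b"]
        by (meson mult_right_mono norm_ge_zero order_trans)
    qed (use 1 in auto)
    then have "\<bar>k y x s\<bar> \<le> (\<Sum>b\<in>(Basis :: 'a set). (\<nu> * exp (- \<omega> * s) * norm (G b) * norm x) * (\<nu>' * norm (G' b) * norm y))"
      unfolding gramian_kernel_def by (intro order_trans[OF sum_abs] sum_mono)
    also have "\<dots> = c * norm y * norm x * exp (- \<omega> * s)"
      by (simp add: c_def sum_distrib_left sum_distrib_right ac_simps)
    finally show ?thesis .
  qed
  moreover have "0 \<le> c" unfolding c_def using 1 2 by (intro sum_nonneg) auto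
  ultimately show ?thesis using 1(1) by blast
qed

lemma gramian_kernel_integrable: "set_integrable lborel {0..} (k y x)"
  using gramian_kernel_bound
  by (metis set_integrable_atLeast_bound[OF continuous_gramian_kernel])

definition gramian_form :: "'y \<Rightarrow> 'x \<Rightarrow> real" where
  "gramian_form y x = (LBINT s:{0..}. k y x s)"

lemma gramian_form_linear:
  "gramian_form (y + y') x = gramian_form y x + gramian_form y' x" "gramian_form y (x + x') = gramian_form y x + gramian_form y x'"
  "gramian_form (r *\<^sub>R y) x = r * gramian_form y x" "gramian_form y (r *\<^sub>R x) = r * gramian_form y x"
proof -
  have "k (y + y') x = (\<lambda>s. k y x s + k y' x s)" "k y (x + x') = (\<lambda>s. k y x s + k y x' s)"
    "k (r *\<^sub>R y) x = (\<lambda>s. r * k y x s)" "k y (r *\<^sub>R x) = (\<lambda>s. r * k y x s)"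
    by (auto simp: gramian_kernel_def fun_eq_iff inner_add algebra_simps sum.distrib sum_distrib_left)
  then show "gramian_form (y + y') x = gramian_form y x + gramian_form y' x" "gramian_form y (x + x') = gramian_form y x + gramian_form y x'"
    "gramian_form (r *\<^sub>R y) x = r * gramian_form y x" "gramian_form y (r *\<^sub>R x) = r * gramian_form y x"
    using gramian_kernel_integrable by (simp_all add: gramian_form_def set_integral_add set_integral_mult_right)
qed

lemma gramian_form_bound: "\<exists>c\<ge>0. \<forall>y x. \<bar>gramian_form y x\<bar> \<le> c * norm y * norm x"
proof -
  obtain c \<omega> where c: "c \<ge> 0" "\<omega> > 0" "\<And>y x s. 0 \<le> s \<Longrightarrow> \<bar>k y x s\<bar> \<le> c * norm y * norm x * exp (- \<omega> * s)"
    using gramian_kernel_bound by metis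
  let ?e = "LBINT s:{0..}. exp (- \<omega> * s)"
  have "\<bar>gramian_form y x\<bar> \<le> (c * ?e) * norm y * norm x" for y x
  proof -
    have "\<bar>gramian_form y x\<bar> \<le> (LBINT s:{0..}. \<bar>k y x s\<bar>)"
      unfolding gramian_form_def using set_integral_norm_bound[OF gramian_kernel_integrable, of y x] by simp
    also have "\<dots> \<le> (LBINT s:{0..}. c * norm y * norm x * exp (- \<omega> * s))"
      using c gramian_kernel_integrable set_integrable_exp_decay[OF c(2)]
      by (intro set_integral_mono set_integrable_mult_right) (auto intro: set_integrable_abs)
    also have "\<dots> = (c * ?e) * norm y * norm x" by (simp only: set_integral_mult_right) (simp add: ac_simps)
    finally show ?thesis .
  qed
  moreover have "0 \<le> c * ?e"
    using c(1) by (intro mult_nonneg_nonneg) (auto simp: set_lebesgue_integral_def intro!: integral_nonneg_AE)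
  ultimately show ?thesis by blast
qed

lemma bounded_linear_gramian_form: "bounded_linear (gramian_form y)" "bounded_linear (\<lambda>y. gramian_form y x)"
proof -
  obtain c where c: "c \<ge> 0" "\<And>y x. \<bar>gramian_form y x\<bar> \<le> c * norm y * norm x" using gramian_form_bound by blast
  show "bounded_linear (gramian_form y)"
    by (rule bounded_linear_intro[where K = "c * norm y"])
      (use c(2) in \<open>auto simp: gramian_form_linear ac_simps\<close>)
  show "bounded_linear (\<lambda>y. gramian_form y x)"
    by (rule bounded_linear_intro[where K = "c * norm x"])
      (use c(2) in \<open>auto simp: gramian_form_linear ac_simps\<close>)
qed

lemma is_gramian_iff: "is_gramian S G S' G' P \<longleftrightarrow> bounded_linear P \<and> (\<forall>y x. P y \<bullet> x = gramian_form y x)"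
  by (simp add: is_gramian_def gramian_form_def)

lemma is_gramian_exists: "\<exists>P. is_gramian S G S' G' P"
proof -
  obtain c where c: "c \<ge> 0" "\<And>y x. \<bar>gramian_form y x\<bar> \<le> c * norm y * norm x" using gramian_form_bound by blast
  have "\<forall>y. \<exists>z. \<forall>x. gramian_form y x = x \<bullet> z"
    using riesz_representation[OF bounded_linear_gramian_form(1)] by blast
  then obtain P where P: "\<And>y x. P y \<bullet> x = gramian_form y x" by (metis inner_commute)
  have "bounded_linear P"
  proof (rule bounded_linear_intro[where K = c])
    show "P (y + y') = P y + P y'" for y y'
      by (rule vector_eq_rdot[THEN iffD1]) (simp add: P gramian_form_linear inner_add_left)
    show "P (r *\<^sub>R y) = r *\<^sub>R P y" for r y
      by (rule vector_eq_rdot[THEN iffD1]) (simp add: P gramian_form_linear)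
    show "norm (P y) \<le> norm y * c" for y
      by (rule norm_le_if_inner_le) (use c in \<open>auto simp: P ac_simps\<close>)
  qed
  with P show ?thesis by (auto simp: is_gramian_iff)
qed

lemma set_integral_weak_gramian:
  "set_integrable lborel {0..} (\<lambda>s. S s (G (adjoint G' (adjoint (S' s) y))) \<bullet> x)"
  "(LBINT s:{0..}. S s (G (adjoint G' (adjoint (S' s) y))) \<bullet> x) = gramian_form y x"
proof -
  let ?F = "\<lambda>y s. S s (G (adjoint G' (adjoint (S' s) y)))"
  show "set_integrable lborel {0..} (\<lambda>s. ?F y s \<bullet> x)"
    using gramian_kernel_integrable[of y x]
    by (subst set_integrable_cong[OF refl refl gramian_kernel_eq]) auto
  show "(LBINT s:{0..}. ?F y s \<bullet> x) = gramian_form y x"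
    unfolding gramian_form_def by (rule set_lebesgue_integral_cong) (auto simp: gramian_kernel_eq)
qed

theorem gramian_is_gramian: "is_gramian S G S' G' (gramian S G S' G')"
proof -
  let ?F = "\<lambda>y s. S s (G (adjoint G' (adjoint (S' s) y)))"
  obtain P where P: "is_gramian S G S' G' P" using is_gramian_exists by blast
  have "gramian S G S' G' = P"
    unfolding gramian_def weak_operator_integral_def
  proof (rule the_equality)
    show "bounded_linear P \<and> (\<forall>y x. set_integrable lborel {0..} (\<lambda>s. ?F y s \<bullet> x) \<and>
        P y \<bullet> x = (LBINT s:{0..}. ?F y s \<bullet> x))"
      using P by (simp add: is_gramian_iff set_integral_weak_gramian)
    fix Q assume "bounded_linear Q \<and> (\<forall>y x. set_integrable lborel {0..} (\<lambda>s. ?F y s \<bullet> x) \<and>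
        Q y \<bullet> x = (LBINT s:{0..}. ?F y s \<bullet> x))"
    then have "Q y \<bullet> x = P y \<bullet> x" for y x using P by (simp add: is_gramian_iff set_integral_weak_gramian)
    then show "Q = P" by (metis vector_eq_rdot ext)
  qed
  with P show ?thesis by simp
qed

text \<open>
  The function \<open>f t = P S'\<^sub>t\<^sup>* y \<bullet> S\<^sub>t\<^sup>* x\<close> is differentiable with derivative minus the kernel, and it
  tends to \<open>0\<close>. The two orbits are only weakly differentiable and Lipschitz; this suffices for a
  product rule, since the mixed increment is quadratic in the time step.
\<close>
lemma lyapunov_solution_on_domains:
  assumes P: "lyapunov_solution (generator S) (generator S') G G' P"
    and x: "(x, x') \<in> adjoint_graph (generator S)" and y: "(y, y') \<in> adjoint_graph (generator S')"
  shows "P y \<bullet> x = gramian_form y x"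
proof -
  have blP: "bounded_linear P" using P by (simp add: lyapunov_solution_def)
  define \<xi> where "\<xi> t = adjoint (S t) x" for t
  define \<eta> where "\<eta> t = adjoint (S' t) y" for t
  define f where "f t = P (\<eta> t) \<bullet> \<xi> t" for t
  have deriv: "(f has_real_derivative - k y x t) (at t within {0..N})" if t: "t \<in> {0..N}" for t N
  proof -
    have t0: "0 \<le> t" using t by simp
    obtain c where c: "c \<ge> 0" "\<And>s t. s \<ge> 0 \<Longrightarrow> t \<ge> 0 \<Longrightarrow> norm (\<xi> t - \<xi> s) \<le> c * \<bar>t - s\<bar>"
      using S.adjoint_orbit_lipschitz[OF x] unfolding \<xi>_def by blast
    obtain c' where c': "c' \<ge> 0" "\<And>s t. s \<ge> 0 \<Longrightarrow> t \<ge> 0 \<Longrightarrow> norm (\<eta> t - \<eta> s) \<le> c' * \<bar>t - s\<bar>"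
      using S'.adjoint_orbit_lipschitz[OF y] unfolding \<eta>_def by blast
    \<comment> \<open>The mixed increment, which does not contribute to the derivative.\<close>
    define r where "r s = P (\<eta> s - \<eta> t) \<bullet> (\<xi> s - \<xi> t)" for s
    have r: "(r has_real_derivative 0) (at t within {0..N})"
    proof (rule has_real_derivative_zero_if_quadratic[OF t])
      fix s assume s: "s \<in> {0..N}"
      have "\<bar>r s\<bar> \<le> norm (P (\<eta> s - \<eta> t)) * norm (\<xi> s - \<xi> t)"
        unfolding r_def by (rule Cauchy_Schwarz_ineq2)
      also have "\<dots> \<le> (onorm P * (c' * \<bar>s - t\<bar>)) * (c * \<bar>s - t\<bar>)"
      proof (rule mult_mono)
        have "norm (P (\<eta> s - \<eta> t)) \<le> onorm P * norm (\<eta> s - \<eta> t)" by (rule onorm[OF blP])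
        also have "\<dots> \<le> onorm P * (c' * \<bar>s - t\<bar>)"
          using c'(2)[of t s] s t by (intro mult_left_mono onorm_pos_le blP) auto
        finally show "norm (P (\<eta> s - \<eta> t)) \<le> onorm P * (c' * \<bar>s - t\<bar>)" .
        show "norm (\<xi> s - \<xi> t) \<le> c * \<bar>s - t\<bar>" using c(2)[of t s] s t by auto
      qed (use c' onorm_pos_le[OF blP] in auto)
      also have "\<dots> = (onorm P * c' * c) * (s - t)\<^sup>2" by (simp add: power2_eq_square abs_mult[symmetric])
      finally show "\<bar>r s\<bar> \<le> (onorm P * c' * c) * (s - t)\<^sup>2" .
    qed
    let ?D = "0 + S t (P (\<eta> t)) \<bullet> x' + S' t (adjoint P (\<xi> t)) \<bullet> y' - 0"
    have D: "((\<lambda>s. r s + S s (P (\<eta> t)) \<bullet> x + S' s (adjoint P (\<xi> t)) \<bullet> y - f t) has_real_derivative ?D) (at t within {0..N})"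
      by (intro DERIV_add DERIV_diff r S.orbit_inner_derivative S'.orbit_inner_derivative t x y DERIV_const)
    have eq: "r s + S s (P (\<eta> t)) \<bullet> x + S' s (adjoint P (\<xi> t)) \<bullet> y - f t = f s" if "s \<in> {0..N}" for s
    proof -
      have "S s (P (\<eta> t)) \<bullet> x = P (\<eta> t) \<bullet> \<xi> s"
        using that by (simp add: \<xi>_def inner_adjoint[OF S.bounded_linear_semigroup])
      moreover have "S' s (adjoint P (\<xi> t)) \<bullet> y = P (\<eta> s) \<bullet> \<xi> t"
        using that
        by (simp add: \<eta>_def inner_adjoint[OF blP, symmetric] inner_adjoint[OF S'.bounded_linear_semigroup, symmetric])
           (metis adjoint_inner[OF blP] inner_commute)
      ultimately show ?thesis
        by (simp add: r_def f_def linear_diff[OF bounded_linear.linear[OF blP]] inner_diff)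
    qed
    have "?D = P (\<eta> t) \<bullet> adjoint (S t) x' + P (adjoint (S' t) y') \<bullet> \<xi> t"
      using adjoint_inner[OF blP, of "\<xi> t" "adjoint (S' t) y'"]
      by (simp add: inner_adjoint[OF S.bounded_linear_semigroup[OF t0]]
          inner_adjoint[OF S'.bounded_linear_semigroup[OF t0]] inner_commute[of "P _" "\<xi> t"])
    also have "\<dots> = - (G (adjoint G' (\<eta> t)) \<bullet> \<xi> t)"
      using P S.adjoint_graph_semigroup[OF t0 x] S'.adjoint_graph_semigroup[OF t0 y]
      unfolding lyapunov_solution_def \<eta>_def \<xi>_def by blast
    also have "\<dots> = - k y x t"
      using gramian_kernel_eq[OF t0, of y x]
      by (simp add: \<eta>_def \<xi>_def inner_adjoint[OF S.bounded_linear_semigroup[OF t0]])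
    finally have "?D = - k y x t" .
    with D have D': "((\<lambda>s. r s + S s (P (\<eta> t)) \<bullet> x + S' s (adjoint P (\<xi> t)) \<bullet> y - f t)
        has_vector_derivative - k y x t) (at t within {0..N})"
      by (simp add: has_real_derivative_iff_has_vector_derivative)
    show ?thesis
      unfolding has_real_derivative_iff_has_vector_derivative
      by (rule has_vector_derivative_transform[OF t _ D']) (use eq in auto)
  qed
  have int: "(LBINT s:{0..N}. k y x s) = f 0 - f N" if "0 \<le> N" for N
  proof -
    have "(LBINT s:{0..N}. - k y x s) = f N - f 0"
      unfolding set_lebesgue_integral_def
      by (rule integral_FTC_Icc[OF that])
        (use deriv continuous_on_subset[OF continuous_gramian_kernel, of "{0..N}"] in
          \<open>auto simp: has_real_derivative_iff_has_vector_derivative intro: continuous_on_minus\<close>)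
    then show ?thesis by (simp add: set_lebesgue_integral_def)
  qed
  have f0: "f 0 = P y \<bullet> x"
  proof -
    have "adjoint (S 0) x = x"
      by (rule vector_eq_ldot[THEN iffD1])
        (simp add: inner_adjoint[OF S.bounded_linear_semigroup] S.semigroup_0)
    moreover have "adjoint (S' 0) y = y"
      by (rule vector_eq_ldot[THEN iffD1])
        (simp add: inner_adjoint[OF S'.bounded_linear_semigroup] S'.semigroup_0)
    ultimately show ?thesis by (simp add: f_def \<xi>_def \<eta>_def)
  qed
  have lim: "(f \<longlongrightarrow> 0) at_top"
  proof -
    obtain \<omega> \<nu> where 1: "\<omega> > 0" "\<nu> \<ge> 1" "\<And>t x. 0 \<le> t \<Longrightarrow> norm (S t x) \<le> \<nu> * exp (- \<omega> * t) * norm x"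
      using S.decay by metis
    obtain \<nu>' where 2: "\<nu>' \<ge> 1" "\<And>t x. 0 \<le> t \<Longrightarrow> norm (S' t x) \<le> \<nu>' * norm x"
      using S'.bounded_semigroup by metis
    let ?c = "\<nu> * (onorm P * (\<nu>' * norm y)) * norm x"
    have "\<forall>\<^sub>F t in at_top. norm (f t) \<le> ?c * exp (- \<omega> * t)"
      using eventually_ge_at_top[of 0]
    proof eventually_elim
      case (elim t)
      have "norm (\<eta> t) \<le> \<nu>' * norm y"
      proof (rule norm_le_if_inner_le)
        show "\<bar>\<eta> t \<bullet> a\<bar> \<le> \<nu>' * norm y * norm a" for a
          using Cauchy_Schwarz_ineq2[of y "S' t a"] mult_left_mono[OF 2(2)[OF elim, of a], of "norm y"]
          unfolding \<eta>_def adjoint_inner[OF S'.bounded_linear_semigroup[OF elim]]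
          by (simp add: ac_simps)
      qed (use 2 in simp)
      then have "onorm P * norm (\<eta> t) \<le> onorm P * (\<nu>' * norm y)"
        by (rule mult_left_mono) (rule onorm_pos_le[OF blP])
      with onorm[OF blP] have "norm (P (\<eta> t)) \<le> onorm P * (\<nu>' * norm y)" by (rule order_trans)
      moreover have "0 \<le> \<nu> * exp (- \<omega> * t)" using 1(2) by simp
      ultimately have "\<nu> * exp (- \<omega> * t) * norm (P (\<eta> t)) \<le> \<nu> * exp (- \<omega> * t) * (onorm P * (\<nu>' * norm y))"
        by (rule mult_left_mono)
      with 1(3)[OF elim] have "norm (S t (P (\<eta> t))) \<le> \<nu> * exp (- \<omega> * t) * (onorm P * (\<nu>' * norm y))"
        by (rule order_trans)
      then have "norm (S t (P (\<eta> t))) * norm x \<le> \<nu> * exp (- \<omega> * t) * (onorm P * (\<nu>' * norm y)) * norm x"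
        by (rule mult_right_mono) simp
      moreover have "norm (f t) \<le> norm (S t (P (\<eta> t))) * norm x"
        using Cauchy_Schwarz_ineq2[of "S t (P (\<eta> t))" x]
        by (simp add: f_def \<xi>_def inner_adjoint[OF S.bounded_linear_semigroup[OF elim]])
      ultimately show ?case by (simp add: ac_simps)
    qed
    moreover have "((\<lambda>t. ?c * exp (- \<omega> * t)) \<longlongrightarrow> 0) at_top"
    proof -
      have "((\<lambda>t. exp (- \<omega> * t)) \<longlongrightarrow> 0) at_top" using 1(1) by real_asymp
      then show ?thesis by (rule tendsto_mult_right_zero)
    qed
    ultimately show ?thesis by (rule Lim_null_comparison)
  qed
  have "((\<lambda>N. LBINT s:{0..N}. k y x s) \<longlongrightarrow> gramian_form y x) at_top"
    unfolding gramian_form_def by (rule tendsto_set_lebesgue_integral_at_top) (auto intro: gramian_kernel_integrable)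
  moreover have "((\<lambda>N. LBINT s:{0..N}. k y x s) \<longlongrightarrow> f 0 - 0) at_top"
  proof (rule Lim_transform_eventually)
    show "((\<lambda>N. f 0 - f N) \<longlongrightarrow> f 0 - 0) at_top" by (intro tendsto_intros lim)
    show "\<forall>\<^sub>F N in at_top. f 0 - f N = (LBINT s:{0..N}. k y x s)"
      using eventually_ge_at_top[of 0] by eventually_elim (simp add: int)
  qed
  ultimately have "gramian_form y x = f 0 - 0" by (rule tendsto_unique[rotated]) simp
  with f0 show ?thesis by simp
qed

text \<open>
  Both sides are bounded bilinear forms, so their equality on the weakly dense domains extends to all
  vectors, first in \<open>x\<close> and then in \<open>y\<close>.
\<close>
theorem lyapunov_solution_is_gramian:
  assumes P: "lyapunov_solution (generator S) (generator S') G G' P"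
  shows "is_gramian S G S' G' P"
proof -
  have blP: "bounded_linear P" using P by (simp add: lyapunov_solution_def)
  have 1: "P y \<bullet> x - gramian_form y x = 0" if "(y, y') \<in> adjoint_graph (generator S')" for y y' x
  proof (rule S.adjoint_domain_dense)
    show "bounded_linear (\<lambda>x. P y \<bullet> x - gramian_form y x)"
      by (intro bounded_linear_sub bounded_linear_inner_right bounded_linear_gramian_form)
  qed (use lyapunov_solution_on_domains[OF P _ that] in auto)
  have "P y \<bullet> x - gramian_form y x = 0" for y x
  proof (rule S'.adjoint_domain_dense)
    show "bounded_linear (\<lambda>y. P y \<bullet> x - gramian_form y x)"
      by (intro bounded_linear_sub bounded_linear_inner_left_comp blP bounded_linear_gramian_form)
  qed (use 1 in auto)
  then show ?thesis using blP by (simp add: is_gramian_iff)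
qed

end

section \<open>The positive semidefinite square root\<close>

text \<open>
  The eigenvector maximizes the quadratic form on the unit sphere of \<open>V\<close>: the vanishing of the first
  variation is the eigenvector equation, tested against \<open>V\<close>.
\<close>
lemma selfadjoint_eigenvector:
  fixes f :: "'a::euclidean_space \<Rightarrow> 'a"
  assumes f: "linear f" and sym: "\<And>x y. f x \<bullet> y = x \<bullet> f y"
    and V: "subspace V" "\<And>x. x \<in> V \<Longrightarrow> f x \<in> V" and ne: "z \<in> V" "z \<noteq> 0"
  shows "\<exists>x\<in>V. norm x = 1 \<and> f x = (f x \<bullet> x) *\<^sub>R x"
proof -
  let ?K = "V \<inter> sphere 0 1"
  have "compact ?K" by (intro closed_Int_compact closed_subspace V compact_sphere)
  moreover have "z /\<^sub>R norm z \<in> ?K" using ne V by (simp add: subspace_scale)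
  moreover have "continuous_on ?K (\<lambda>x. f x \<bullet> x)"
    by (intro continuous_intros linear_continuous_on f[unfolded linear_conv_bounded_linear])
  ultimately obtain x where x: "x \<in> ?K" "\<And>y. y \<in> ?K \<Longrightarrow> f y \<bullet> y \<le> f x \<bullet> x"
    using continuous_attains_sup[of ?K "\<lambda>x. f x \<bullet> x"] by blast
  define l where "l = f x \<bullet> x"
  have x1: "x \<in> V" "x \<bullet> x = 1" using x(1) by (auto simp: norm_eq_1)
  have pos: "0 \<le> l * (y \<bullet> y) - f y \<bullet> y" if "y \<in> V" for y
  proof (cases "y = 0")
    case False
    have "y /\<^sub>R norm y \<in> ?K" using False that V by (simp add: subspace_scale)
    from x(2)[OF this] have "(f y \<bullet> y) / (norm y)\<^sup>2 \<le> l"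
      by (simp add: linear_scale[OF f] l_def power2_eq_square divide_inverse ac_simps)
    then show ?thesis using False by (simp add: divide_le_eq power2_norm_eq_inner)
  qed (simp add: linear_0[OF f])
  have "(l *\<^sub>R x - f x) \<bullet> y = 0" if y: "y \<in> V" for y
  proof (rule linear_coefficient_zero)
    show "0 \<le> 2 * t * ((l *\<^sub>R x - f x) \<bullet> y) + t\<^sup>2 * (l * (y \<bullet> y) - f y \<bullet> y)" for t
    proof -
      have "x + t *\<^sub>R y \<in> V" using x1 y V by (simp add: subspace_add subspace_scale)
      from pos[OF this] show ?thesis
        using sym[of y x] x1(2) l_def
        by (simp add: linear_add[OF f] linear_scale[OF f] inner_add inner_diff
            inner_commute power2_eq_square algebra_simps)
    qed
    show "0 \<le> l * (y \<bullet> y) - f y \<bullet> y" by (rule pos[OF y])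
  qed
  moreover have "l *\<^sub>R x - f x \<in> V" using x1 V by (simp add: subspace_diff subspace_scale)
  ultimately have "l *\<^sub>R x - f x = 0" by (metis inner_eq_zero_iff)
  then show ?thesis using x1 by (intro bexI[of _ x]) (auto simp: l_def norm_eq_1)
qed

text \<open>
  An orthonormal set of eigenvectors of largest cardinality spans the space: its orthogonal
  complement is invariant, and a nonzero complement would contribute another eigenvector.
\<close>
lemma selfadjoint_eigenbasis:
  fixes f :: "'a::euclidean_space \<Rightarrow> 'a"
  assumes f: "linear f" and sym: "\<And>x y. f x \<bullet> y = x \<bullet> f y"
  shows "\<exists>B. finite B \<and> orthonormal_set B \<and> (\<forall>e\<in>B. f e = (f e \<bullet> e) *\<^sub>R e) \<and>
    (\<forall>x. x = (\<Sum>e\<in>B. (x \<bullet> e) *\<^sub>R e))"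
proof -
  let ?P = "\<lambda>B. orthonormal_set B \<and> (\<forall>e\<in>B. f e = (f e \<bullet> e) *\<^sub>R e)"
  have bound: "finite B \<and> card B < Suc DIM('a)" if "?P B" for B
  proof -
    have "independent B"
      using that by (intro pairwise_orthogonal_independent)
        (auto simp: pairwise_def orthogonal_def orthonormal_set_def)
    then show ?thesis using independent_bound[of B] by simp
  qed
  have "?P {}" by (simp add: orthonormal_set_def)
  then obtain B where B: "?P B" "\<And>B'. ?P B' \<Longrightarrow> card B' \<le> card B"
    using ex_has_greatest_nat[of ?P "{}" card "Suc DIM('a)"] bound by blast
  have fin: "finite B" using B(1) bound by blast
  define V where "V = {y. \<forall>e\<in>B. y \<bullet> e = 0}"
  have "y = 0" if y: "y \<in> V" for y
  proof (rule ccontr)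
    assume "y \<noteq> 0"
    have "subspace V" by (auto simp: V_def subspace_def inner_add_left)
    moreover have "f x \<in> V" if "x \<in> V" for x
    proof -
      have "f x \<bullet> e = 0" if e: "e \<in> B" for e
      proof -
        have "f x \<bullet> e = x \<bullet> f e" by (rule sym)
        also have "\<dots> = x \<bullet> ((f e \<bullet> e) *\<^sub>R e)" using B(1) e by metis
        also have "\<dots> = 0" using \<open>x \<in> V\<close> e by (simp add: V_def)
        finally show ?thesis .
      qed
      then show ?thesis by (simp add: V_def)
    qed
    ultimately obtain x where x: "x \<in> V" "norm x = 1" "f x = (f x \<bullet> x) *\<^sub>R x"
      using selfadjoint_eigenvector[OF f sym _ _ y \<open>y \<noteq> 0\<close>] by blast
    have "x \<notin> B" using x by (auto simp: V_def norm_eq_1)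
    moreover have "?P (insert x B)"
      using B(1) x by (auto simp: orthonormal_set_def V_def inner_commute)
    ultimately show False using B(2)[of "insert x B"] fin by simp
  qed
  moreover have "x - (\<Sum>e\<in>B. (x \<bullet> e) *\<^sub>R e) \<in> V" for x
    using B(1) fin by (simp add: V_def inner_diff_left inner_orthonormal_sum)
  ultimately have "x = (\<Sum>e\<in>B. (x \<bullet> e) *\<^sub>R e)" for x by (metis eq_iff_diff_eq_0)
  with B(1) fin show ?thesis by blast
qed

text \<open>
  The square roots of the eigenvalues in an orthonormal eigenbasis define a positive semidefinite
  square root, so the choice in \<open>psd_sqrt\<close> is not vacuous.
\<close>
lemma psd_sqrt_works:
  fixes Q :: "real ^ 'n ^ 'n"
  assumes sym: "transpose Q = Q" and psd: "\<And>x. 0 \<le> (Q *v x) \<bullet> x"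
  shows "transpose (psd_sqrt Q) = psd_sqrt Q" "psd_sqrt Q ** psd_sqrt Q = Q"
proof -
  let ?f = "\<lambda>x. Q *v x"
  have fsym: "?f x \<bullet> y = x \<bullet> ?f y" for x y
    using dot_lmul_matrix[of x Q y] transpose_matrix_vector[of Q x] sym by simp
  obtain B where B: "finite B" "orthonormal_set B" "\<And>e. e \<in> B \<Longrightarrow> Q *v e = ((Q *v e) \<bullet> e) *\<^sub>R e"
    "\<And>x. x = (\<Sum>e\<in>B. (x \<bullet> e) *\<^sub>R e)"
    using selfadjoint_eigenbasis[of ?f, OF matrix_vector_mul_linear fsym] by blast
  define g where "g x = (\<Sum>e\<in>B. (sqrt ((Q *v e) \<bullet> e) * (x \<bullet> e)) *\<^sub>R e)" for x
  have g: "linear g"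
    by (rule linearI) (simp_all add: g_def inner_add_left algebra_simps sum.distrib scaleR_sum_right)
  have ge: "g x \<bullet> e = sqrt ((Q *v e) \<bullet> e) * (x \<bullet> e)" if "e \<in> B" for x e
    unfolding g_def using inner_orthonormal_sum[OF B(2,1) that] by simp
  have gsym: "g x \<bullet> y = x \<bullet> g y" for x y
    by (simp add: g_def inner_sum_left inner_sum_right inner_commute ac_simps)
  have gg: "g (g x) = Q *v x" for x
  proof -
    have "Q *v x = Q *v (\<Sum>e\<in>B. (x \<bullet> e) *\<^sub>R e)"
      by (rule arg_cong[OF B(4)])
    also have "\<dots> = (\<Sum>e\<in>B. (x \<bullet> e) *\<^sub>R (Q *v e))"
      by (simp add: linear_sum[OF matrix_vector_mul_linear] linear_scale[OF matrix_vector_mul_linear])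
    also have "\<dots> = (\<Sum>e\<in>B. (x \<bullet> e) *\<^sub>R (((Q *v e) \<bullet> e) *\<^sub>R e))"
      by (intro sum.cong refl arg_cong[OF B(3)])
    also have "\<dots> = g (g x)"
      unfolding g_def[of "g x"]
    proof (intro sum.cong refl)
      fix e assume e: "e \<in> B"
      have "sqrt ((Q *v e) \<bullet> e) * (sqrt ((Q *v e) \<bullet> e) * c) = c * ((Q *v e) \<bullet> e)" for c
        using psd[of e] by (simp flip: mult.assoc)
      then show "(x \<bullet> e) *\<^sub>R (((Q *v e) \<bullet> e) *\<^sub>R e) = (sqrt ((Q *v e) \<bullet> e) * (g x \<bullet> e)) *\<^sub>R e"
        using psd[of e] by (simp add: ge[OF e])
    qed
    finally show ?thesis ..
  qed
  define R where "R = matrix g"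
  have R: "R *v x = g x" for x unfolding R_def using matrix_vector_mul(2)[OF g] by metis
  have "transpose R = R"
  proof (rule matrix_eq[THEN iffD2], rule allI, rule vector_eq_rdot[THEN iffD1], rule allI)
    show "(transpose R *v x) \<bullet> y = (R *v x) \<bullet> y" for x y
      using dot_lmul_matrix[of x R y] by (simp add: R gsym)
  qed
  moreover have "0 \<le> (R *v x) \<bullet> x" for x
  proof -
    have "(R *v x) \<bullet> x = (\<Sum>e\<in>B. sqrt ((Q *v e) \<bullet> e) * (x \<bullet> e)\<^sup>2)"
      unfolding R g_def inner_sum_left
      by (intro sum.cong refl) (simp add: power2_eq_square inner_commute[of _ x])
    then show ?thesis by (simp add: sum_nonneg psd)
  qed
  moreover have "R ** R = Q"
    by (rule matrix_eq[THEN iffD2]) (simp add: R gg flip: matrix_vector_mul_assoc)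
  ultimately have "\<exists>R. transpose R = R \<and> (\<forall>x. 0 \<le> (R *v x) \<bullet> x) \<and> R ** R = Q" by blast
  from someI_ex[OF this] show "transpose (psd_sqrt Q) = psd_sqrt Q" "psd_sqrt Q ** psd_sqrt Q = Q"
    by (simp_all add: psd_sqrt_def)
qed

section \<open>Second moments of a square-integrable Levy process\<close>

text \<open>
  Nonnegativity makes the additive function monotone; comparing \<open>n t\<close> with the neighbouring integers
  bounds \<open>n \<bar>f t - t f 1\<bar>\<close> by \<open>f 1\<close> for every \<open>n\<close>.
\<close>
lemma additive_nonneg_linear:
  fixes f :: "real \<Rightarrow> real"
  assumes add: "\<And>s t. 0 \<le> s \<Longrightarrow> 0 \<le> t \<Longrightarrow> f (s + t) = f s + f t"
    and nonneg: "\<And>t. 0 \<le> t \<Longrightarrow> 0 \<le> f t" and t: "0 \<le> t"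
  shows "f t = t * f 1"
proof -
  have f0: "f 0 = 0" using add[of 0 0] by simp
  have f_mult: "f (real n * s) = real n * f s" if "0 \<le> s" for n s
    using that by (induct n) (simp_all add: f0 add algebra_simps)
  have mono: "f s \<le> f t" if "0 \<le> s" "s \<le> t" for s t
    using add[of s "t - s"] nonneg[of "t - s"] that by simp
  have close: "real n * \<bar>f t - t * f 1\<bar> \<le> f 1" for n
  proof -
    define m where "m = nat \<lfloor>real n * t\<rfloor>"
    have m: "real m \<le> real n * t" "real n * t \<le> real (Suc m)"
      using t by (auto simp: m_def) linarith
    have "real m * f 1 \<le> real n * f t"
      using mono[OF _ m(1)] f_mult[of 1 m] f_mult[OF t, of n] by simp
    moreover have "real n * f t \<le> real (Suc m) * f 1"
      using mono[OF _ m(2)] f_mult[of 1 "Suc m"] f_mult[OF t, of n] t by simp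
    moreover have "real m * f 1 \<le> (real n * t) * f 1" "(real n * t) * f 1 \<le> real (Suc m) * f 1"
      using m nonneg[of 1] by (auto intro: mult_right_mono)
    moreover have "real (Suc m) * f 1 = real m * f 1 + f 1" by (simp add: algebra_simps)
    ultimately have "\<bar>real n * f t - (real n * t) * f 1\<bar> \<le> f 1" by linarith
    moreover have "real n * f t - (real n * t) * f 1 = real n * (f t - t * f 1)" by (simp add: algebra_simps)
    ultimately show ?thesis by (simp add: abs_mult)
  qed
  have "\<bar>f t - t * f 1\<bar> \<le> 0"
  proof (rule ccontr)
    assume "\<not> \<bar>f t - t * f 1\<bar> \<le> 0"
    then have "\<bar>f t - t * f 1\<bar> > 0" by simp
    then obtain n where "f 1 < real n * \<bar>f t - t * f 1\<bar>" using ex_less_of_nat_mult by blast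
    with close[of n] show False by simp
  qed
  then show ?thesis by simp
qed

locale square_integrable_levy = prob_space M for M :: "'w measure" +
  fixes L :: "real \<Rightarrow> 'w \<Rightarrow> real ^ 'd"
  assumes levy: "levy_process M L" and square_integrable: "square_integrable_mean_zero M L"
begin

lemma L_measurable [measurable]: "0 \<le> t \<Longrightarrow> L t \<in> borel_measurable M"
  using levy by (simp add: levy_process_def)

lemma L_0: "AE \<omega> in M. L 0 \<omega> = 0"
  using levy by (simp add: levy_process_def)

lemma integrable_mult_components:
  assumes "0 \<le> s" "0 \<le> t"
  shows "integrable M (\<lambda>\<omega>. (L s \<omega> \<bullet> a) * (L t \<omega> \<bullet> b))"
proof (rule Bochner_Integration.integrable_bound)
  show "integrable M (\<lambda>\<omega>. (norm a * norm b) * ((norm (L s \<omega>))\<^sup>2 + (norm (L t \<omega>))\<^sup>2))"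
    using square_integrable assms
    by (intro integrable_mult_right Bochner_Integration.integrable_add) (auto simp: square_integrable_mean_zero_def)
  show "(\<lambda>\<omega>. (L s \<omega> \<bullet> a) * (L t \<omega> \<bullet> b)) \<in> borel_measurable M" using assms by measurable
  have "\<bar>(x \<bullet> a) * (y \<bullet> b)\<bar> \<le> (norm a * norm b) * ((norm x)\<^sup>2 + (norm y)\<^sup>2)" for x y :: "real ^ 'd"
  proof -
    have "\<bar>(x \<bullet> a) * (y \<bullet> b)\<bar> \<le> (norm x * norm a) * (norm y * norm b)"
      unfolding abs_mult by (intro mult_mono Cauchy_Schwarz_ineq2) auto
    also have "\<dots> = (norm a * norm b) * (norm x * norm y)" by (simp add: ac_simps)
    also have "\<dots> \<le> (norm a * norm b) * ((norm x)\<^sup>2 + (norm y)\<^sup>2)"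
    proof (rule mult_left_mono)
      have "2 * (norm x * norm y) \<le> (norm x)\<^sup>2 + (norm y)\<^sup>2"
        using sum_squares_bound[of "norm x" "norm y"] by simp
      then show "norm x * norm y \<le> (norm x)\<^sup>2 + (norm y)\<^sup>2"
        by (smt (verit) norm_ge_zero mult_nonneg_nonneg)
    qed simp
    finally show ?thesis .
  qed
  then show "AE \<omega> in M. norm ((L s \<omega> \<bullet> a) * (L t \<omega> \<bullet> b))
      \<le> norm ((norm a * norm b) * ((norm (L s \<omega>))\<^sup>2 + (norm (L t \<omega>))\<^sup>2))"
    by (intro AE_I2) (auto intro: order_trans[OF _ abs_ge_self])
qed

lemma L_integrable:
  assumes "0 \<le> t"
  shows "integrable M (L t)"
proof (rule Bochner_Integration.integrable_bound)
  show "integrable M (\<lambda>\<omega>. 1 + (norm (L t \<omega>))\<^sup>2)"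
    using square_integrable assms by (simp add: square_integrable_mean_zero_def)
  have "n \<le> 1 + n\<^sup>2" for n :: real
    using sum_squares_bound[of 1 n] zero_le_power2[of n] unfolding power_one by argo
  then show "AE \<omega> in M. norm (L t \<omega>) \<le> norm (1 + (norm (L t \<omega>))\<^sup>2)"
    by (intro AE_I2) (simp add: abs_of_pos add_pos_nonneg)
qed (use assms in measurable)

lemma expectation_L: "0 \<le> t \<Longrightarrow> expectation (L t) = 0"
  using square_integrable by (simp add: square_integrable_mean_zero_def)

abbreviation moment :: "real \<Rightarrow> real ^ 'd \<Rightarrow> real \<Rightarrow> real ^ 'd \<Rightarrow> real" where
  "moment s a t b \<equiv> expectation (\<lambda>\<omega>. (L s \<omega> \<bullet> a) * (L t \<omega> \<bullet> b))"

lemma increment_orthogonal: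
  assumes st: "0 \<le> s" "s \<le> t"
  shows "expectation (\<lambda>\<omega>. (L s \<omega> \<bullet> a) * ((L t \<omega> - L s \<omega>) \<bullet> b)) = 0"
proof -
  define p where "p i = (if i = 0 then 0 else if i = 1 then s else t)" for i :: nat
  have "indep_vars (\<lambda>_. borel) (\<lambda>i \<omega>. L (p (Suc i)) \<omega> - L (p i) \<omega>) {..<2}"
  proof -
    have "0 \<le> p 0 \<and> (\<forall>i<2. p i \<le> p (Suc i))" using st by (auto simp: p_def less_2_cases_iff)
    then show ?thesis using levy by (simp add: levy_process_def)
  qed
  from indep_vars_compose2[OF this, of "\<lambda>i x. x \<bullet> (if i = 0 then a else b)" "\<lambda>_. borel"]
  have ind: "indep_vars (\<lambda>_. borel) (\<lambda>i \<omega>. (L (p (Suc i)) \<omega> - L (p i) \<omega>) \<bullet> (if i = 0 then a else b)) {..<2}"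
    by simp
  have "expectation (\<lambda>\<omega>. \<Prod>i<2. (L (p (Suc i)) \<omega> - L (p i) \<omega>) \<bullet> (if i = 0 then a else b)) =
     (\<Prod>i<2. expectation (\<lambda>\<omega>. (L (p (Suc i)) \<omega> - L (p i) \<omega>) \<bullet> (if i = 0 then a else b)))"
    by (rule indep_vars_lebesgue_integral[OF _ ind]) (use st in \<open>auto simp: p_def intro!: L_integrable Bochner_Integration.integrable_diff\<close>)
  then have "expectation (\<lambda>\<omega>. ((L s \<omega> - L 0 \<omega>) \<bullet> a) * ((L t \<omega> - L s \<omega>) \<bullet> b)) = 0"
    using st by (simp add: p_def numeral_2_eq_2 inner_diff_left L_integrable expectation_L)
  moreover have "expectation (\<lambda>\<omega>. ((L s \<omega> - L 0 \<omega>) \<bullet> a) * ((L t \<omega> - L s \<omega>) \<bullet> b)) =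
    expectation (\<lambda>\<omega>. (L s \<omega> \<bullet> a) * ((L t \<omega> - L s \<omega>) \<bullet> b))"
    by (rule integral_cong_AE) (use st L_0 in auto)
  ultimately show ?thesis by simp
qed

definition cov :: "real ^ 'd \<Rightarrow> real ^ 'd \<Rightarrow> real" where
  "cov a b = moment 1 a 1 b"

text \<open>
  By independence and stationarity of the increments the second moment is additive in time, hence
  linear.
\<close>
lemma second_moment: "0 \<le> t \<Longrightarrow> expectation (\<lambda>\<omega>. (L t \<omega> \<bullet> a)\<^sup>2) = t * cov a a"
proof -
  define q where "q t = expectation (\<lambda>\<omega>. (L t \<omega> \<bullet> a)\<^sup>2)" for t
  have add: "q (s + t) = q s + q t" if st: "0 \<le> s" "0 \<le> t" for s t
  proof -
    let ?D = "\<lambda>\<omega>. L (s + t) \<omega> - L s \<omega>"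
    have "expectation (\<lambda>\<omega>. (?D \<omega> \<bullet> a)\<^sup>2) = integral\<^sup>L (distr M borel ?D) (\<lambda>x. (x \<bullet> a)\<^sup>2)"
      using st by (intro integral_distr[symmetric]) measurable
    also have "distr M borel ?D = distr M borel (L t)"
    proof -
      have "\<forall>s\<ge>0. \<forall>t\<ge>s. distr M borel (\<lambda>\<omega>. L t \<omega> - L s \<omega>) = distr M borel (L (t - s))"
        using levy by (simp add: levy_process_def)
      from this[rule_format, of s "s + t"] st show ?thesis by simp
    qed
    also have "integral\<^sup>L \<dots> (\<lambda>x. (x \<bullet> a)\<^sup>2) = q t"
      unfolding q_def using st by (intro integral_distr) measurable
    finally have D: "expectation (\<lambda>\<omega>. (?D \<omega> \<bullet> a)\<^sup>2) = q t" .
    note int = integrable_mult_components[of _ _ a a]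
    have "q (s + t) = expectation (\<lambda>\<omega>. (L s \<omega> \<bullet> a)\<^sup>2 + (?D \<omega> \<bullet> a)\<^sup>2 + 2 * ((L s \<omega> \<bullet> a) * (?D \<omega> \<bullet> a)))"
      unfolding q_def by (intro Bochner_Integration.integral_cong refl)
        (simp add: inner_diff_left power2_eq_square algebra_simps)
    also have "\<dots> = q s + q t + 2 * expectation (\<lambda>\<omega>. (L s \<omega> \<bullet> a) * (?D \<omega> \<bullet> a))"
      unfolding D[symmetric] using st int
      by (simp add: q_def inner_diff_left power2_eq_square algebra_simps)
    finally show ?thesis using increment_orthogonal[of s "s + t" a a] st by simp
  qed
  have "q t = t * q 1" if "0 \<le> t"
    by (rule additive_nonneg_linear[OF add _ that]) (auto simp: q_def)
  then show "0 \<le> t \<Longrightarrow> expectation (\<lambda>\<omega>. (L t \<omega> \<bullet> a)\<^sup>2) = t * cov a a"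
    by (simp add: q_def cov_def power2_eq_square)
qed

text \<open>Polarization of the second moments.\<close>
lemma mixed_moment:
  assumes t: "0 \<le> t"
  shows "moment t a t b = t * cov a b"
proof -
  have *: "4 * moment t a t b =
      expectation (\<lambda>\<omega>. (L t \<omega> \<bullet> (a + b))\<^sup>2) - expectation (\<lambda>\<omega>. (L t \<omega> \<bullet> (a - b))\<^sup>2)" if t: "0 \<le> t" for t
  proof -
    have "4 * moment t a t b =
      expectation (\<lambda>\<omega>. (L t \<omega> \<bullet> (a + b))\<^sup>2 - (L t \<omega> \<bullet> (a - b))\<^sup>2)"
      unfolding integral_mult_right_zero[symmetric]
      by (intro Bochner_Integration.integral_cong refl) (simp add: inner_add inner_diff power2_eq_square algebra_simps)
    also have "\<dots> = expectation (\<lambda>\<omega>. (L t \<omega> \<bullet> (a + b))\<^sup>2) - expectation (\<lambda>\<omega>. (L t \<omega> \<bullet> (a - b))\<^sup>2)"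
      using integrable_mult_components[OF t t] by (intro Bochner_Integration.integral_diff) (auto simp: power2_eq_square)
    finally show ?thesis .
  qed
  show ?thesis
  proof -
    have "4 * moment t a t b = t * (cov (a + b) (a + b) - cov (a - b) (a - b))"
      unfolding *[OF t] second_moment[OF t] by (simp add: algebra_simps)
    also have "cov (a + b) (a + b) - cov (a - b) (a - b) = 4 * cov a b"
      using *[of 1] second_moment[of 1] by (simp flip: cov_def)
    finally show ?thesis by simp
  qed
qed

lemma covariance_min:
  assumes "0 \<le> s" "0 \<le> t"
  shows "moment s a t b = min s t * cov a b"
proof -
  have *: "moment s a t b = s * cov a b" if "0 \<le> s" "s \<le> t" for s t a b
  proof -
    have "moment s a t b =
        expectation (\<lambda>\<omega>. (L s \<omega> \<bullet> a) * (L s \<omega> \<bullet> b) + (L s \<omega> \<bullet> a) * ((L t \<omega> - L s \<omega>) \<bullet> b))"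
      by (intro Bochner_Integration.integral_cong refl) (simp add: inner_diff_left algebra_simps)
    also have "\<dots> = expectation (\<lambda>\<omega>. (L s \<omega> \<bullet> a) * (L s \<omega> \<bullet> b)) +
        expectation (\<lambda>\<omega>. (L s \<omega> \<bullet> a) * ((L t \<omega> - L s \<omega>) \<bullet> b))"
      using that integrable_mult_components[of s s a b] integrable_mult_components[of s t a b]
      by (intro Bochner_Integration.integral_add) (auto simp: inner_diff_left right_diff_distrib)
    finally show ?thesis using that by (simp add: increment_orthogonal mixed_moment)
  qed
  show ?thesis
  proof (cases "s \<le> t")
    case False
    have "cov a b = cov b a" by (simp add: cov_def mult.commute)
    then show ?thesis using False assms *[of t s b a] by (simp add: mult.commute min_def)
  qed (use assms * in \<open>simp add: min_def\<close>)
qed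

text \<open>
  The first factor of the result is the length of the intersection of \<open>(a, b]\<close> and \<open>(c, d]\<close>.
\<close>
lemma increment_covariance:
  assumes "0 \<le> a" "a \<le> b" "0 \<le> c" "c \<le> d"
  shows "has_bochner_integral M (\<lambda>\<omega>. ((L b \<omega> - L a \<omega>) \<bullet> x) * ((L d \<omega> - L c \<omega>) \<bullet> y))
     (max 0 (min b d - max a c) * cov x y)"
proof -
  have eq: "((L b \<omega> - L a \<omega>) \<bullet> x) * ((L d \<omega> - L c \<omega>) \<bullet> y) =
    (L b \<omega> \<bullet> x) * (L d \<omega> \<bullet> y) - (L b \<omega> \<bullet> x) * (L c \<omega> \<bullet> y) -
    ((L a \<omega> \<bullet> x) * (L d \<omega> \<bullet> y) - (L a \<omega> \<bullet> x) * (L c \<omega> \<bullet> y))" for \<omega>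
    by (simp add: inner_diff_left algebra_simps)
  have one: "has_bochner_integral M (\<lambda>\<omega>. (L s \<omega> \<bullet> x) * (L t \<omega> \<bullet> y)) (min s t * cov x y)"
    if "0 \<le> s" "0 \<le> t" for s t
    using that by (simp add: has_bochner_integral_iff integrable_mult_components covariance_min)
  have "has_bochner_integral M (\<lambda>\<omega>. ((L b \<omega> - L a \<omega>) \<bullet> x) * ((L d \<omega> - L c \<omega>) \<bullet> y))
    (min b d * cov x y - min b c * cov x y - (min a d * cov x y - min a c * cov x y))"
    unfolding eq by (intro has_bochner_integral_diff one) (use assms in auto)
  also have "min b d * cov x y - min b c * cov x y - (min a d * cov x y - min a c * cov x y) =
     (min b d - min b c - min a d + min a c) * cov x y" by (simp add: algebra_simps)
  also have "min b d - min b c - min a d + min a c = max 0 (min b d - max a c)"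
    using assms by (auto simp: min_def max_def)
  finally show ?thesis .
qed

text \<open>
  The increments of \<open>L\<close> have the covariances of those of \<open>R W\<close> for a standard Brownian motion \<open>W\<close>.
\<close>
definition R :: "real ^ 'd ^ 'd" where "R = psd_sqrt (covariance M L)"

lemma cov_covariance: "cov a b = (covariance M L *v a) \<bullet> b"
proof -
  have int: "integrable M (\<lambda>\<omega>. L 1 \<omega> $ i * L 1 \<omega> $ j)" for i j
    using integrable_mult_components[of 1 1 "axis i 1" "axis j 1"] by (simp add: inner_axis)
  have "cov a b = expectation (\<lambda>\<omega>. \<Sum>i\<in>UNIV. \<Sum>j\<in>UNIV. (a $ j * b $ i) * (L 1 \<omega> $ i * L 1 \<omega> $ j))"
    unfolding cov_def
  proof (intro Bochner_Integration.integral_cong refl)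
    fix \<omega>
    have "(L 1 \<omega> \<bullet> a) * (L 1 \<omega> \<bullet> b) = (\<Sum>i\<in>UNIV. L 1 \<omega> $ i * b $ i) * (\<Sum>j\<in>UNIV. L 1 \<omega> $ j * a $ j)"
      by (simp add: inner_vec_def)
    also have "\<dots> = (\<Sum>i\<in>UNIV. \<Sum>j\<in>UNIV. (a $ j * b $ i) * (L 1 \<omega> $ i * L 1 \<omega> $ j))"
      unfolding sum_product by (intro sum.cong refl) simp
    finally show "(L 1 \<omega> \<bullet> a) * (L 1 \<omega> \<bullet> b) = (\<Sum>i\<in>UNIV. \<Sum>j\<in>UNIV. (a $ j * b $ i) * (L 1 \<omega> $ i * L 1 \<omega> $ j))" .
  qed
  also have "\<dots> = (\<Sum>i\<in>UNIV. \<Sum>j\<in>UNIV. (a $ j * b $ i) * expectation (\<lambda>\<omega>. L 1 \<omega> $ i * L 1 \<omega> $ j))"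
    using int by simp
  also have "\<dots> = (covariance M L *v a) \<bullet> b"
    by (simp add: inner_vec_def matrix_vector_mult_def covariance_def sum_distrib_right sum_distrib_left ac_simps)
  finally show ?thesis .
qed

lemma R_works: "transpose R = R" "R ** R = covariance M L"
proof -
  have sym: "transpose (covariance M L) = covariance M L"
    by (simp add: covariance_def transpose_def vec_eq_iff mult.commute)
  have psd: "0 \<le> (covariance M L *v x) \<bullet> x" for x
    unfolding cov_covariance[symmetric] by (simp add: cov_def)
  show "transpose R = R" "R ** R = covariance M L"
    unfolding R_def by (rule psd_sqrt_works[OF sym psd])+
qed

lemma R_sym: "(R *v a) \<bullet> b = a \<bullet> (R *v b)"
  using dot_lmul_matrix[of a R b] transpose_matrix_vector[of R a] R_works(1) by simp

lemma cov_R: "cov a b = (R *v a) \<bullet> (R *v b)"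
proof -
  have "cov a b = (R *v (R *v a)) \<bullet> b"
    by (simp add: cov_covariance R_works(2) matrix_vector_mul_assoc)
  also have "\<dots> = (R *v a) \<bullet> (R *v b)" by (rule R_sym)
  finally show ?thesis .
qed

end

section \<open>Square integrals and the Ito isometry\<close>

abbreviation mean_square :: "'a measure \<Rightarrow> ('a \<Rightarrow> 'b::real_normed_vector) \<Rightarrow> ennreal" where
  "mean_square N f \<equiv> \<integral>\<^sup>+x. ennreal ((norm (f x))\<^sup>2) \<partial>N"

text \<open>
  Minkowski's inequality for explicit bounds. Pointwise,
  \<open>(u + v)\<^sup>2 \<le> (1 + b / a) u\<^sup>2 + (1 + a / b) v\<^sup>2\<close>, and for norms \<open>a\<close> and \<open>b\<close> the right-hand side
  integrates to \<open>(a + b)\<^sup>2\<close>; zero bounds are reached as limits of positive ones.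
\<close>
lemma nn_integral_minkowski:
  fixes f g h :: "'a \<Rightarrow> real"
  assumes [measurable]: "f \<in> borel_measurable N" "g \<in> borel_measurable N"
    and f: "(\<integral>\<^sup>+x. ennreal ((f x)\<^sup>2) \<partial>N) \<le> ennreal (\<alpha>\<^sup>2)"
    and g: "(\<integral>\<^sup>+x. ennreal ((g x)\<^sup>2) \<partial>N) \<le> ennreal (\<beta>\<^sup>2)"
    and pos: "0 \<le> \<alpha>" "0 \<le> \<beta>"
    and h: "AE x in N. \<bar>h x\<bar> \<le> \<bar>f x\<bar> + \<bar>g x\<bar>"
  shows "(\<integral>\<^sup>+x. ennreal ((h x)\<^sup>2) \<partial>N) \<le> ennreal ((\<alpha> + \<beta>)\<^sup>2)"
proof -
  have main: "(\<integral>\<^sup>+x. ennreal ((h x)\<^sup>2) \<partial>N) \<le> ennreal ((a + b)\<^sup>2)"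
    if ab: "0 < a" "0 < b" "\<alpha> \<le> a" "\<beta> \<le> b" for a b
  proof -
    have ptw: "y\<^sup>2 \<le> (1 + b / a) * u\<^sup>2 + (1 + a / b) * v\<^sup>2" if "\<bar>y\<bar> \<le> \<bar>u\<bar> + \<bar>v\<bar>" for y u v :: real
    proof -
      have "y\<^sup>2 \<le> (\<bar>u\<bar> + \<bar>v\<bar>)\<^sup>2" using that by (metis abs_ge_zero power2_abs power_mono)
      also have "\<dots> = u\<^sup>2 + v\<^sup>2 + 2 * (\<bar>u\<bar> * \<bar>v\<bar>)" by (simp add: power2_sum)
      also have "2 * (\<bar>u\<bar> * \<bar>v\<bar>) \<le> (b / a) * u\<^sup>2 + (a / b) * v\<^sup>2"
      proof -
        have "(b * p - a * q)\<^sup>2 / (a * b) = (b / a) * p\<^sup>2 + (a / b) * q\<^sup>2 - 2 * (p * q)" for p q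
          using ab by (simp add: field_simps power2_eq_square)
        from this[of "\<bar>u\<bar>" "\<bar>v\<bar>"] show ?thesis
          using ab zero_le_divide_iff[of "(b * \<bar>u\<bar> - a * \<bar>v\<bar>)\<^sup>2" "a * b"] by simp
      qed
      finally show ?thesis by (simp add: algebra_simps)
    qed
    have "(\<integral>\<^sup>+x. ennreal ((h x)\<^sup>2) \<partial>N) \<le>
        (\<integral>\<^sup>+x. ennreal (1 + b / a) * ennreal ((f x)\<^sup>2) + ennreal (1 + a / b) * ennreal ((g x)\<^sup>2) \<partial>N)"
    proof (rule nn_integral_mono_AE, use h in eventually_elim)
      case (elim x)
      show ?case
        using ptw[OF elim] ab by (simp flip: ennreal_mult ennreal_plus)
    qed
    also have "\<dots> = ennreal (1 + b / a) * (\<integral>\<^sup>+x. ennreal ((f x)\<^sup>2) \<partial>N) + ennreal (1 + a / b) * (\<integral>\<^sup>+x. ennreal ((g x)\<^sup>2) \<partial>N)"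
      by (simp add: nn_integral_add nn_integral_cmult)
    also have "\<dots> \<le> ennreal (1 + b / a) * ennreal (a\<^sup>2) + ennreal (1 + a / b) * ennreal (b\<^sup>2)"
    proof (intro add_mono mult_left_mono)
      show "(\<integral>\<^sup>+x. ennreal ((f x)\<^sup>2) \<partial>N) \<le> ennreal (a\<^sup>2)"
        using ab pos by (intro order_trans[OF f] ennreal_leI power_mono) auto
      show "(\<integral>\<^sup>+x. ennreal ((g x)\<^sup>2) \<partial>N) \<le> ennreal (b\<^sup>2)"
        using ab pos by (intro order_trans[OF g] ennreal_leI power_mono) auto
    qed auto
    also have "\<dots> = ennreal ((1 + b / a) * a\<^sup>2 + (1 + a / b) * b\<^sup>2)"
      using ab by (simp flip: ennreal_mult ennreal_plus)
    also have "(1 + b / a) * a\<^sup>2 + (1 + a / b) * b\<^sup>2 = (a + b)\<^sup>2"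
      using ab by (simp add: field_simps power2_eq_square)
    finally show ?thesis .
  qed
  have "((\<lambda>d. ennreal (((\<alpha> + d) + (\<beta> + d))\<^sup>2)) \<longlongrightarrow> ennreal (((\<alpha> + 0) + (\<beta> + 0))\<^sup>2)) (at_right 0)"
    by (intro tendsto_intros)
  moreover have "\<forall>\<^sub>F d in at_right 0. (\<integral>\<^sup>+x. ennreal ((h x)\<^sup>2) \<partial>N) \<le> ennreal (((\<alpha> + d) + (\<beta> + d))\<^sup>2)"
    using eventually_at_right_less[of 0] by eventually_elim (use pos in \<open>intro main; simp\<close>)
  ultimately have "(\<integral>\<^sup>+x. ennreal ((h x)\<^sup>2) \<partial>N) \<le> ennreal (((\<alpha> + 0) + (\<beta> + 0))\<^sup>2)"
    by (rule tendsto_lowerbound) simp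
  then show ?thesis by simp
qed

text \<open>The Hilbert-Schmidt norm of a linear map from a Euclidean space.\<close>
definition hs_norm :: "('v::euclidean_space \<Rightarrow> 'x::real_normed_vector) \<Rightarrow> real" where
  "hs_norm F = sqrt (\<Sum>b\<in>Basis. (norm (F b))\<^sup>2)"

lemma hs_norm_nonneg [simp]: "0 \<le> hs_norm F"
  by (simp add: hs_norm_def sum_nonneg)

lemma hs_norm_sq: "(hs_norm F)\<^sup>2 = (\<Sum>b\<in>Basis. (norm (F b))\<^sup>2)"
  by (simp add: hs_norm_def sum_nonneg)

lemma hs_norm_triangle: "hs_norm (\<lambda>b. F b + G b) \<le> hs_norm F + hs_norm G"
proof -
  have "hs_norm (\<lambda>b. F b + G b) \<le> L2_set (\<lambda>b. norm (F b) + norm (G b)) Basis"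
    unfolding hs_norm_def L2_set_def
    by (intro real_sqrt_le_mono sum_mono power_mono norm_triangle_ineq) auto
  also have "\<dots> \<le> hs_norm F + hs_norm G"
    using L2_set_triangle_ineq[of "\<lambda>b. norm (F b)" "\<lambda>b. norm (G b)" Basis]
    by (simp add: hs_norm_def L2_set_def)
  finally show ?thesis .
qed

lemma norm_le_hs_norm:
  assumes "linear F"
  shows "norm (F x) \<le> hs_norm F * norm x"
proof -
  have "norm (F x) = norm (\<Sum>b\<in>Basis. (x \<bullet> b) *\<^sub>R F b)"
    by (subst euclidean_representation[of x, symmetric]) (simp add: linear_sum[OF assms] linear_scale[OF assms])
  also have "\<dots> \<le> (\<Sum>b\<in>Basis. \<bar>x \<bullet> b\<bar> * \<bar>norm (F b)\<bar>)"
    by (rule order_trans[OF norm_sum]) simp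
  also have "\<dots> \<le> L2_set (\<lambda>b. x \<bullet> b) Basis * L2_set (\<lambda>b. norm (F b)) Basis"
    by (rule L2_set_mult_ineq)
  also have "\<dots> = hs_norm F * norm x"
    unfolding L2_set_def hs_norm_def by (simp add: norm_eq_sqrt_inner[of x] euclidean_inner[of x x] power2_eq_square)
  finally show ?thesis .
qed

lemma hs_norm_comp:
  assumes "linear F"
  shows "hs_norm (\<lambda>b. F (A b)) \<le> hs_norm A * hs_norm F"
proof -
  have "(\<Sum>b\<in>Basis. (norm (F (A b)))\<^sup>2) \<le> (\<Sum>b\<in>Basis. (hs_norm F * norm (A b))\<^sup>2)"
    by (intro sum_mono power_mono norm_le_hs_norm assms) auto
  also have "\<dots> = (hs_norm A * hs_norm F)\<^sup>2"
    by (simp add: power_mult_distrib hs_norm_sq sum_distrib_left mult.commute)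
  finally show ?thesis
    unfolding hs_norm_def[of "\<lambda>b. F (A b)"] by (intro real_le_lsqrt) (auto simp: sum_nonneg)
qed

lemma step_value_Cons:
  "step_value ((a, b, \<Phi>) # ps) s x = indicator {a<..b} s *\<^sub>R \<Phi> x + step_value ps s x"
  by (simp add: step_value_def)

lemma step_integral_Cons:
  "step_integral L ((a, b, \<Phi>) # ps) \<omega> = \<Phi> (L b \<omega> - L a \<omega>) + step_integral L ps \<omega>"
  by (simp add: step_integral_def)

lemma linear_step_value:
  assumes "steps_on t ps"
  shows "linear (step_value ps s)"
  using assms
proof (induct ps)
  case Nil
  show ?case by (simp add: step_value_def linear_iff)
next
  case (Cons p ps)
  obtain a b \<Phi> where p: "p = (a, b, \<Phi>)" by (cases p) auto
  have "linear \<Phi>" "linear (step_value ps s)"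
    using Cons by (auto simp: steps_on_def p bounded_linear.linear)
  then show ?case
    unfolding linear_iff by (simp add: step_value_def p algebra_simps)
qed

lemma step_value_outside:
  assumes "steps_on t ps" "s \<notin> {0..t}"
  shows "step_value ps s x = 0"
  using assms by (induct ps) (auto simp: steps_on_def step_value_def split: split_indicator)

lemma step_value_measurable:
  fixes ps :: "(real \<times> real \<times> ('v::real_normed_vector \<Rightarrow> 'x::{real_normed_vector, second_countable_topology})) list"
  shows "(\<lambda>s. step_value ps s x) \<in> borel_measurable lborel"
  by (induct ps) (auto simp: step_value_def)

context square_integrable_levy
begin

lemma step_integral_measurable:
  fixes ps :: "(real \<times> real \<times> (real ^ 'd \<Rightarrow> 'x::{real_normed_vector, second_countable_topology})) list"
  assumes "steps_on t ps"
  shows "step_integral L ps \<in> borel_measurable M"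
  using assms
proof (induct ps)
  case Nil
  show ?case by (simp add: step_integral_def[abs_def])
next
  case (Cons p ps)
  obtain a b \<Phi> where p: "p = (a, b, \<Phi>)" by (cases p) auto
  have *: "bounded_linear \<Phi>" "0 \<le> a" "0 \<le> b" "steps_on t ps" using Cons(2) by (auto simp: steps_on_def p)
  have "(\<lambda>\<omega>. \<Phi> (L b \<omega> - L a \<omega>)) \<in> borel_measurable M"
    using * by (intro measurable_compose[OF _ borel_measurable_continuous_onI[OF linear_continuous_on[of \<Phi> UNIV]]]) auto
  then have "(\<lambda>\<omega>. \<Phi> (L b \<omega> - L a \<omega>) + step_integral L ps \<omega>) \<in> borel_measurable M"
    using Cons(1)[OF *(4)] by (rule borel_measurable_add)
  then show ?case by (simp add: step_integral_def[abs_def] p)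
qed

text \<open>
  The Ito isometry for two single steps: both integrals are the length of the intersection of the
  two intervals times the Hilbert-Schmidt inner product of \<open>\<Phi> R\<close> and \<open>\<Psi> R\<close>.
\<close>
lemma step_pair:
  fixes \<Phi> \<Psi> :: "real ^ 'd \<Rightarrow> 'h::real_inner"
  assumes ab: "0 \<le> a" "a \<le> b" "0 \<le> c" "c \<le> d" and lin: "linear \<Phi>" "linear \<Psi>"
  shows "\<exists>r. has_bochner_integral M (\<lambda>\<omega>. \<Phi> (L b \<omega> - L a \<omega>) \<bullet> \<Psi> (L d \<omega> - L c \<omega>)) r \<and>
    has_bochner_integral lborel
      (\<lambda>s. \<Sum>k\<in>Basis. (indicator {a<..b} s *\<^sub>R \<Phi> (R *v k)) \<bullet> (indicator {c<..d} s *\<^sub>R \<Psi> (R *v k))) r"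
proof -
  define l where "l = max 0 (min b d - max a c)"
  have expand: "F x = (\<Sum>i\<in>Basis. (x \<bullet> i) *\<^sub>R F i)" if "linear F" for F :: "real ^ 'd \<Rightarrow> 'h" and x
    by (subst euclidean_representation[of x, symmetric]) (simp add: linear_sum[OF that] linear_scale[OF that])
  have "has_bochner_integral M
      (\<lambda>\<omega>. \<Sum>i\<in>Basis. \<Sum>j\<in>Basis. (((L b \<omega> - L a \<omega>) \<bullet> i) * ((L d \<omega> - L c \<omega>) \<bullet> j)) * (\<Phi> i \<bullet> \<Psi> j))
      (\<Sum>i\<in>Basis. \<Sum>j\<in>Basis. (l * cov i j) * (\<Phi> i \<bullet> \<Psi> j))"
    unfolding l_def
    by (intro has_bochner_integral_sum has_bochner_integral_mult_left increment_covariance ab)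
  moreover have "\<Phi> (L b \<omega> - L a \<omega>) \<bullet> \<Psi> (L d \<omega> - L c \<omega>) =
      (\<Sum>i\<in>Basis. \<Sum>j\<in>Basis. (((L b \<omega> - L a \<omega>) \<bullet> i) * ((L d \<omega> - L c \<omega>) \<bullet> j)) * (\<Phi> i \<bullet> \<Psi> j))" for \<omega>
    unfolding expand[OF lin(1), of "L b \<omega> - L a \<omega>"] expand[OF lin(2), of "L d \<omega> - L c \<omega>"]
    by (simp only: inner_sum_left inner_scaleR_left)
      (simp add: inner_sum_right sum_distrib_left mult.assoc)
  moreover have "(\<Sum>i\<in>Basis. \<Sum>j\<in>Basis. (l * cov i j) * (\<Phi> i \<bullet> \<Psi> j)) = l * (\<Sum>k\<in>Basis. \<Phi> (R *v k) \<bullet> \<Psi> (R *v k))"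
  proof -
    have "(\<Sum>k\<in>Basis. \<Phi> (R *v k) \<bullet> \<Psi> (R *v k)) =
      (\<Sum>k\<in>Basis. \<Sum>i\<in>Basis. \<Sum>j\<in>Basis. (((R *v i) \<bullet> k) * ((R *v j) \<bullet> k)) * (\<Phi> i \<bullet> \<Psi> j))"
    proof (intro sum.cong refl)
      fix k
      have "(\<Sum>i\<in>Basis. ((R *v k) \<bullet> i) *\<^sub>R \<Phi> i) \<bullet> (\<Sum>j\<in>Basis. ((R *v k) \<bullet> j) *\<^sub>R \<Psi> j) =
        (\<Sum>i\<in>Basis. \<Sum>j\<in>Basis. (((R *v k) \<bullet> i) * ((R *v k) \<bullet> j)) * (\<Phi> i \<bullet> \<Psi> j))"
        by (simp only: inner_sum_left inner_scaleR_left)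
          (simp add: inner_sum_right sum_distrib_left mult.assoc)
      then show "\<Phi> (R *v k) \<bullet> \<Psi> (R *v k) =
        (\<Sum>i\<in>Basis. \<Sum>j\<in>Basis. (((R *v i) \<bullet> k) * ((R *v j) \<bullet> k)) * (\<Phi> i \<bullet> \<Psi> j))"
        using expand[OF lin(1), of "R *v k"] expand[OF lin(2), of "R *v k"]
        by (simp add: R_sym inner_commute[of k])
    qed
    also have "\<dots> = (\<Sum>i\<in>Basis. \<Sum>j\<in>Basis. \<Sum>k\<in>Basis. (((R *v i) \<bullet> k) * ((R *v j) \<bullet> k)) * (\<Phi> i \<bullet> \<Psi> j))"
      by (subst sum.swap) (intro sum.cong refl sum.swap)
    also have "\<dots> = (\<Sum>i\<in>Basis. \<Sum>j\<in>Basis. cov i j * (\<Phi> i \<bullet> \<Psi> j))"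
    proof (intro sum.cong refl)
      fix i j
      show "(\<Sum>k\<in>Basis. (((R *v i) \<bullet> k) * ((R *v j) \<bullet> k)) * (\<Phi> i \<bullet> \<Psi> j)) = cov i j * (\<Phi> i \<bullet> \<Psi> j)"
        unfolding cov_R by (simp add: euclidean_inner[of "R *v i" "R *v j"] sum_distrib_right)
    qed
    finally show ?thesis by (simp add: sum_distrib_left mult.assoc)
  qed
  moreover have "has_bochner_integral lborel
      (\<lambda>s. \<Sum>k\<in>Basis. (indicator {a<..b} s *\<^sub>R \<Phi> (R *v k)) \<bullet> (indicator {c<..d} s *\<^sub>R \<Psi> (R *v k)))
      (l * (\<Sum>k\<in>Basis. \<Phi> (R *v k) \<bullet> \<Psi> (R *v k)))"
  proof -
    have "has_bochner_integral lborel (indicator {max a c<..min b d} :: real \<Rightarrow> real) (measure lborel {max a c<..min b d})"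
    proof (rule has_bochner_integral_real_indicator)
      show "emeasure lborel {max a c<..min b d} < \<infinity>"
        by (rule emeasure_bounded_finite) (rule bounded_subset[OF compact_imp_bounded[OF compact_Icc[of "max a c" "min b d"]]], auto)
    qed simp
    moreover have "measure lborel {max a c<..min b d} = l"
    proof (cases "max a c \<le> min b d")
      case True
      then show ?thesis using measure_lborel_Ioc[OF True] unfolding l_def by linarith
    next
      case False
      then have "{max a c<..min b d} = {}" by auto
      with False show ?thesis unfolding l_def by (simp only: measure_empty)
    qed
    ultimately have "has_bochner_integral lborel (\<lambda>s. indicator {max a c<..min b d} s * (\<Sum>k\<in>Basis. \<Phi> (R *v k) \<bullet> \<Psi> (R *v k)))
      (l * (\<Sum>k\<in>Basis. \<Phi> (R *v k) \<bullet> \<Psi> (R *v k)))"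
      by (intro has_bochner_integral_mult_left) simp
    moreover have "indicator {max a c<..min b d} s * (\<Sum>k\<in>Basis. \<Phi> (R *v k) \<bullet> \<Psi> (R *v k)) =
       (\<Sum>k\<in>Basis. (indicator {a<..b} s *\<^sub>R \<Phi> (R *v k)) \<bullet> (indicator {c<..d} s *\<^sub>R \<Psi> (R *v k)))" for s
    proof -
      have "indicator {max a c<..min b d} s = (indicator {a<..b} s * indicator {c<..d} s :: real)"
        by (auto split: split_indicator)
      then show ?thesis by (simp only: inner_scaleR_left inner_scaleR_right sum_distrib_left mult.assoc mult.left_commute)
    qed
    ultimately show ?thesis by (simp only:)
  qed
  ultimately show ?thesis by auto
qed

text \<open>
  The bilinear form of the isometry permits an induction over both lists, so that overlapping steps
  need no special treatment.
\<close>
lemma step_integral_isometry: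
  fixes ps qs :: "(real \<times> real \<times> (real ^ 'd \<Rightarrow> 'h::real_inner)) list"
  assumes "steps_on t ps" "steps_on t qs"
  shows "\<exists>r. has_bochner_integral M (\<lambda>\<omega>. step_integral L ps \<omega> \<bullet> step_integral L qs \<omega>) r \<and>
    has_bochner_integral lborel (\<lambda>s. \<Sum>k\<in>Basis. step_value ps s (R *v k) \<bullet> step_value qs s (R *v k)) r"
  using assms(1)
proof (induct ps)
  case Nil
  show ?case by (intro exI[of _ 0]) (simp add: step_integral_def step_value_def has_bochner_integral_zero)
next
  case (Cons p ps)
  obtain a b \<Phi> where p: "p = (a, b, \<Phi>)" by (cases p) auto
  have \<Phi>: "0 \<le> a" "a \<le> b" "linear \<Phi>" and ps: "steps_on t ps"
    using Cons(2) by (auto simp: steps_on_def p bounded_linear.linear)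
  have "\<exists>r. has_bochner_integral M (\<lambda>\<omega>. \<Phi> (L b \<omega> - L a \<omega>) \<bullet> step_integral L qs \<omega>) r \<and>
    has_bochner_integral lborel (\<lambda>s. \<Sum>k\<in>Basis. (indicator {a<..b} s *\<^sub>R \<Phi> (R *v k)) \<bullet> step_value qs s (R *v k)) r"
    using assms(2)
  proof (induct qs)
    case Nil
    show ?case by (intro exI[of _ 0]) (simp add: step_integral_def step_value_def has_bochner_integral_zero)
  next
    case (Cons q qs)
    obtain c d \<Psi> where q: "q = (c, d, \<Psi>)" by (cases q) auto
    have \<Psi>: "0 \<le> c" "c \<le> d" "linear \<Psi>" and qs: "steps_on t qs"
      using Cons(2) by (auto simp: steps_on_def q bounded_linear.linear)
    obtain r where r: "has_bochner_integral M (\<lambda>\<omega>. \<Phi> (L b \<omega> - L a \<omega>) \<bullet> step_integral L qs \<omega>) r"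
      "has_bochner_integral lborel (\<lambda>s. \<Sum>k\<in>Basis. (indicator {a<..b} s *\<^sub>R \<Phi> (R *v k)) \<bullet> step_value qs s (R *v k)) r"
      using Cons(1)[OF qs] by blast
    obtain r' where r': "has_bochner_integral M (\<lambda>\<omega>. \<Phi> (L b \<omega> - L a \<omega>) \<bullet> \<Psi> (L d \<omega> - L c \<omega>)) r'"
      "has_bochner_integral lborel
        (\<lambda>s. \<Sum>k\<in>Basis. (indicator {a<..b} s *\<^sub>R \<Phi> (R *v k)) \<bullet> (indicator {c<..d} s *\<^sub>R \<Psi> (R *v k))) r'"
      using step_pair[OF \<Phi>(1,2) \<Psi>(1,2) \<Phi>(3) \<Psi>(3)] by blast
    from has_bochner_integral_add[OF r'(1) r(1)] has_bochner_integral_add[OF r'(2) r(2)]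
    show ?case
      by (intro exI[of _ "r' + r"])
        (simp only: q step_integral_Cons step_value_Cons inner_add_right sum.distrib simp_thms)
  qed
  then obtain r' where r': "has_bochner_integral M (\<lambda>\<omega>. \<Phi> (L b \<omega> - L a \<omega>) \<bullet> step_integral L qs \<omega>) r'"
    "has_bochner_integral lborel (\<lambda>s. \<Sum>k\<in>Basis. (indicator {a<..b} s *\<^sub>R \<Phi> (R *v k)) \<bullet> step_value qs s (R *v k)) r'"
    by blast
  obtain r where r: "has_bochner_integral M (\<lambda>\<omega>. step_integral L ps \<omega> \<bullet> step_integral L qs \<omega>) r"
    "has_bochner_integral lborel (\<lambda>s. \<Sum>k\<in>Basis. step_value ps s (R *v k) \<bullet> step_value qs s (R *v k)) r"
    using Cons(1)[OF ps] by blast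
  from has_bochner_integral_add[OF r'(1) r(1)] has_bochner_integral_add[OF r'(2) r(2)]
  show ?case
    by (intro exI[of _ "r' + r"])
      (simp only: p step_integral_Cons step_value_Cons inner_add_left sum.distrib simp_thms)
qed

lemma nn_integral_step_integral:
  fixes ps :: "(real \<times> real \<times> (real ^ 'd \<Rightarrow> 'h::real_inner)) list"
  assumes "steps_on t ps"
  shows "mean_square M (\<lambda>\<omega>. step_integral L ps \<omega>) =
    (\<integral>\<^sup>+s. ennreal ((hs_norm (\<lambda>k. step_value ps s (R *v k)))\<^sup>2) \<partial>lborel)"
proof -
  obtain r where r: "has_bochner_integral M (\<lambda>\<omega>. step_integral L ps \<omega> \<bullet> step_integral L ps \<omega>) r"
    "has_bochner_integral lborel (\<lambda>s. \<Sum>k\<in>Basis. step_value ps s (R *v k) \<bullet> step_value ps s (R *v k)) r"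
    using step_integral_isometry[OF assms assms] by blast
  have "mean_square M (\<lambda>\<omega>. step_integral L ps \<omega>) = ennreal r"
    using r(1) by (simp add: has_bochner_integral_iff nn_integral_eq_integral power2_norm_eq_inner)
  moreover have "(\<integral>\<^sup>+s. ennreal ((hs_norm (\<lambda>k. step_value ps s (R *v k)))\<^sup>2) \<partial>lborel) = ennreal r"
    using r(2) by (simp add: has_bochner_integral_iff nn_integral_eq_integral power2_norm_eq_inner hs_norm_sq sum_nonneg)
  ultimately show ?thesis by simp
qed

text \<open>
  The approximating step functions converge in the Hilbert-Schmidt norm, hence also after composition
  with \<open>R\<close> (at the cost of the constant \<open>\<kappa>\<close>); the isometry for steps and Minkowski's inequality on both
  sides give the bound up to an error that tends to \<open>0\<close>.
\<close>
theorem stochastic_integral_bound: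
  fixes I :: "'w \<Rightarrow> 'h::{real_inner, second_countable_topology}"
  assumes I: "is_stochastic_integral M L t F I"
    and lin: "\<And>s. s \<in> {0..t} \<Longrightarrow> linear (F s)"
    and bound: "(\<integral>\<^sup>+s\<in>{0..t}. ennreal ((hs_norm (\<lambda>k. F s (R *v k)))\<^sup>2) \<partial>lborel) \<le> ennreal (\<alpha>\<^sup>2)"
    and \<alpha>: "0 \<le> \<alpha>"
  shows "mean_square M I \<le> ennreal (\<alpha>\<^sup>2)"
proof -
  let ?N = "restrict_space lborel {0..t}" and ?f = "\<lambda>s. hs_norm (\<lambda>k. F s (R *v k))"
  have [measurable]: "(\<lambda>s. F s x) \<in> borel_measurable ?N" for x
    using I by (simp add: is_stochastic_integral_def)
  have Im [measurable]: "I \<in> borel_measurable M"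
    using I by (simp add: is_stochastic_integral_def)
  have restr: "(\<integral>\<^sup>+s\<in>{0..t}. f s \<partial>lborel) = (\<integral>\<^sup>+s. f s \<partial>?N)" for f :: "real \<Rightarrow> ennreal"
    by (simp add: nn_integral_restrict_space)
  obtain ps where ps: "\<And>n. steps_on t (ps n)"
    and lim1: "(\<lambda>n. \<integral>\<^sup>+s\<in>{0..t}. ennreal (\<Sum>b\<in>Basis. (norm (F s b - step_value (ps n) s b))\<^sup>2) \<partial>lborel) \<longlonglongrightarrow> 0"
    and lim2: "(\<lambda>n. \<integral>\<^sup>+\<omega>. ennreal ((norm (I \<omega> - step_integral L (ps n) \<omega>))\<^sup>2) \<partial>M) \<longlonglongrightarrow> 0"
    using I by (auto simp: is_stochastic_integral_def)
  define \<kappa> where "\<kappa> = hs_norm (\<lambda>k. R *v k)"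
  have \<kappa>: "0 \<le> \<kappa>" by (simp add: \<kappa>_def)
  have main: "mean_square M I \<le> ennreal (((\<alpha> + \<kappa> * \<delta>) + \<delta>)\<^sup>2)" if \<delta>: "0 < \<delta>" for \<delta>
  proof -
    have "0 < ennreal (\<delta>\<^sup>2)" using \<delta> by simp
    from order_tendstoD(2)[OF lim1 this] order_tendstoD(2)[OF lim2 this]
    have "\<forall>\<^sub>F n in sequentially.
       (\<integral>\<^sup>+s\<in>{0..t}. ennreal (\<Sum>b\<in>Basis. (norm (F s b - step_value (ps n) s b))\<^sup>2) \<partial>lborel) < ennreal (\<delta>\<^sup>2) \<and>
       mean_square M (\<lambda>\<omega>. I \<omega> - step_integral L (ps n) \<omega>) < ennreal (\<delta>\<^sup>2)"
      by eventually_elim auto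
    then obtain n where
      n1: "(\<integral>\<^sup>+s. ennreal ((hs_norm (\<lambda>b. F s b - step_value (ps n) s b))\<^sup>2) \<partial>?N) < ennreal (\<delta>\<^sup>2)" and
      n2: "mean_square M (\<lambda>\<omega>. I \<omega> - step_integral L (ps n) \<omega>) < ennreal (\<delta>\<^sup>2)"
      by (auto simp: eventually_sequentially restr hs_norm_sq)
    let ?g = "\<lambda>s. hs_norm (\<lambda>k. step_value (ps n) s (R *v k))"
      and ?e = "\<lambda>s. hs_norm (\<lambda>b. F s b - step_value (ps n) s b)"
    have [measurable]: "(\<lambda>s. step_value (ps n) s x) \<in> borel_measurable ?N" for x
      using step_value_measurable[of "ps n" x] by (intro measurable_restrict_space1) auto
    have [measurable]: "step_integral L (ps n) \<in> borel_measurable M"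
      by (rule step_integral_measurable[OF ps])
    have hs1: "(\<lambda>s. ?f s) \<in> borel_measurable ?N"
      unfolding hs_norm_def by measurable
    have hs2: "(\<lambda>s. ?e s) \<in> borel_measurable ?N"
      unfolding hs_norm_def by measurable
    have "(\<integral>\<^sup>+s. ennreal ((?g s)\<^sup>2) \<partial>?N) \<le> ennreal ((\<alpha> + \<kappa> * \<delta>)\<^sup>2)"
    proof (rule nn_integral_minkowski)
      show "(\<lambda>s. ?f s) \<in> borel_measurable ?N" by (rule hs1)
      show "(\<lambda>s. \<kappa> * ?e s) \<in> borel_measurable ?N"
        using hs2 by measurable
      show "(\<integral>\<^sup>+s. ennreal ((?f s)\<^sup>2) \<partial>?N) \<le> ennreal (\<alpha>\<^sup>2)"
        using bound by (simp add: restr)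
      have "(\<integral>\<^sup>+s. ennreal ((\<kappa> * ?e s)\<^sup>2) \<partial>?N) =
         ennreal (\<kappa>\<^sup>2) * (\<integral>\<^sup>+s. ennreal ((?e s)\<^sup>2) \<partial>?N)"
        using hs2 by (simp add: power_mult_distrib ennreal_mult nn_integral_cmult)
      also have "\<dots> \<le> ennreal (\<kappa>\<^sup>2) * ennreal (\<delta>\<^sup>2)" using n1 by (intro mult_left_mono) auto
      also have "\<dots> = ennreal ((\<kappa> * \<delta>)\<^sup>2)" by (simp add: power_mult_distrib ennreal_mult)
      finally show "(\<integral>\<^sup>+s. ennreal ((\<kappa> * ?e s)\<^sup>2) \<partial>?N) \<le> ennreal ((\<kappa> * \<delta>)\<^sup>2)" .
      show "0 \<le> \<alpha>" "0 \<le> \<kappa> * \<delta>" using \<alpha> \<kappa> \<delta> by auto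
      show "AE s in ?N. \<bar>?g s\<bar>
          \<le> \<bar>?f s\<bar> + \<bar>\<kappa> * ?e s\<bar>"
      proof (rule AE_I2)
        fix s assume "s \<in> space ?N"
        then have s: "s \<in> {0..t}" by (simp add: space_restrict_space)
        let ?D = "\<lambda>b. F s b - step_value (ps n) s b"
        have D: "linear ?D" by (intro linear_compose_sub lin s linear_step_value[OF ps])
        have "?g s = hs_norm (\<lambda>k. F s (R *v k) + - ?D (R *v k))"
          by simp
        also have "\<dots> \<le> ?f s + hs_norm (\<lambda>k. - ?D (R *v k))"
          by (rule hs_norm_triangle)
        also have "hs_norm (\<lambda>k. - ?D (R *v k)) = hs_norm (\<lambda>k. ?D (R *v k))"
          by (simp only: hs_norm_def norm_minus_cancel)
        also have "\<dots> \<le> \<kappa> * hs_norm ?D"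
          unfolding \<kappa>_def by (rule hs_norm_comp[OF D])
        finally show "\<bar>?g s\<bar>
          \<le> \<bar>?f s\<bar> + \<bar>\<kappa> * hs_norm ?D\<bar>"
          using \<kappa> by (simp add: abs_mult)
      qed
    qed
    moreover have "(\<integral>\<^sup>+s. ennreal ((?g s)\<^sup>2) \<partial>?N) =
        (\<integral>\<^sup>+s. ennreal ((?g s)\<^sup>2) \<partial>lborel)"
      unfolding restr[symmetric]
      by (intro nn_integral_cong) (auto simp: hs_norm_sq step_value_outside[OF ps] split: split_indicator)
    ultimately have SI: "mean_square M (\<lambda>\<omega>. step_integral L (ps n) \<omega>) \<le> ennreal ((\<alpha> + \<kappa> * \<delta>)\<^sup>2)"
      by (simp add: nn_integral_step_integral[OF ps])
    show ?thesis
    proof (rule nn_integral_minkowski[OF _ _ SI])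
      show "mean_square M (\<lambda>\<omega>. I \<omega> - step_integral L (ps n) \<omega>) \<le> ennreal (\<delta>\<^sup>2)"
        using n2 by simp
      show "AE \<omega> in M. \<bar>norm (I \<omega>)\<bar> \<le> \<bar>norm (step_integral L (ps n) \<omega>)\<bar> + \<bar>norm (I \<omega> - step_integral L (ps n) \<omega>)\<bar>"
        by (intro AE_I2) (simp add: norm_triangle_sub)
    qed (use \<alpha> \<kappa> \<delta> in auto)
  qed
  have "((\<lambda>\<delta>. ennreal (((\<alpha> + \<kappa> * \<delta>) + \<delta>)\<^sup>2)) \<longlongrightarrow> ennreal (((\<alpha> + \<kappa> * 0) + 0)\<^sup>2)) (at_right 0)"
    by (intro tendsto_intros)
  moreover have "\<forall>\<^sub>F \<delta> in at_right 0. mean_square M I \<le> ennreal (((\<alpha> + \<kappa> * \<delta>) + \<delta>)\<^sup>2)"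
    using eventually_at_right_less[of 0] by eventually_elim (rule main)
  ultimately have "mean_square M I \<le> ennreal (((\<alpha> + \<kappa> * 0) + 0)\<^sup>2)"
    by (rule tendsto_lowerbound) simp
  then show ?thesis by simp
qed

text \<open>
  The steps of \<open>F\<close> composed with \<open>C\<close>, followed by the steps of \<open>F'\<close> composed with \<open>- C'\<close>,
  approximate the difference.
\<close>
lemma stochastic_integral_diff:
  fixes F :: "real \<Rightarrow> real ^ 'd \<Rightarrow> 'x::{real_normed_vector, second_countable_topology}"
    and F' :: "real \<Rightarrow> real ^ 'd \<Rightarrow> 'y::{real_normed_vector, second_countable_topology}"
    and C :: "'x \<Rightarrow> 'h::{real_normed_vector, second_countable_topology}"
  assumes I: "is_stochastic_integral M L t F I" and I': "is_stochastic_integral M L t F' I'"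
    and C: "bounded_linear C" and C': "bounded_linear C'"
  shows "is_stochastic_integral M L t (\<lambda>s x. C (F s x) - C' (F' s x)) (\<lambda>\<omega>. C (I \<omega>) - C' (I' \<omega>))"
proof -
  let ?N = "restrict_space lborel {0..t}"
  note [measurable] = borel_measurable_continuous_onI[OF linear_continuous_on[OF C]]
    borel_measurable_continuous_onI[OF linear_continuous_on[OF C']]
  have m [measurable]: "(\<lambda>s. F s x) \<in> borel_measurable ?N" "I \<in> borel_measurable M"
    "(\<lambda>s. F' s x) \<in> borel_measurable ?N" "I' \<in> borel_measurable M" for x
    using I I' by (simp_all add: is_stochastic_integral_def)
  have restr: "(\<integral>\<^sup>+s\<in>{0..t}. f s \<partial>lborel) = (\<integral>\<^sup>+s. f s \<partial>?N)" for f :: "real \<Rightarrow> ennreal"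
    by (simp add: nn_integral_restrict_space)
  obtain ps where ps: "\<And>n. steps_on t (ps n)"
    and lim1: "(\<lambda>n. \<integral>\<^sup>+s. ennreal (\<Sum>b\<in>Basis. (norm (F s b - step_value (ps n) s b))\<^sup>2) \<partial>?N) \<longlonglongrightarrow> 0"
    and lim2: "(\<lambda>n. \<integral>\<^sup>+\<omega>. ennreal ((norm (I \<omega> - step_integral L (ps n) \<omega>))\<^sup>2) \<partial>M) \<longlonglongrightarrow> 0"
    using I unfolding is_stochastic_integral_def restr by blast
  obtain ps' where ps': "\<And>n. steps_on t (ps' n)"
    and lim1': "(\<lambda>n. \<integral>\<^sup>+s. ennreal (\<Sum>b\<in>Basis. (norm (F' s b - step_value (ps' n) s b))\<^sup>2) \<partial>?N) \<longlonglongrightarrow> 0"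
    and lim2': "(\<lambda>n. \<integral>\<^sup>+\<omega>. ennreal ((norm (I' \<omega> - step_integral L (ps' n) \<omega>))\<^sup>2) \<partial>M) \<longlonglongrightarrow> 0"
    using I' unfolding is_stochastic_integral_def restr by blast
  define qs where "qs n = map (\<lambda>(a, b, \<Phi>). (a, b, \<lambda>x. C (\<Phi> x))) (ps n) @
      map (\<lambda>(a, b, \<Phi>). (a, b, \<lambda>x. - C' (\<Phi> x))) (ps' n)" for n
  have l: "linear C" "linear C'" using C C' by (auto intro: bounded_linear.linear)
  have qs: "steps_on t (qs n)" for n
    using ps[of n] ps'[of n] C C' unfolding qs_def steps_on_def
    by (auto intro: bounded_linear_compose[OF C] bounded_linear_minus[OF bounded_linear_compose[OF C']])
  have mapC: "step_value (map (\<lambda>(a, b, \<Phi>). (a, b, \<lambda>x. C (\<Phi> x))) rs) s x = C (step_value rs s x)"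
    "step_integral L (map (\<lambda>(a, b, \<Phi>). (a, b, \<lambda>x. C (\<Phi> x))) rs) \<omega> = C (step_integral L rs \<omega>)" for rs s x \<omega>
    by (induct rs) (auto simp: step_value_def step_integral_def linear_0 linear_add linear_scale l)
  have mapC': "step_value (map (\<lambda>(a, b, \<Phi>). (a, b, \<lambda>x. - C' (\<Phi> x))) rs) s x = - C' (step_value rs s x)"
    "step_integral L (map (\<lambda>(a, b, \<Phi>). (a, b, \<lambda>x. - C' (\<Phi> x))) rs) \<omega> = - C' (step_integral L rs \<omega>)" for rs s x \<omega>
    by (induct rs) (auto simp: step_value_def step_integral_def linear_0 linear_add linear_scale l)
  have append: "step_value (rs @ rs') s x = step_value rs s x + step_value rs' s x"
    "step_integral L (rs @ rs') \<omega> = step_integral L rs \<omega> + step_integral L rs' \<omega>"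
    for rs rs' :: "(real \<times> real \<times> (real ^ 'd \<Rightarrow> 'h)) list" and s x \<omega>
    by (auto simp: step_value_def step_integral_def)
  have val: "C (F s x) - C' (F' s x) - step_value (qs n) s x =
     C (F s x - step_value (ps n) s x) - C' (F' s x - step_value (ps' n) s x)" for s x n
    by (simp add: qs_def append mapC mapC' linear_diff l)
  have integral: "C (I \<omega>) - C' (I' \<omega>) - step_integral L (qs n) \<omega> =
     C (I \<omega> - step_integral L (ps n) \<omega>) - C' (I' \<omega> - step_integral L (ps' n) \<omega>)" for \<omega> n
    by (simp add: qs_def append mapC mapC' linear_diff l)
  define c where "c = 2 * ((onorm C)\<^sup>2 + (onorm C')\<^sup>2)"
  have c: "0 \<le> c" by (simp add: c_def)
  have ptw: "(norm (C x - C' y))\<^sup>2 \<le> c * ((norm x)\<^sup>2 + (norm y)\<^sup>2)" for x y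
  proof -
    have "norm (C x - C' y) \<le> onorm C * norm x + onorm C' * norm y"
      using norm_triangle_ineq4[of "C x" "C' y"] onorm[OF C, of x] onorm[OF C', of y] by linarith
    then have "(norm (C x - C' y))\<^sup>2 \<le> (onorm C * norm x + onorm C' * norm y)\<^sup>2" by (intro power_mono) auto
    also have "\<dots> \<le> 2 * ((onorm C * norm x)\<^sup>2 + (onorm C' * norm y)\<^sup>2)"
      using sum_squares_bound[of "onorm C * norm x" "onorm C' * norm y"] by (simp add: power2_sum)
    also have "\<dots> \<le> c * ((norm x)\<^sup>2 + (norm y)\<^sup>2)"
      by (simp add: c_def power_mult_distrib algebra_simps)
    finally show ?thesis .
  qed
  have squeeze: "f \<longlonglongrightarrow> 0" if "g \<longlonglongrightarrow> 0" "g' \<longlonglongrightarrow> 0" "\<And>n. f n \<le> ennreal c * (g n + g' n)" for f g g' :: "nat \<Rightarrow> ennreal"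
  proof (rule tendsto_sandwich[OF _ _ tendsto_const])
    have "(\<lambda>n. ennreal c * (g n + g' n)) \<longlonglongrightarrow> ennreal c * (0 + 0)"
      by (intro ennreal_tendsto_cmult tendsto_add that) simp
    then show "(\<lambda>n. ennreal c * (g n + g' n)) \<longlonglongrightarrow> 0" by simp
  qed (use that(3) in auto)
  have sm [measurable]: "(\<lambda>s. step_value (ps n) s x) \<in> borel_measurable ?N" "(\<lambda>s. step_value (ps' n) s x) \<in> borel_measurable ?N" for x n
    using step_value_measurable[of "ps n" x] step_value_measurable[of "ps' n" x] by (auto intro: measurable_restrict_space1)
  have im [measurable]: "step_integral L (ps n) \<in> borel_measurable M" "step_integral L (ps' n) \<in> borel_measurable M" for n
    using step_integral_measurable[OF ps] step_integral_measurable[OF ps'] by auto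
  show ?thesis
    unfolding is_stochastic_integral_def
  proof (intro conjI allI exI[of _ qs] qs)
    show "(\<lambda>s. C (F s x) - C' (F' s x)) \<in> borel_measurable ?N" for x by measurable
    show "(\<lambda>\<omega>. C (I \<omega>) - C' (I' \<omega>)) \<in> borel_measurable M" by measurable
    show "(\<lambda>n. \<integral>\<^sup>+s\<in>{0..t}. ennreal (\<Sum>b\<in>Basis. (norm (C (F s b) - C' (F' s b) - step_value (qs n) s b))\<^sup>2) \<partial>lborel) \<longlonglongrightarrow> 0"
      unfolding restr val
    proof (rule squeeze[OF lim1 lim1'])
      fix n
      let ?x = "\<lambda>s b. F s b - step_value (ps n) s b" and ?y = "\<lambda>s b. F' s b - step_value (ps' n) s b"
      have "(\<integral>\<^sup>+s. ennreal (\<Sum>b\<in>Basis. (norm (C (?x s b) - C' (?y s b)))\<^sup>2) \<partial>?N) \<le>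
         (\<integral>\<^sup>+s. ennreal c * (ennreal (\<Sum>b\<in>Basis. (norm (?x s b))\<^sup>2) + ennreal (\<Sum>b\<in>Basis. (norm (?y s b))\<^sup>2)) \<partial>?N)"
      proof (rule nn_integral_mono)
        fix s
        have "(\<Sum>b\<in>Basis. (norm (C (?x s b) - C' (?y s b)))\<^sup>2) \<le> (\<Sum>b\<in>Basis. c * ((norm (?x s b))\<^sup>2 + (norm (?y s b))\<^sup>2))"
          by (intro sum_mono ptw)
        also have "\<dots> = c * ((\<Sum>b\<in>Basis. (norm (?x s b))\<^sup>2) + (\<Sum>b\<in>Basis. (norm (?y s b))\<^sup>2))"
          by (simp add: sum.distrib flip: sum_distrib_left)
        finally show "ennreal (\<Sum>b\<in>Basis. (norm (C (?x s b) - C' (?y s b)))\<^sup>2) \<le>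
          ennreal c * (ennreal (\<Sum>b\<in>Basis. (norm (?x s b))\<^sup>2) + ennreal (\<Sum>b\<in>Basis. (norm (?y s b))\<^sup>2))"
          using c by (simp add: sum_nonneg ennreal_leI flip: ennreal_mult ennreal_plus)
      qed
      also have "\<dots> = ennreal c * ((\<integral>\<^sup>+s. ennreal (\<Sum>b\<in>Basis. (norm (?x s b))\<^sup>2) \<partial>?N) + (\<integral>\<^sup>+s. ennreal (\<Sum>b\<in>Basis. (norm (?y s b))\<^sup>2) \<partial>?N))"
        by (subst nn_integral_cmult, measurable) (subst nn_integral_add, measurable)
      finally show "(\<integral>\<^sup>+s. ennreal (\<Sum>b\<in>Basis. (norm (C (?x s b) - C' (?y s b)))\<^sup>2) \<partial>?N) \<le> \<dots>" .
    qed
    show "(\<lambda>n. \<integral>\<^sup>+\<omega>. ennreal ((norm (C (I \<omega>) - C' (I' \<omega>) - step_integral L (qs n) \<omega>))\<^sup>2) \<partial>M) \<longlonglongrightarrow> 0"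
      unfolding integral
    proof (rule squeeze[OF lim2 lim2'])
      fix n
      let ?x = "\<lambda>\<omega>. I \<omega> - step_integral L (ps n) \<omega>" and ?y = "\<lambda>\<omega>. I' \<omega> - step_integral L (ps' n) \<omega>"
      have "mean_square M (\<lambda>\<omega>. C (?x \<omega>) - C' (?y \<omega>)) \<le>
         (\<integral>\<^sup>+\<omega>. ennreal c * (ennreal ((norm (?x \<omega>))\<^sup>2) + ennreal ((norm (?y \<omega>))\<^sup>2)) \<partial>M)"
        using ptw c by (intro nn_integral_mono) (simp add: ennreal_leI flip: ennreal_mult ennreal_plus)
      also have "\<dots> = ennreal c * (mean_square M (\<lambda>\<omega>. ?x \<omega>) + mean_square M (\<lambda>\<omega>. ?y \<omega>))"
        by (subst nn_integral_cmult, measurable) (subst nn_integral_add, measurable)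
      finally show "mean_square M (\<lambda>\<omega>. C (?x \<omega>) - C' (?y \<omega>)) \<le> \<dots>" .
    qed
  qed
qed

end

section \<open>The trace of the error Gramian as an energy\<close>

lemma has_sum_finite_sum:
  fixes f :: "'i \<Rightarrow> 'e \<Rightarrow> real"
  assumes "finite B" "\<And>b. b \<in> B \<Longrightarrow> (f b has_sum (r b)) E"
  shows "((\<lambda>e. \<Sum>b\<in>B. f b e) has_sum (\<Sum>b\<in>B. r b)) E"
  using assms
proof (induct B)
  case (insert b B)
  then show ?case using has_sum_add[of "f b" E "r b"] by simp
qed simp

text \<open>
  Two systems with matching inputs and a common output space, seen through the difference \<open>\<Gamma>\<close> of
  their impulse responses. The choice \<open>C' = 0\<close> gives a single system.
\<close>
locale error_system = stable_pair S S' G G'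
  for S :: "real \<Rightarrow> 'x::{real_inner, banach, second_countable_topology} \<Rightarrow> 'x"
    and S' :: "real \<Rightarrow> 'y::{real_inner, banach, second_countable_topology} \<Rightarrow> 'y"
    and G :: "'a::euclidean_space \<Rightarrow> 'x" and G' :: "'a \<Rightarrow> 'y" +
  fixes C :: "'x \<Rightarrow> 'h::{real_inner, banach, second_countable_topology}" and C' :: "'y \<Rightarrow> 'h"
  assumes C: "bounded_linear C" and C': "bounded_linear C'"
begin

definition \<Gamma> :: "real \<Rightarrow> 'a \<Rightarrow> 'h" where
  "\<Gamma> s a = C (S s (G a)) - C' (S' s (G' a))"

text \<open>The squared \<open>H\<^sub>2\<close> norm of the error system.\<close>
definition energy :: real where
  "energy = (LBINT s:{0..}. (hs_norm (\<Gamma> s))\<^sup>2)"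

lemma bounded_linear_\<Gamma>: "0 \<le> s \<Longrightarrow> bounded_linear (\<Gamma> s)"
  unfolding \<Gamma>_def[abs_def]
  by (intro bounded_linear_sub bounded_linear_compose[OF C] bounded_linear_compose[OF C']
      bounded_linear_compose[OF S.bounded_linear_semigroup] bounded_linear_compose[OF S'.bounded_linear_semigroup] G G')

lemma linear_\<Gamma>: "0 \<le> s \<Longrightarrow> linear (\<Gamma> s)"
  by (rule bounded_linear.linear[OF bounded_linear_\<Gamma>])

lemma continuous_\<Gamma>: "continuous_on {0..} (\<lambda>s. \<Gamma> s a)"
  unfolding \<Gamma>_def
  by (intro continuous_intros bounded_linear.continuous_on[OF C] bounded_linear.continuous_on[OF C']
      S.continuous_orbit S'.continuous_orbit)

lemma \<Gamma>_expand: "0 \<le> s \<Longrightarrow> \<Gamma> s a = (\<Sum>b\<in>Basis. (a \<bullet> b) *\<^sub>R \<Gamma> s b)"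
  by (subst euclidean_representation[of a, symmetric])
    (simp add: linear_sum[OF linear_\<Gamma>] linear_scale[OF linear_\<Gamma>])

lemma norm_\<Gamma>_le: "0 \<le> s \<Longrightarrow> norm (\<Gamma> s a) \<le> hs_norm (\<Gamma> s) * norm a"
  by (rule norm_le_hs_norm[OF linear_\<Gamma>])

lemma continuous_hs_\<Gamma>: "continuous_on {0..} (\<lambda>s. hs_norm (\<Gamma> s))"
  unfolding hs_norm_def by (intro continuous_intros continuous_\<Gamma>)

lemma hs_\<Gamma>_decay: "\<exists>c\<ge>0. \<exists>\<omega>>0. \<forall>s\<ge>0. (hs_norm (\<Gamma> s))\<^sup>2 \<le> c * exp (- \<omega> * s)"
proof -
  obtain \<omega> \<nu> where 1: "\<omega> > 0" "\<nu> \<ge> 1" "\<And>t x. 0 \<le> t \<Longrightarrow> norm (S t x) \<le> \<nu> * exp (- \<omega> * t) * norm x"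
    using S.decay by metis
  obtain \<omega>' \<nu>' where 2: "\<omega>' > 0" "\<nu>' \<ge> 1" "\<And>t x. 0 \<le> t \<Longrightarrow> norm (S' t x) \<le> \<nu>' * exp (- \<omega>' * t) * norm x"
    using S'.decay by metis
  define \<mu> where "\<mu> = min \<omega> \<omega>'"
  have \<mu>: "\<mu> > 0" "\<mu> \<le> \<omega>" "\<mu> \<le> \<omega>'" using 1 2 by (auto simp: \<mu>_def)
  define k where "k b = onorm C * (\<nu> * norm (G b)) + onorm C' * (\<nu>' * norm (G' b))" for b
  have bound: "norm (\<Gamma> s b) \<le> k b * exp (- \<mu> * s)" if s: "0 \<le> s" for s b
  proof -
    have e: "exp (- \<omega> * s) \<le> exp (- \<mu> * s)" "exp (- \<omega>' * s) \<le> exp (- \<mu> * s)"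
      using \<mu> s by (auto intro: mult_right_mono)
    have "norm (C (S s (G b))) \<le> onorm C * (\<nu> * exp (- \<mu> * s) * norm (G b))"
    proof -
      have "norm (C (S s (G b))) \<le> onorm C * norm (S s (G b))" by (rule onorm[OF C])
      also have "norm (S s (G b)) \<le> \<nu> * exp (- \<omega> * s) * norm (G b)" by (rule 1(3)[OF s])
      also have "\<dots> \<le> \<nu> * exp (- \<mu> * s) * norm (G b)"
        using e 1 by (intro mult_right_mono mult_left_mono) auto
      finally show ?thesis by (simp add: onorm_pos_le[OF C] mult_left_mono)
    qed
    moreover have "norm (C' (S' s (G' b))) \<le> onorm C' * (\<nu>' * exp (- \<mu> * s) * norm (G' b))"
    proof -
      have "norm (C' (S' s (G' b))) \<le> onorm C' * norm (S' s (G' b))" by (rule onorm[OF C'])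
      also have "norm (S' s (G' b)) \<le> \<nu>' * exp (- \<omega>' * s) * norm (G' b)" by (rule 2(3)[OF s])
      also have "\<dots> \<le> \<nu>' * exp (- \<mu> * s) * norm (G' b)"
        using e 2 by (intro mult_right_mono mult_left_mono) auto
      finally show ?thesis by (simp add: onorm_pos_le[OF C'] mult_left_mono)
    qed
    ultimately have "norm (\<Gamma> s b) \<le> onorm C * (\<nu> * exp (- \<mu> * s) * norm (G b)) + onorm C' * (\<nu>' * exp (- \<mu> * s) * norm (G' b))"
      unfolding \<Gamma>_def by (intro order_trans[OF norm_triangle_ineq4] add_mono)
    then show ?thesis by (simp add: k_def algebra_simps)
  qed
  have "(hs_norm (\<Gamma> s))\<^sup>2 \<le> (\<Sum>b\<in>Basis. (k b)\<^sup>2) * exp (- (2 * \<mu>) * s)" if s: "0 \<le> s" for s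
  proof -
    have "(hs_norm (\<Gamma> s))\<^sup>2 \<le> (\<Sum>b\<in>Basis. (k b * exp (- \<mu> * s))\<^sup>2)"
      unfolding hs_norm_sq by (intro sum_mono power_mono bound s) auto
    also have "\<dots> = (\<Sum>b\<in>Basis. (k b)\<^sup>2) * exp (- (2 * \<mu>) * s)"
      by (simp add: power_mult_distrib sum_distrib_right ac_simps flip: exp_double)
    finally show ?thesis .
  qed
  then show ?thesis using \<mu>(1)
    by (intro exI[of _ "\<Sum>b\<in>Basis. (k b)\<^sup>2"] conjI exI[of _ "2 * \<mu>"]) (auto simp: sum_nonneg)
qed

lemma energy_integrable: "set_integrable lborel {0..} (\<lambda>s. (hs_norm (\<Gamma> s))\<^sup>2)"
proof -
  obtain c \<omega> where "\<omega> > 0" "\<And>s. 0 \<le> s \<Longrightarrow> (hs_norm (\<Gamma> s))\<^sup>2 \<le> c * exp (- \<omega> * s)"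
    using hs_\<Gamma>_decay by blast
  then show ?thesis
    by (intro set_integrable_atLeast_bound[where c = c and \<omega> = \<omega>]) (auto intro!: continuous_intros continuous_hs_\<Gamma>)
qed

lemma energy_nonneg: "0 \<le> energy"
  unfolding energy_def set_lebesgue_integral_def by (rule integral_nonneg_AE) auto

lemma nn_integral_energy: "(\<integral>\<^sup>+s\<in>{0..}. ennreal ((hs_norm (\<Gamma> s))\<^sup>2) \<partial>lborel) = ennreal energy"
proof -
  have "(\<integral>\<^sup>+s\<in>{0..}. ennreal ((hs_norm (\<Gamma> s))\<^sup>2) \<partial>lborel) =
      (\<integral>\<^sup>+s. ennreal (indicator {0..} s *\<^sub>R (hs_norm (\<Gamma> s))\<^sup>2) \<partial>lborel)"
    by (intro nn_integral_cong) (auto split: split_indicator)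
  also have "\<dots> = ennreal energy"
    using energy_integrable unfolding set_integrable_def energy_def set_lebesgue_integral_def
    by (intro nn_integral_eq_integral) auto
  finally show ?thesis .
qed

text \<open>
  Parseval's identity in the output space for each time and each input direction, integrated over
  time.
\<close>
lemma energy_has_sum:
  assumes E: "hilbert_basis E"
  shows "((\<lambda>e. LBINT s:{0..}. \<Sum>b\<in>Basis. (\<Gamma> s b \<bullet> e)\<^sup>2) has_sum energy) E"
  unfolding set_lebesgue_integral_def energy_def
proof (rule has_sum_integral_nonneg)
  let ?g = "\<lambda>e s. indicator {0..} s *\<^sub>R (\<Sum>b\<in>Basis. (\<Gamma> s b \<bullet> e)\<^sup>2)"
  show "countable E" by (rule orthonormal_set_countable[OF hilbert_basis_orthonormal[OF E]])
  show "(\<lambda>s. ?g e s) \<in> borel_measurable lborel" for e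
  proof -
    have "continuous_on {0..} (\<lambda>s. \<Sum>b\<in>Basis. (\<Gamma> s b \<bullet> e)\<^sup>2)"
      by (intro continuous_intros continuous_\<Gamma>)
    from borel_measurable_continuous_on_indicator[OF _ this] show ?thesis by simp
  qed
  show "0 \<le> ?g e s" for s e
    by (simp add: sum_nonneg)
  show "((\<lambda>e. ?g e s) has_sum indicator {0..} s *\<^sub>R (hs_norm (\<Gamma> s))\<^sup>2) E" for s
    unfolding real_scaleR_def hs_norm_sq
    by (intro has_sum_cmult_right has_sum_finite_sum parseval E) simp
  show "integrable lborel (\<lambda>s. indicator {0..} s *\<^sub>R (hs_norm (\<Gamma> s))\<^sup>2)"
    using energy_integrable by (simp add: set_integrable_def)
qed

text \<open>
  The diagonal entry at \<open>e\<close> is the integral of a sum of squares: the three Gramian kernels combine to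
  \<open>(\<Gamma> s b \<bullet> e)\<^sup>2\<close>.
\<close>
theorem has_trace_error:
  assumes P: "is_gramian S G S G P" and Pg: "is_gramian S G S' G' Pg" and P': "is_gramian S' G' S' G' P'"
  shows "has_trace (\<lambda>h. C (P (adjoint C h)) - 2 *\<^sub>R C (Pg (adjoint C' h)) + C' (P' (adjoint C' h))) energy"
  unfolding has_trace_def
proof (intro allI impI)
  fix E :: "'h set" assume E: "hilbert_basis E"
  interpret p: stable_pair S S G G 
    by (intro stable_pair.intro stable_pair_axioms.intro S.stable_semigroup_axioms G)
  interpret p': stable_pair S' S' G' G' 
    by (intro stable_pair.intro stable_pair_axioms.intro S'.stable_semigroup_axioms G')
  have "(C (P (adjoint C e)) - 2 *\<^sub>R C (Pg (adjoint C' e)) + C' (P' (adjoint C' e))) \<bullet> e =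
     (LBINT s:{0..}. \<Sum>b\<in>Basis. (\<Gamma> s b \<bullet> e)\<^sup>2)" for e
  proof -
    let ?x = "adjoint C e" and ?y = "adjoint C' e"
    have "(C (P ?x) - 2 *\<^sub>R C (Pg ?y) + C' (P' ?y)) \<bullet> e = P ?x \<bullet> ?x - 2 * (Pg ?y \<bullet> ?x) + P' ?y \<bullet> ?y"
      by (simp add: inner_add_left inner_diff_left inner_adjoint[OF C] inner_adjoint[OF C'])
    also have "\<dots> = (LBINT s:{0..}. gramian_kernel S G S G ?x ?x s) - 2 * (LBINT s:{0..}. gramian_kernel S G S' G' ?y ?x s)
       + (LBINT s:{0..}. gramian_kernel S' G' S' G' ?y ?y s)"
      using P Pg P' by (simp add: is_gramian_def)
    also have "\<dots> = (LBINT s:{0..}. gramian_kernel S G S G ?x ?x s - 2 * gramian_kernel S G S' G' ?y ?x s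
       + gramian_kernel S' G' S' G' ?y ?y s)"
      by (simp add: set_integral_add set_integral_diff p.gramian_kernel_integrable gramian_kernel_integrable
          p'.gramian_kernel_integrable)
    also have "\<dots> = (LBINT s:{0..}. \<Sum>b\<in>Basis. (\<Gamma> s b \<bullet> e)\<^sup>2)"
      by (intro set_lebesgue_integral_cong)
        (auto simp: gramian_kernel_def \<Gamma>_def inner_adjoint[OF C] inner_adjoint[OF C'] inner_diff_left
          power2_diff sum.distrib sum_subtractf sum_distrib_left power2_eq_square algebra_simps)
    finally show ?thesis .
  qed
  then show "((\<lambda>e. (C (P (adjoint C e)) - 2 *\<^sub>R C (Pg (adjoint C' e)) + C' (P' (adjoint C' e))) \<bullet> e) has_sum energy) E"
    using energy_has_sum[OF E] by simp
qed

section \<open>Mean-square estimates\<close>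

lemma nn_integral_reversed_energy:
  assumes "0 \<le> t"
  shows "(\<integral>\<^sup>+s\<in>{0..t}. ennreal ((hs_norm (\<Gamma> (t - s)))\<^sup>2) \<partial>lborel) \<le> ennreal energy"
proof -
  let ?f = "\<lambda>s. indicator {0..t} s *\<^sub>R (hs_norm (\<Gamma> s))\<^sup>2"
  have m: "?f \<in> borel_measurable lborel"
  proof -
    have "continuous_on {0..t} (\<lambda>s. (hs_norm (\<Gamma> s))\<^sup>2)"
      by (intro continuous_intros continuous_on_subset[OF continuous_hs_\<Gamma>]) auto
    from borel_measurable_continuous_on_indicator[OF _ this] show ?thesis by simp
  qed
  have "(\<integral>\<^sup>+s\<in>{0..t}. ennreal ((hs_norm (\<Gamma> (t - s)))\<^sup>2) \<partial>lborel) = (\<integral>\<^sup>+s. ennreal (?f (t + (-1) * s)) \<partial>lborel)"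
    by (intro nn_integral_cong) (auto split: split_indicator)
  also have "\<dots> = (\<integral>\<^sup>+s. ennreal (?f s) \<partial>lborel)"
    using nn_integral_real_affine[of "\<lambda>s. ennreal (?f s)" "-1" t] m by simp
  also have "\<dots> \<le> (\<integral>\<^sup>+s\<in>{0..}. ennreal ((hs_norm (\<Gamma> s))\<^sup>2) \<partial>lborel)"
    by (intro nn_integral_mono) (auto split: split_indicator)
  finally show ?thesis by (simp add: nn_integral_energy)
qed

lemma \<Gamma>_measurable [measurable]: "(\<lambda>s. \<Gamma> (max 0 s) b) \<in> borel_measurable borel"
proof (rule borel_measurable_continuous_onI)
  have "continuous_on UNIV ((\<lambda>s. \<Gamma> s b) \<circ> (\<lambda>s. max 0 s))"
    by (intro continuous_on_compose continuous_intros continuous_on_subset[OF continuous_\<Gamma>]) auto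
  then show "continuous_on UNIV (\<lambda>s. \<Gamma> (max 0 s) b)" by (simp add: o_def)
qed

lemma hs_\<Gamma>_measurable [measurable]: "(\<lambda>s. hs_norm (\<Gamma> (max 0 s))) \<in> borel_measurable borel"
  unfolding hs_norm_def by measurable

end

definition time_interval :: "real \<Rightarrow> real measure" where
  "time_interval T = restrict_space lborel {0<..<T}"

lemma Omega_T_eq: "Omega_T M T = M \<Otimes>\<^sub>M time_interval T"
  by (simp add: Omega_T_def time_interval_def)

lemma space_time_interval: "space (time_interval T) = {0<..<T}"
  by (simp add: time_interval_def space_restrict_space)

lemma nn_integral_time_interval: "(\<integral>\<^sup>+s. f s \<partial>time_interval T) = (\<integral>\<^sup>+s\<in>{0<..<T}. f s \<partial>lborel)"
  by (simp add: time_interval_def nn_integral_restrict_space)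

lemma emeasure_time_interval: "0 \<le> T \<Longrightarrow> emeasure (time_interval T) (space (time_interval T)) = ennreal T"
  by (simp add: time_interval_def space_restrict_space emeasure_restrict_space)

lemma sigma_finite_time_interval: "0 \<le> T \<Longrightarrow> sigma_finite_measure (time_interval T)"
  by (intro finite_measure.sigma_finite_measure finite_measureI) (simp add: emeasure_time_interval)

text \<open>
  This map extends functions on \<open>(0, T)\<close> to the whole line while preserving joint measurability with
  a further variable; \<open>T / 2\<close> stands for an arbitrary point of the interval.
\<close>
lemma clip_measurable:
  assumes "0 < T"
  shows "(\<lambda>s. if s \<in> {0<..<T} then s else T / 2) \<in> measurable lborel (time_interval T)"
  unfolding time_interval_def using assms by (intro measurable_restrict_space2) auto

lemma id_time_interval: "(\<lambda>s. s) \<in> borel_measurable (time_interval T)"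
  unfolding time_interval_def by (rule measurable_restrict_space1) simp

context error_system
begin

lemma convolution_integrable:
  fixes x :: "real \<Rightarrow> 'a"
  assumes x: "x \<in> borel_measurable (time_interval T)" and fin: "mean_square (time_interval T) x < \<infinity>"
    and t: "0 < t" "t < T"
  shows "set_integrable lborel {0<..<t} (\<lambda>s. \<Gamma> (t - s) (x s))"
  unfolding set_integrable_def
proof (rule integrableI_bounded)
  let ?f = "\<lambda>s. indicator {0<..<t} s *\<^sub>R \<Gamma> (t - s) (x s)"
  have T: "0 < T" using t by simp
  define y where "y s = x (if s \<in> {0<..<T} then s else T / 2)" for s
  have y [measurable]: "y \<in> borel_measurable lborel"
    unfolding y_def by (rule measurable_compose[OF clip_measurable[OF T] x])
  have eq: "?f s =
      indicator {0<..<t} s *\<^sub>R (\<Sum>b\<in>Basis. (y s \<bullet> b) *\<^sub>R \<Gamma> (max 0 (t - s)) b)" for s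
    using \<Gamma>_expand[of "t - s" "x s"] t by (auto simp: y_def split: split_indicator)
  show "(\<lambda>s. ?f s) \<in> borel_measurable lborel"
    unfolding eq by measurable
  obtain c \<omega> where c: "c \<ge> 0" "\<omega> > 0" "\<And>s. 0 \<le> s \<Longrightarrow> (hs_norm (\<Gamma> s))\<^sup>2 \<le> c * exp (- \<omega> * s)"
    using hs_\<Gamma>_decay by blast
  have ptw: "norm (\<Gamma> s a) \<le> c + (norm a)\<^sup>2" if s: "0 \<le> s" for s a
  proof -
    have "c * exp (- \<omega> * s) \<le> c * 1" using c s by (intro mult_left_mono) auto
    then have "(hs_norm (\<Gamma> s))\<^sup>2 \<le> c" using c(3)[OF s] by simp
    moreover have "hs_norm (\<Gamma> s) * norm a \<le> (hs_norm (\<Gamma> s))\<^sup>2 + (norm a)\<^sup>2"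
    proof -
      have "0 \<le> hs_norm (\<Gamma> s) * norm a" by simp
      moreover have "2 * (hs_norm (\<Gamma> s) * norm a) \<le> (hs_norm (\<Gamma> s))\<^sup>2 + (norm a)\<^sup>2"
        using sum_squares_bound[of "hs_norm (\<Gamma> s)" "norm a"] by (simp add: mult.assoc)
      ultimately show ?thesis by linarith
    qed
    ultimately show ?thesis using norm_\<Gamma>_le[OF s, of a] by linarith
  qed
  have "(\<integral>\<^sup>+s. ennreal (norm (?f s)) \<partial>lborel) \<le>
      (\<integral>\<^sup>+s. ennreal c * indicator {0<..<T} s + ennreal ((norm (x s))\<^sup>2) * indicator {0<..<T} s \<partial>lborel)"
    using ptw t c(1) by (intro nn_integral_mono) (auto split: split_indicator simp: ennreal_leI simp flip: ennreal_plus)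
  also have "\<dots> = (\<integral>\<^sup>+s. ennreal c * indicator {0<..<T} s + ennreal ((norm (y s))\<^sup>2) * indicator {0<..<T} s \<partial>lborel)"
    by (intro nn_integral_cong) (auto simp: y_def split: split_indicator)
  also have "\<dots> = (\<integral>\<^sup>+s. ennreal c * indicator {0<..<T} s \<partial>lborel) + (\<integral>\<^sup>+s\<in>{0<..<T}. ennreal ((norm (y s))\<^sup>2) \<partial>lborel)"
    by (intro nn_integral_add) measurable
  also have "(\<integral>\<^sup>+s\<in>{0<..<T}. ennreal ((norm (y s))\<^sup>2) \<partial>lborel) = (\<integral>\<^sup>+s\<in>{0<..<T}. ennreal ((norm (x s))\<^sup>2) \<partial>lborel)"
    by (intro nn_integral_cong) (auto simp: y_def split: split_indicator)
  also have "(\<integral>\<^sup>+s. ennreal c * indicator {0<..<T} s \<partial>lborel) + \<dots> < \<infinity>"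
    using fin T by (simp add: nn_integral_time_interval nn_integral_cmult_indicator ennreal_mult_less_top)
  finally show "(\<integral>\<^sup>+s. ennreal (norm (?f s)) \<partial>lborel) < \<infinity>" .
qed

text \<open>Cauchy-Schwarz in time, applied to \<open>norm (\<Gamma> r a) \<le> hs_norm (\<Gamma> r) * norm a\<close>.\<close>
lemma convolution_bound:
  fixes x :: "real \<Rightarrow> 'a"
  assumes x: "x \<in> borel_measurable (time_interval T)" and t: "0 < t" "t < T"
  shows "ennreal ((norm (LBINT s:{0<..<t}. \<Gamma> (t - s) (x s)))\<^sup>2) \<le>
    ennreal energy * mean_square (time_interval T) x"
proof -
  have T: "0 < T" using t by simp
  define y where "y s = x (if s \<in> {0<..<T} then s else T / 2)" for s
  have y [measurable]: "y \<in> borel_measurable lborel"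
    unfolding y_def by (rule measurable_compose[OF clip_measurable[OF T] x])
  let ?F = "\<lambda>s. indicator {0<..<t} s *\<^sub>R \<Gamma> (t - s) (x s)"
  let ?g = "\<lambda>s. ennreal (hs_norm (\<Gamma> (max 0 (t - s)))) * indicator {0<..<t} s"
  let ?h = "\<lambda>s. ennreal (norm (y s)) * indicator {0<..<T} s"
  have "ennreal (norm (integral\<^sup>L lborel ?F)) \<le> (\<integral>\<^sup>+s. ennreal (norm (?F s)) \<partial>lborel)"
  proof (cases "integrable lborel ?F")
    case True
    then show ?thesis by (rule integral_norm_bound_ennreal)
  qed (simp add: not_integrable_integral_eq)
  also have "\<dots> \<le> (\<integral>\<^sup>+s. ?g s * ?h s \<partial>lborel)"
    using norm_\<Gamma>_le t
    by (intro nn_integral_mono) (auto simp: y_def ennreal_leI split: split_indicator simp flip: ennreal_mult)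
  finally have "(ennreal (norm (integral\<^sup>L lborel ?F)))\<^sup>2 \<le> (\<integral>\<^sup>+s. ?g s * ?h s \<partial>lborel)\<^sup>2"
    by (rule power_mono) simp
  also have "\<dots> \<le> (\<integral>\<^sup>+s. (?g s)\<^sup>2 \<partial>lborel) * (\<integral>\<^sup>+s. (?h s)\<^sup>2 \<partial>lborel)"
    by (rule Cauchy_Schwarz_nn_integral) measurable
  also have "(\<integral>\<^sup>+s. (?g s)\<^sup>2 \<partial>lborel) \<le> (\<integral>\<^sup>+s\<in>{0..t}. ennreal ((hs_norm (\<Gamma> (t - s)))\<^sup>2) \<partial>lborel)"
    by (intro nn_integral_mono) (auto simp: ennreal_power split: split_indicator)
  also have "\<dots> \<le> ennreal energy" using t by (intro nn_integral_reversed_energy) simp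
  also have "(\<integral>\<^sup>+s. (?h s)\<^sup>2 \<partial>lborel) = mean_square (time_interval T) x"
    unfolding nn_integral_time_interval
    by (intro nn_integral_cong) (auto simp: y_def ennreal_power split: split_indicator)
  finally show ?thesis
    by (simp add: set_lebesgue_integral_def ennreal_power mult_right_mono)
qed

text \<open>
  The integrand is rewritten as a finite sum of products of jointly measurable functions on the whole
  time axis, for which parameter integrals are measurable.
\<close>
lemma convolution_measurable:
  fixes u :: "real \<Rightarrow> 'w \<Rightarrow> 'a"
  assumes u: "(\<lambda>(\<omega>, s). u s \<omega>) \<in> borel_measurable (M \<Otimes>\<^sub>M time_interval T)" and T: "0 < T"
  shows "(\<lambda>(\<omega>, t). LBINT s:{0<..<t}. \<Gamma> (t - s) (u s \<omega>)) \<in> borel_measurable (M \<Otimes>\<^sub>M time_interval T)"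
proof -
  define w where "w \<omega> s = u (if s \<in> {0<..<T} then s else T / 2) \<omega>" for \<omega> s
  have "(\<lambda>(\<omega>, s). (\<omega>, if s \<in> {0<..<T} then s else T / 2)) \<in> measurable (M \<Otimes>\<^sub>M lborel) (M \<Otimes>\<^sub>M time_interval T)"
    using clip_measurable[OF T] by measurable
  from measurable_compose[OF this u]
  have w [measurable]: "(\<lambda>(\<omega>, s). w \<omega> s) \<in> borel_measurable (M \<Otimes>\<^sub>M lborel)"
    by (simp add: w_def case_prod_beta')
  let ?N = "M \<Otimes>\<^sub>M time_interval T"
  let ?f = "\<lambda>\<omega> t s. indicator {0<..<t} s *\<^sub>R (\<Sum>b\<in>Basis. (w \<omega> s \<bullet> b) *\<^sub>R \<Gamma> (max 0 (t - s)) b)"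
  have [measurable]: "(\<lambda>p. snd p) \<in> borel_measurable ?N"
    by (rule measurable_compose[OF measurable_snd id_time_interval])
  have "(\<lambda>p. \<integral>s. ?f (fst p) (snd p) s \<partial>lborel) \<in> borel_measurable ?N"
    unfolding indicator_def greaterThanLessThan_iff
    by measurable
  moreover have "(LBINT s:{0<..<t}. \<Gamma> (t - s) (u s \<omega>)) =
     (\<integral>s. ?f \<omega> t s \<partial>lborel)"
    if "t \<in> {0<..<T}" for t \<omega>
    unfolding set_lebesgue_integral_def
  proof (intro Bochner_Integration.integral_cong refl)
    fix s
    show "indicator {0<..<t} s *\<^sub>R \<Gamma> (t - s) (u s \<omega>) =
        ?f \<omega> t s"
      using that \<Gamma>_expand[of "t - s" "u s \<omega>"] by (auto simp: w_def split: split_indicator)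
  qed
  ultimately show ?thesis
    by (subst measurable_cong[where g = "\<lambda>p. \<integral>s. ?f (fst p) (snd p) s \<partial>lborel"])
      (auto simp: space_pair_measure space_time_interval)
qed

text \<open>
  The pathwise bound does not depend on \<open>t\<close>, so integration over the time interval contributes the
  factor \<open>T\<close>.
\<close>
lemma convolution_mean_square:
  fixes u :: "real \<Rightarrow> 'w \<Rightarrow> 'a"
  assumes M: "sigma_finite_measure M"
    and u: "(\<lambda>(\<omega>, s). u s \<omega>) \<in> borel_measurable (M \<Otimes>\<^sub>M time_interval T)" and T: "0 < T"
    and \<beta>: "mean_square (M \<Otimes>\<^sub>M time_interval T) (\<lambda>p. u (snd p) (fst p)) \<le> ennreal (\<beta>\<^sup>2)"
  shows "mean_square (M \<Otimes>\<^sub>M time_interval T) (\<lambda>p. LBINT s:{0<..<snd p}. \<Gamma> (snd p - s) (u s (fst p))) \<le>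
    ennreal ((sqrt T * sqrt energy * \<beta>)\<^sup>2)"
proof -
  interpret M: sigma_finite_measure M by (rule M)
  interpret I: sigma_finite_measure "time_interval T" by (rule sigma_finite_time_interval) (use T in simp)
  let ?N = "M \<Otimes>\<^sub>M time_interval T"
  let ?f = "\<lambda>p. ennreal ((norm (LBINT s:{0<..<snd p}. \<Gamma> (snd p - s) (u s (fst p))))\<^sup>2)"
  have um: "(\<lambda>p. u (snd p) (fst p)) \<in> borel_measurable ?N" using u by (simp add: case_prod_beta')
  have fm: "?f \<in> borel_measurable ?N"
    using convolution_measurable[OF u T] by (simp add: case_prod_beta') 
  have "(\<integral>\<^sup>+p. ?f p \<partial>?N) = (\<integral>\<^sup>+\<omega>. \<integral>\<^sup>+t. ?f (\<omega>, t) \<partial>time_interval T \<partial>M)"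
    by (rule I.nn_integral_fst[symmetric, OF fm])
  also have "\<dots> \<le> (\<integral>\<^sup>+\<omega>. \<integral>\<^sup>+t. ennreal energy * mean_square (time_interval T) (\<lambda>s. u s \<omega>) \<partial>time_interval T \<partial>M)"
  proof (intro nn_integral_mono)
    fix \<omega> t assume "\<omega> \<in> space M" and t: "t \<in> space (time_interval T)"
    then have "(\<lambda>s. u s \<omega>) \<in> borel_measurable (time_interval T)"
      using measurable_compose[OF measurable_Pair1'[of \<omega> M "time_interval T"] um] by simp
    then show "?f (\<omega>, t) \<le> ennreal energy * mean_square (time_interval T) (\<lambda>s. u s \<omega>)"
      using t convolution_bound[of "\<lambda>s. u s \<omega>" T t] by (simp add: space_time_interval)
  qed
  also have "\<dots> = (\<integral>\<^sup>+\<omega>. ennreal (T * energy) * mean_square (time_interval T) (\<lambda>s. u s \<omega>) \<partial>M)"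
    using T energy_nonneg by (simp add: emeasure_time_interval ennreal_mult ac_simps)
  also have "\<dots> = ennreal (T * energy) * (\<integral>\<^sup>+\<omega>. \<integral>\<^sup>+s. ennreal ((norm (u s \<omega>))\<^sup>2) \<partial>time_interval T \<partial>M)"
    using um by (intro nn_integral_cmult I.borel_measurable_nn_integral_fst[of "\<lambda>p. ennreal ((norm (u (snd p) (fst p)))\<^sup>2)", simplified]) measurable
  also have "(\<integral>\<^sup>+\<omega>. \<integral>\<^sup>+s. ennreal ((norm (u s \<omega>))\<^sup>2) \<partial>time_interval T \<partial>M) = mean_square ?N (\<lambda>p. u (snd p) (fst p))"
    using um I.nn_integral_fst[of "\<lambda>p. ennreal ((norm (u (snd p) (fst p)))\<^sup>2)" M] by simp
  also have "ennreal (T * energy) * \<dots> \<le> ennreal (T * energy) * ennreal (\<beta>\<^sup>2)"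
    by (intro mult_left_mono \<beta>) simp
  also have "\<dots> = ennreal ((sqrt T * sqrt energy * \<beta>)\<^sup>2)"
    using T energy_nonneg by (simp add: power_mult_distrib flip: ennreal_mult)
  finally show ?thesis .
qed

lemma initial_mean_square:
  fixes v :: "'w \<Rightarrow> 'a"
  assumes v: "v \<in> borel_measurable M" and T: "0 < T"
    and \<beta>: "mean_square M v \<le> ennreal (\<beta>\<^sup>2)"
  shows "(\<lambda>p. \<Gamma> (snd p) (v (fst p))) \<in> borel_measurable (M \<Otimes>\<^sub>M time_interval T)"
    and "mean_square (M \<Otimes>\<^sub>M time_interval T) (\<lambda>p. \<Gamma> (snd p) (v (fst p))) \<le> ennreal ((\<beta> * sqrt energy)\<^sup>2)"
proof -
  interpret I: sigma_finite_measure "time_interval T" by (rule sigma_finite_time_interval) (use T in simp)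
  let ?N = "M \<Otimes>\<^sub>M time_interval T"
  have [measurable]: "(\<lambda>p. snd p) \<in> borel_measurable ?N"
    by (rule measurable_compose[OF measurable_snd id_time_interval])
  have "(\<lambda>p. \<Sum>b\<in>Basis. (v (fst p) \<bullet> b) *\<^sub>R \<Gamma> (max 0 (snd p)) b) \<in> borel_measurable ?N"
    using v by measurable
  moreover have "\<Gamma> (snd p) (v (fst p)) = (\<Sum>b\<in>Basis. (v (fst p) \<bullet> b) *\<^sub>R \<Gamma> (max 0 (snd p)) b)" if "p \<in> space ?N" for p
    using that \<Gamma>_expand[of "snd p" "v (fst p)"] by (auto simp: space_pair_measure space_time_interval)
  ultimately show m: "(\<lambda>p. \<Gamma> (snd p) (v (fst p))) \<in> borel_measurable ?N"
    by (subst measurable_cong) auto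
  have "mean_square ?N (\<lambda>p. \<Gamma> (snd p) (v (fst p))) =
      (\<integral>\<^sup>+\<omega>. \<integral>\<^sup>+t. ennreal ((norm (\<Gamma> t (v \<omega>)))\<^sup>2) \<partial>time_interval T \<partial>M)"
    using m I.nn_integral_fst[of "\<lambda>p. ennreal ((norm (\<Gamma> (snd p) (v (fst p))))\<^sup>2)" M] by simp
  also have "\<dots> \<le> (\<integral>\<^sup>+\<omega>. ennreal energy * ennreal ((norm (v \<omega>))\<^sup>2) \<partial>M)"
  proof (intro nn_integral_mono)
    fix \<omega>
    have "mean_square (time_interval T) (\<lambda>t. \<Gamma> t (v \<omega>)) \<le>
      (\<integral>\<^sup>+t. ennreal ((norm (v \<omega>))\<^sup>2) * (ennreal ((hs_norm (\<Gamma> (max 0 t)))\<^sup>2) * indicator {0..} t) \<partial>lborel)"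
      unfolding nn_integral_time_interval
    proof (intro nn_integral_mono)
      fix t
      show "ennreal ((norm (\<Gamma> t (v \<omega>)))\<^sup>2) * indicator {0<..<T} t
         \<le> ennreal ((norm (v \<omega>))\<^sup>2) * (ennreal ((hs_norm (\<Gamma> (max 0 t)))\<^sup>2) * indicator {0..} t)"
      proof (cases "t \<in> {0<..<T}")
        case True
        then have "(norm (\<Gamma> t (v \<omega>)))\<^sup>2 \<le> (hs_norm (\<Gamma> t) * norm (v \<omega>))\<^sup>2"
          by (intro power_mono norm_\<Gamma>_le) auto
        then show ?thesis
          using True by (simp add: power_mult_distrib ennreal_leI mult.commute flip: ennreal_mult)
      qed simp
    qed
    also have "\<dots> = ennreal ((norm (v \<omega>))\<^sup>2) * (\<integral>\<^sup>+t. ennreal ((hs_norm (\<Gamma> (max 0 t)))\<^sup>2) * indicator {0..} t \<partial>lborel)"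
      by (intro nn_integral_cmult) measurable
    also have "(\<integral>\<^sup>+t. ennreal ((hs_norm (\<Gamma> (max 0 t)))\<^sup>2) * indicator {0..} t \<partial>lborel) = ennreal energy"
      unfolding nn_integral_energy[symmetric] by (intro nn_integral_cong) (auto split: split_indicator)
    finally show "mean_square (time_interval T) (\<lambda>t. \<Gamma> t (v \<omega>)) \<le> ennreal energy * ennreal ((norm (v \<omega>))\<^sup>2)"
      by (simp add: mult.commute)
  qed
  also have "\<dots> = ennreal energy * mean_square M v"
    using v by (intro nn_integral_cmult) measurable
  also have "\<dots> \<le> ennreal energy * ennreal (\<beta>\<^sup>2)" by (intro mult_left_mono \<beta>) simp
  also have "\<dots> = ennreal ((\<beta> * sqrt energy)\<^sup>2)"
    using energy_nonneg by (simp add: power_mult_distrib mult.commute flip: ennreal_mult)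
  finally show "mean_square ?N (\<lambda>p. \<Gamma> (snd p) (v (fst p))) \<le> ennreal ((\<beta> * sqrt energy)\<^sup>2)" .
qed

end

section \<open>The error estimate\<close>

lemma nn_integral_L2_fun:
  assumes "L2_fun N f"
  shows "mean_square N f = ennreal ((L2_norm N f)\<^sup>2)"
  using assms by (simp add: L2_fun_def L2_norm_def nn_integral_eq_integral)

lemma L2_norm_nonneg: "0 \<le> L2_norm N f"
  by (simp add: L2_norm_def)

lemma L2_norm_leI:
  assumes m: "f \<in> borel_measurable N" and b: "mean_square N f \<le> ennreal (\<alpha>\<^sup>2)" and "0 \<le> \<alpha>"
  shows "L2_fun N f \<and> L2_norm N f \<le> \<alpha>"
proof -
  have i: "integrable N (\<lambda>x. (norm (f x))\<^sup>2)"
    using m b by (intro integrableI_nonneg) (auto intro: le_less_trans)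
  then have "ennreal (\<integral>x. (norm (f x))\<^sup>2 \<partial>N) \<le> ennreal (\<alpha>\<^sup>2)"
    using b by (simp add: nn_integral_eq_integral)
  then have "(\<integral>x. (norm (f x))\<^sup>2 \<partial>N) \<le> \<alpha>\<^sup>2" by (simp add: ennreal_le_iff)
  then have "L2_norm N f \<le> \<alpha>"
    unfolding L2_norm_def using \<open>0 \<le> \<alpha>\<close> by (intro real_le_lsqrt) auto
  with i m show ?thesis by (simp add: L2_fun_def)
qed

lemma L2_bound_add:
  fixes f g :: "'a \<Rightarrow> 'h::{real_normed_vector, second_countable_topology}"
  assumes "f \<in> borel_measurable N" "g \<in> borel_measurable N"
    and "mean_square N f \<le> ennreal (\<alpha>\<^sup>2)"
    and "mean_square N g \<le> ennreal (\<beta>\<^sup>2)"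
    and "0 \<le> \<alpha>" "0 \<le> \<beta>"
  shows "mean_square N (\<lambda>x. f x + g x) \<le> ennreal ((\<alpha> + \<beta>)\<^sup>2)"
  by (rule nn_integral_minkowski[of "\<lambda>x. norm (f x)" N "\<lambda>x. norm (g x)"])
    (use assms in \<open>auto intro: norm_triangle_ineq\<close>)

lemma stable_pair_intro:
  assumes "stable_semigroup S" "stable_semigroup S'" "bounded_linear G" "bounded_linear G'"
  shows "stable_pair S S' G G'"
  using assms by (intro stable_pair.intro stable_pair_axioms.intro)

lemma error_system_intro:
  assumes "stable_semigroup S" "stable_semigroup S'" "bounded_linear G" "bounded_linear G'"
    "bounded_linear C" "bounded_linear C'"
  shows "error_system S S' G G' C C'"
  using assms by (intro error_system.intro error_system_axioms.intro stable_pair_intro)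

lemma bounded_linear_initial_input: "bounded_linear (initial_input \<phi> :: real ^ 'k \<Rightarrow> 'x::real_normed_vector)"
  unfolding initial_input_def[abs_def]
  by (intro bounded_linear_sum bounded_linear_scaleR_const bounded_linear_vec_nth)

lemma bounded_linear_noise_input:
  assumes "bounded_linear K"
  shows "bounded_linear (noise_input M L K)"
  unfolding noise_input_def by (rule bounded_linear_compose[OF assms matrix_vector_mul_bounded_linear])

context square_integrable_levy
begin

text \<open>
  The integrand composed with \<open>R\<close> is the time-reversed impulse response to the noise inputs.
\<close>
lemma stochastic_convolution_bound:
  assumes err: "error_system S S' (noise_input M L K) (noise_input M L K') C C'"
    and K: "bounded_linear K" "bounded_linear K'" and t: "0 \<le> t"
    and I: "is_stochastic_integral M L t (\<lambda>s x. S (t - s) (K x)) I"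
    and I': "is_stochastic_integral M L t (\<lambda>s x. S' (t - s) (K' x)) I'"
  shows "mean_square M (\<lambda>\<omega>. C (I \<omega>) - C' (I' \<omega>))
    \<le> ennreal (error_system.energy S S' (noise_input M L K) (noise_input M L K') C C')"
proof -
  interpret e: error_system S S' "noise_input M L K" "noise_input M L K'" C C' by (rule err)
  let ?F = "\<lambda>s x. C (S (t - s) (K x)) - C' (S' (t - s) (K' x))"
  have F: "?F s (R *v k) = e.\<Gamma> (t - s) k" for s k
    unfolding e.\<Gamma>_def by (simp add: noise_input_def R_def)
  have "mean_square M (\<lambda>\<omega>. C (I \<omega>) - C' (I' \<omega>)) \<le> ennreal ((sqrt e.energy)\<^sup>2)"
  proof (rule stochastic_integral_bound)
    show "is_stochastic_integral M L t ?F (\<lambda>\<omega>. C (I \<omega>) - C' (I' \<omega>))"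
      by (rule stochastic_integral_diff[OF I I' e.C e.C'])
    show "linear (?F s)" if "s \<in> {0..t}" for s
      using that
      by (intro bounded_linear.linear bounded_linear_sub bounded_linear_compose[OF e.C] bounded_linear_compose[OF e.C']
        bounded_linear_compose[OF e.S.bounded_linear_semigroup] bounded_linear_compose[OF e.S'.bounded_linear_semigroup] K) auto
    show "(\<integral>\<^sup>+s\<in>{0..t}. ennreal ((hs_norm (\<lambda>k. ?F s (R *v k)))\<^sup>2) \<partial>lborel) \<le> ennreal ((sqrt e.energy)\<^sup>2)"
      unfolding F using e.nn_integral_reversed_energy[OF t] e.energy_nonneg by simp
  qed (simp add: e.energy_nonneg)
  then show ?thesis using e.energy_nonneg by simp
qed

end

text \<open>
  The second system is first driven by the control of the first one. Square-integrability of the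
  controls justifies moving the output operators under the integrals.
\<close>
lemma control_decomposition:
  fixes S :: "real \<Rightarrow> 'x::{real_inner, banach, second_countable_topology} \<Rightarrow> 'x"
    and S' :: "real \<Rightarrow> 'y::{real_inner, banach, second_countable_topology} \<Rightarrow> 'y"
    and B :: "'a::euclidean_space \<Rightarrow> 'x" and B' :: "'a \<Rightarrow> 'y"
    and C :: "'x \<Rightarrow> 'h::{real_inner, banach, second_countable_topology}" and C' :: "'y \<Rightarrow> 'h"
  assumes S: "stable_semigroup S" "stable_semigroup S'" and B: "bounded_linear B" "bounded_linear B'"
    and C: "bounded_linear C" "bounded_linear C'"
    and x: "x \<in> borel_measurable (time_interval T)" "mean_square (time_interval T) x < \<infinity>"
    and x': "x' \<in> borel_measurable (time_interval T)" "mean_square (time_interval T) (\<lambda>s. x' s) < \<infinity>"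
    and t: "0 < t" "t < T"
  shows "C (LBINT s:{0<..<t}. S (t - s) (B (x s))) - C' (LBINT s:{0<..<t}. S' (t - s) (B' (x' s))) =
    (LBINT s:{0<..<t}. C (S (t - s) (B (x s))) - C' (S' (t - s) (B' (x s)))) +
    (LBINT s:{0<..<t}. C' (S' (t - s) (B' (x s - x' s))))"
proof -
  have bl0: "bounded_linear (\<lambda>_. 0)" by (rule bounded_linear_zero)
  interpret a: error_system S S B B "\<lambda>x. x" "\<lambda>_. 0"
    by (intro error_system_intro S B bounded_linear_ident bl0)
  interpret a': error_system S' S' B' B' "\<lambda>x. x" "\<lambda>_. 0"
    by (intro error_system_intro S B bounded_linear_ident bl0)
  have pull: "set_integrable lborel A (\<lambda>s. D (f s))" "D (LBINT s:A. f s) = (LBINT s:A. D (f s))"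
    if D: "bounded_linear D" and f: "set_integrable lborel A f"
    for D :: "'p::{real_normed_vector, banach, second_countable_topology} \<Rightarrow> 'h" and f A
  proof -
    have eq: "D (indicator A s *\<^sub>R f s) = indicator A s *\<^sub>R D (f s)" for s
      by (simp add: linear_scale[OF bounded_linear.linear[OF D]])
    show "set_integrable lborel A (\<lambda>s. D (f s))"
      using integrable_bounded_linear[OF D f[unfolded set_integrable_def]] by (simp add: set_integrable_def eq)
    show "D (LBINT s:A. f s) = (LBINT s:A. D (f s))"
      using integral_bounded_linear[OF D f[unfolded set_integrable_def]] by (simp add: set_lebesgue_integral_def eq)
  qed
  have i: "set_integrable lborel {0<..<t} (\<lambda>s. S (t - s) (B (x s)))"
    using a.convolution_integrable[OF x t] by (simp add: a.\<Gamma>_def)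
  have i': "set_integrable lborel {0<..<t} (\<lambda>s. S' (t - s) (B' (x' s)))"
    using a'.convolution_integrable[OF x' t] by (simp add: a'.\<Gamma>_def)
  have i'': "set_integrable lborel {0<..<t} (\<lambda>s. S' (t - s) (B' (x s)))"
    using a'.convolution_integrable[OF x t] by (simp add: a'.\<Gamma>_def)
  note j = pull(1)[OF C(1) i] pull(1)[OF C(2) i'] pull(1)[OF C(2) i'']
  have lin: "C' (S' (t - s) (B' (x s - x' s))) = C' (S' (t - s) (B' (x s))) - C' (S' (t - s) (B' (x' s)))"
    if "s \<in> {0<..<t}" for s
    using that bounded_linear.linear[OF a'.S.bounded_linear_semigroup[of "t - s"]]
    by (simp add: linear_diff bounded_linear.linear[OF B(2)] bounded_linear.linear[OF C(2)])
  have "(LBINT s:{0<..<t}. C' (S' (t - s) (B' (x s - x' s)))) =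
    (LBINT s:{0<..<t}. C' (S' (t - s) (B' (x s))) - C' (S' (t - s) (B' (x' s))))"
    by (rule set_lebesgue_integral_cong) (auto simp: lin)
  then show ?thesis
    by (simp add: pull(2)[OF C(1) i] pull(2)[OF C(2) i'] set_integral_diff j)
qed

text \<open>Tonelli: almost every path of a square-integrable process is square-integrable in time.\<close>
lemma AE_section_square_integrable:
  assumes "L2_proc M T f" "0 < T"
  shows "AE \<omega> in M. (\<lambda>s. f s \<omega>) \<in> borel_measurable (time_interval T) \<and>
    mean_square (time_interval T) (\<lambda>s. f s \<omega>) < \<infinity>"
proof -
  interpret I: sigma_finite_measure "time_interval T" by (rule sigma_finite_time_interval) (use assms in simp)
  have f: "L2_fun (M \<Otimes>\<^sub>M time_interval T) (\<lambda>p. f (snd p) (fst p))"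
    using assms(1) by (simp add: L2_proc_def Omega_T_eq case_prod_beta')
  then have m: "(\<lambda>p. f (snd p) (fst p)) \<in> borel_measurable (M \<Otimes>\<^sub>M time_interval T)" by (simp add: L2_fun_def)
  let ?g = "\<lambda>p. ennreal ((norm (f (snd p) (fst p)))\<^sup>2)"
  have g: "?g \<in> borel_measurable (M \<Otimes>\<^sub>M time_interval T)" using m by measurable
  have "(\<integral>\<^sup>+\<omega>. \<integral>\<^sup>+s. ?g (\<omega>, s) \<partial>time_interval T \<partial>M) \<noteq> \<infinity>"
    unfolding I.nn_integral_fst[OF g] nn_integral_L2_fun[OF f] by simp
  then have "AE \<omega> in M. (\<integral>\<^sup>+s. ?g (\<omega>, s) \<partial>time_interval T) \<noteq> \<infinity>"
    by (intro nn_integral_PInf_AE I.borel_measurable_nn_integral_fst[OF g])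
  then show ?thesis
  proof (rule AE_mp, intro AE_I2 impI)
    fix \<omega> assume "\<omega> \<in> space M" "(\<integral>\<^sup>+s. ?g (\<omega>, s) \<partial>time_interval T) \<noteq> \<infinity>"
    then show "(\<lambda>s. f s \<omega>) \<in> borel_measurable (time_interval T) \<and>
      mean_square (time_interval T) (\<lambda>s. f s \<omega>) < \<infinity>"
      using measurable_compose[OF measurable_Pair1'[of \<omega> M "time_interval T"] m] by (simp add: top.not_eq_extremum)
  qed
qed

lemma ou_output_measurable:
  fixes C :: "'x::{real_inner, banach, second_countable_topology} \<Rightarrow> 'h::{real_inner, banach, second_countable_topology}"
  assumes Y: "ou_output M L T S B K C u \<xi> Y" and C: "bounded_linear C"
  shows "(\<lambda>p. Y (snd p) (fst p)) \<in> borel_measurable (M \<Otimes>\<^sub>M time_interval T)"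
proof -
  obtain Z where Z: "(\<lambda>(\<omega>, t). Z t \<omega>) \<in> borel_measurable (M \<Otimes>\<^sub>M restrict_space lborel {0..T})"
    and Y: "\<And>t \<omega>. t \<in> {0..T} \<Longrightarrow> \<omega> \<in> space M \<Longrightarrow> Y t \<omega> = C (Z t \<omega>)"
    using Y unfolding ou_output_def mild_solution_def by blast
  have "(\<lambda>s. s) \<in> measurable (time_interval T) (restrict_space lborel {0..T})"
    by (rule measurable_restrict_space2) (auto simp: space_time_interval time_interval_def intro: measurable_restrict_space1)
  then have "(\<lambda>p. (fst p, snd p)) \<in> measurable (M \<Otimes>\<^sub>M time_interval T) (M \<Otimes>\<^sub>M restrict_space lborel {0..T})"
    by (intro measurable_Pair measurable_fst measurable_compose[OF measurable_snd])
  from measurable_compose[OF measurable_compose[OF this Z] borel_measurable_continuous_onI[OF linear_continuous_on[OF C]]]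
  have "(\<lambda>p. C (Z (snd p) (fst p))) \<in> borel_measurable (M \<Otimes>\<^sub>M time_interval T)"
    by (simp add: case_prod_beta')
  then show ?thesis
    by (subst measurable_cong[where g = "\<lambda>p. C (Z (snd p) (fst p))"])
      (auto simp: space_pair_measure space_time_interval Y)
qed

theorem corollary3p4:
  fixes M :: "'w measure"
    and L :: "real \<Rightarrow> 'w \<Rightarrow> real ^ 'd"
    and T :: real
    and A :: "('x::{real_inner, banach, second_countable_topology} \<times> 'x) set"
    and S :: "real \<Rightarrow> 'x \<Rightarrow> 'x"
    and B :: "real ^ 'm \<Rightarrow> 'x"
    and K :: "real ^ 'd \<Rightarrow> 'x"
    and C :: "'x \<Rightarrow> 'h::{real_inner, banach, second_countable_topology}"
    and A' :: "('y::{real_inner, banach, second_countable_topology} \<times> 'y) set"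
    and S' :: "real \<Rightarrow> 'y \<Rightarrow> 'y"
    and B' :: "real ^ 'm \<Rightarrow> 'y"
    and K' :: "real ^ 'd \<Rightarrow> 'y"
    and C' :: "'y \<Rightarrow> 'h"
    and A0 :: "('z::{real_inner, banach, second_countable_topology} \<times> 'z) set"
    and S0 :: "real \<Rightarrow> 'z \<Rightarrow> 'z"
    and Bin' :: "real ^ 'k \<Rightarrow> 'z"
    and C0 :: "'z \<Rightarrow> 'h"
    and \<phi> :: "'k \<Rightarrow> 'x"
    and v :: "'w \<Rightarrow> real ^ 'k"
    and u u' :: "real \<Rightarrow> 'w \<Rightarrow> real ^ 'm"
    and Y Y' Y0 :: "real \<Rightarrow> 'w \<Rightarrow> 'h"
    and P0 :: "'x \<Rightarrow> 'x" and P0g :: "'z \<Rightarrow> 'x" and P0' :: "'z \<Rightarrow> 'z"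
  defines "Bin \<equiv> initial_input \<phi>"
    and "B2 \<equiv> noise_input M L K"
    and "B2' \<equiv> noise_input M L K'"
  defines "P1 \<equiv> gramian S B S B" and "P2 \<equiv> gramian S B2 S B2"
    and "P1g \<equiv> gramian S B S' B'" and "P2g \<equiv> gramian S B2 S' B2'"
    and "P1' \<equiv> gramian S' B' S' B'" and "P2' \<equiv> gramian S' B2' S' B2'"
  defines "Pou \<equiv> (\<lambda>x. P1 x + P2 x)"
    and "Poug \<equiv> (\<lambda>y. P1g y + P2g y)"
    and "Pou' \<equiv> (\<lambda>y. P1' y + P2' y)"
  assumes "prob_space M"
    and "levy_process M L" and "square_integrable_mean_zero M L"
    and "0 < T"
    and "ou_system A S B K C" and "exponentially_stable S"
    and "ou_system A' S' B' K' C'" and "exponentially_stable S'"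
    and "c0_semigroup S0" and "A0 = generator S0" and "exponentially_stable S0"
    and "bounded_linear Bin'" and "bounded_linear C0"
    and "orthonormal_family \<phi>"
    and "L2_fun M v" and "v \<in> borel_measurable (induced_filtration M L 0)"
    and "L2_adapted M L T u" and "L2_adapted M L T u'"
    and "ou_output M L T S B K C u (\<lambda>\<omega>. Bin (v \<omega>)) Y"
    and "ou_output M L T S' B' K' C' u' (\<lambda>\<omega>. 0) Y'"
    and "\<And>t \<omega>. Y0 t \<omega> = C0 (S0 t (Bin' (v \<omega>))) + Y' t \<omega>"
    and "lyapunov_solution A A Bin Bin P0"
    and "lyapunov_solution A A0 Bin Bin' P0g"
    and "lyapunov_solution A0 A0 Bin' Bin' P0'"
  shows "L2_proc M T (\<lambda>t \<omega>. Y t \<omega> - Y0 t \<omega>) \<and>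
    L2_proc_norm M T (\<lambda>t \<omega>. Y t \<omega> - Y0 t \<omega>)
    \<le> sqrt (2 * T) * max 1 (L2_proc_norm M T u)
        * sqrt (trace_operator (\<lambda>h. C (Pou (adjoint C h)) - 2 *\<^sub>R C (Poug (adjoint C' h))
                                    + C' (Pou' (adjoint C' h))))
      + L2_norm M v
        * sqrt (trace_operator (\<lambda>h. C (P0 (adjoint C h)) - 2 *\<^sub>R C (P0g (adjoint C0 h))
                                    + C0 (P0' (adjoint C0 h))))
      + sqrt T * sqrt (trace_operator (\<lambda>h. C' (P1' (adjoint C' h))))
        * L2_proc_norm M T (\<lambda>t \<omega>. u t \<omega> - u' t \<omega>)"
proof -
  interpret levy: square_integrable_levy M L
    by (intro square_integrable_levy.intro square_integrable_levy_axioms.intro assms)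
  have S: "stable_semigroup S" and S': "stable_semigroup S'" and S0: "stable_semigroup S0"
    using assms by (auto simp: stable_semigroup_def ou_system_def)
  have blB: "bounded_linear B" "bounded_linear B'" and blK: "bounded_linear K" "bounded_linear K'"
    and blC: "bounded_linear C" "bounded_linear C'" "bounded_linear C0" and A: "A = generator S"
    using assms by (auto simp: ou_system_def)
  have blBin: "bounded_linear Bin" "bounded_linear Bin'"
    using assms bounded_linear_initial_input by auto
  have blB2: "bounded_linear B2" "bounded_linear B2'"
    using blK bounded_linear_noise_input by (auto simp: B2_def B2'_def)
  have T: "0 < T" by fact
  interpret e0: error_system S S0 Bin Bin' C C0 by (intro error_system_intro S S0 blBin blC)
  interpret e1: error_system S S' B B' C C' by (intro error_system_intro S S' blB blC)
  interpret e2: error_system S S' B2 B2' C C' by (intro error_system_intro S S' blB2 blC)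
  interpret e3: error_system S' S' B' B' C' "\<lambda>_. 0"
    by (intro error_system_intro S' blB blC bounded_linear_zero)
  interpret e4: error_system S0 S0 Bin' Bin' C0 "\<lambda>_. 0"
    by (intro error_system_intro S0 blBin blC bounded_linear_zero)

  have tr0: "trace_operator (\<lambda>h. C (P0 (adjoint C h)) - 2 *\<^sub>R C (P0g (adjoint C0 h)) + C0 (P0' (adjoint C0 h))) = e0.energy"
  proof (rule trace_operator_eqI, rule e0.has_trace_error)
    show "is_gramian S Bin S Bin P0"
      using stable_pair.lyapunov_solution_is_gramian[OF stable_pair_intro[OF S S blBin(1) blBin(1)]] assms A by simp
    show "is_gramian S Bin S0 Bin' P0g"
      using e0.lyapunov_solution_is_gramian assms A by simp
    show "is_gramian S0 Bin' S0 Bin' P0'"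
      using e4.lyapunov_solution_is_gramian assms by simp
  qed
  have gr: "is_gramian S B S B P1" "is_gramian S B S' B' P1g" "is_gramian S' B' S' B' P1'"
    "is_gramian S B2 S B2 P2" "is_gramian S B2 S' B2' P2g" "is_gramian S' B2' S' B2' P2'"
    unfolding P1_def P1g_def P1'_def P2_def P2g_def P2'_def
    by (intro stable_pair.gramian_is_gramian stable_pair_intro S S' blB blB2)+
  let ?Rou = "\<lambda>h. C (Pou (adjoint C h)) - 2 *\<^sub>R C (Poug (adjoint C' h)) + C' (Pou' (adjoint C' h))"
  have tr: "trace_operator ?Rou =
    e1.energy + e2.energy"
  proof (rule trace_operator_eqI)
    have "?Rou =
      (\<lambda>h. (C (P1 (adjoint C h)) - 2 *\<^sub>R C (P1g (adjoint C' h)) + C' (P1' (adjoint C' h))) +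
           (C (P2 (adjoint C h)) - 2 *\<^sub>R C (P2g (adjoint C' h)) + C' (P2' (adjoint C' h))))"
      unfolding Pou_def Poug_def Pou'_def
      by (simp add: linear_add[OF bounded_linear.linear[OF blC(1)]] linear_add[OF bounded_linear.linear[OF blC(2)]]
          algebra_simps)
    then show "has_trace ?Rou (e1.energy + e2.energy)"
      using has_trace_add[OF e1.has_trace_error[OF gr(1,2,3)] e2.has_trace_error[OF gr(4,5,6)]] by simp
  qed
  \<comment> \<open>With the zero output operator in the second place the trace formula reduces to one system.\<close>
  have tr3: "trace_operator (\<lambda>h. C' (P1' (adjoint C' h))) = e3.energy"
  proof (rule trace_operator_eqI)
    have "adjoint (\<lambda>_::'y. 0::'h) = (\<lambda>_. 0)" by (rule adjoint_unique) simp
    moreover have "P1' 0 = 0" "C' 0 = 0"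
      using gr(3) blC(2) by (auto simp: is_gramian_def linear_0 bounded_linear.linear)
    ultimately show "has_trace (\<lambda>h. C' (P1' (adjoint C' h))) e3.energy"
      using e3.has_trace_error[OF gr(3) gr(3) gr(3)] by simp
  qed

  let ?N = "M \<Otimes>\<^sub>M time_interval T"
  interpret I: sigma_finite_measure "time_interval T" by (rule sigma_finite_time_interval) (use T in simp)
  interpret P: pair_sigma_finite M "time_interval T" ..
  have L2u: "L2_proc M T u" "L2_proc M T u'" using assms by (auto simp: L2_adapted_def)
  have um: "(\<lambda>(\<omega>, s). u s \<omega>) \<in> borel_measurable ?N" "(\<lambda>(\<omega>, s). u' s \<omega>) \<in> borel_measurable ?N"
    using L2u by (auto simp: L2_proc_def L2_fun_def Omega_T_eq)
  have um2: "(\<lambda>(\<omega>, s). u s \<omega> - u' s \<omega>) \<in> borel_measurable ?N"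
    using borel_measurable_diff[OF um] by (simp add: case_prod_beta')
  have L2uu: "L2_proc M T (\<lambda>t \<omega>. u t \<omega> - u' t \<omega>)"
  proof -
    have "mean_square ?N (\<lambda>p. u (snd p) (fst p) + - u' (snd p) (fst p)) \<le>
       ennreal ((L2_proc_norm M T u + L2_proc_norm M T u')\<^sup>2)"
      using um nn_integral_L2_fun[OF L2u(1)[unfolded L2_proc_def]] nn_integral_L2_fun[OF L2u(2)[unfolded L2_proc_def]]
      by (intro L2_bound_add) (auto simp: L2_proc_norm_def L2_norm_nonneg Omega_T_eq case_prod_beta')
    from L2_norm_leI[OF _ this] um2 show ?thesis
      by (simp add: L2_proc_def Omega_T_eq case_prod_beta' L2_proc_norm_def L2_norm_nonneg)
  qed
  have nnu: "mean_square ?N (\<lambda>p. u (snd p) (fst p)) \<le> ennreal ((L2_proc_norm M T u)\<^sup>2)"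
    using nn_integral_L2_fun[OF L2u(1)[unfolded L2_proc_def]] by (simp add: L2_proc_norm_def Omega_T_eq case_prod_beta')
  have nnuu: "mean_square ?N (\<lambda>p. u (snd p) (fst p) - u' (snd p) (fst p))
      \<le> ennreal ((L2_proc_norm M T (\<lambda>t \<omega>. u t \<omega> - u' t \<omega>))\<^sup>2)"
    using nn_integral_L2_fun[OF L2uu[unfolded L2_proc_def]] by (simp add: L2_proc_norm_def Omega_T_eq case_prod_beta')
  have vm: "v \<in> borel_measurable M" using \<open>L2_fun M v\<close> by (simp add: L2_fun_def)
  have nnv: "mean_square M v \<le> ennreal ((L2_norm M v)\<^sup>2)"
    using nn_integral_L2_fun[OF \<open>L2_fun M v\<close>] by simp

  define D where "D p = Y (snd p) (fst p) - Y0 (snd p) (fst p)" for p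
  define f0 where "f0 p = e0.\<Gamma> (snd p) (v (fst p))" for p
  define fU where "fU p = (LBINT s:{0<..<snd p}. e1.\<Gamma> (snd p - s) (u s (fst p)))" for p
  define fW where "fW p = (LBINT s:{0<..<snd p}. e3.\<Gamma> (snd p - s) (u s (fst p) - u' s (fst p)))" for p
  \<comment> \<open>The stochastic integrals are given for each time separately and up to null sets, which says
    nothing about joint measurability. The noise term is therefore defined as the remainder, which is
    jointly measurable, and identified with the stochastic integrals at each fixed time.\<close>
  define fN where "fN p = D p - f0 p - fU p - fW p" for p

  have Dm: "D \<in> borel_measurable ?N"
  proof -
    have "(\<lambda>p. C0 (S0 (snd p) (Bin' (v (fst p))))) \<in> borel_measurable ?N"
      using e4.initial_mean_square(1)[OF vm T nnv] by (simp add: e4.\<Gamma>_def)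
    moreover have "(\<lambda>p. Y (snd p) (fst p)) \<in> borel_measurable ?N" "(\<lambda>p. Y' (snd p) (fst p)) \<in> borel_measurable ?N"
      using assms blC by (auto intro: ou_output_measurable)
    ultimately show ?thesis
      unfolding D_def[abs_def] \<open>\<And>t \<omega>. Y0 t \<omega> = C0 (S0 t (Bin' (v \<omega>))) + Y' t \<omega>\<close> by measurable
  qed
  have f0m: "f0 \<in> borel_measurable ?N"
    and f0b: "mean_square ?N f0 \<le> ennreal ((L2_norm M v * sqrt e0.energy)\<^sup>2)"
    using e0.initial_mean_square[OF vm T nnv] by (simp_all add: f0_def[abs_def])
  have fUm: "fU \<in> borel_measurable ?N"
    using e1.convolution_measurable[OF um(1) T] by (simp add: fU_def[abs_def] case_prod_beta')
  have fUb: "mean_square ?N fU \<le> ennreal ((sqrt T * sqrt e1.energy * L2_proc_norm M T u)\<^sup>2)"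
    unfolding fU_def by (rule e1.convolution_mean_square[OF levy.sigma_finite_measure_axioms um(1) T nnu])
  have fWm: "fW \<in> borel_measurable ?N"
    using e3.convolution_measurable[OF um2 T] by (simp add: fW_def[abs_def] case_prod_beta')
  have fWb: "mean_square ?N fW
      \<le> ennreal ((sqrt T * sqrt e3.energy * L2_proc_norm M T (\<lambda>t \<omega>. u t \<omega> - u' t \<omega>))\<^sup>2)"
    unfolding fW_def by (rule e3.convolution_mean_square[OF levy.sigma_finite_measure_axioms um2 T nnuu])
  have fNm: "fN \<in> borel_measurable ?N"
    unfolding fN_def[abs_def] using Dm f0m fUm fWm by measurable

  obtain Z where Z: "mild_solution M L T S B K u (\<lambda>\<omega>. Bin (v \<omega>)) Z"
    and YZ: "\<And>t \<omega>. t \<in> {0..T} \<Longrightarrow> \<omega> \<in> space M \<Longrightarrow> Y t \<omega> = C (Z t \<omega>)"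
    using \<open>ou_output M L T S B K C u (\<lambda>\<omega>. Bin (v \<omega>)) Y\<close> unfolding ou_output_def by blast
  obtain Z' where Z': "mild_solution M L T S' B' K' u' (\<lambda>\<omega>. 0) Z'"
    and YZ': "\<And>t \<omega>. t \<in> {0..T} \<Longrightarrow> \<omega> \<in> space M \<Longrightarrow> Y' t \<omega> = C' (Z' t \<omega>)"
    using \<open>ou_output M L T S' B' K' C' u' (\<lambda>\<omega>. 0) Y'\<close> unfolding ou_output_def by blast
  have noise: "mean_square M (\<lambda>\<omega>. fN (\<omega>, t)) \<le> ennreal e2.energy" if t: "t \<in> {0<..<T}" for t
  proof -
    have t': "0 < t" "t < T" "0 \<le> t" "t \<in> {0..T}" using t by auto
    obtain J where J: "is_stochastic_integral M L t (\<lambda>s x. S (t - s) (K x)) J"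
      "AE \<omega> in M. Z t \<omega> = S t (Bin (v \<omega>)) + J \<omega> + (LBINT s:{0<..<t}. S (t - s) (B (u s \<omega>)))"
      using Z t'(4) unfolding mild_solution_def by blast
    obtain J' where J': "is_stochastic_integral M L t (\<lambda>s x. S' (t - s) (K' x)) J'"
      "AE \<omega> in M. Z' t \<omega> = S' t 0 + J' \<omega> + (LBINT s:{0<..<t}. S' (t - s) (B' (u' s \<omega>)))"
      using Z' t'(4) unfolding mild_solution_def by blast
    have "AE \<omega> in M. fN (\<omega>, t) = C (J \<omega>) - C' (J' \<omega>)"
      using J(2) J'(2) AE_section_square_integrable[OF L2u(1) T] AE_section_square_integrable[OF L2u(2) T] AE_space
    proof eventually_elim
      case (elim \<omega>)
      let ?a = "LBINT s:{0<..<t}. S (t - s) (B (u s \<omega>))" and ?a' = "LBINT s:{0<..<t}. S' (t - s) (B' (u' s \<omega>))"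
      have a: "C ?a - C' ?a' = fU (\<omega>, t) + fW (\<omega>, t)"
        using control_decomposition[OF S S' blB blC(1,2), of "\<lambda>s. u s \<omega>" T "\<lambda>s. u' s \<omega>" t] elim t'
        by (simp add: fU_def fW_def e1.\<Gamma>_def e3.\<Gamma>_def)
      have "S' t 0 = 0" by (rule linear_0[OF bounded_linear.linear[OF e1.S'.bounded_linear_semigroup[OF t'(3)]]])
      then have "Y t \<omega> = C (S t (Bin (v \<omega>))) + C (J \<omega>) + C ?a" "Y' t \<omega> = C' (J' \<omega>) + C' ?a'"
        using YZ[OF t'(4)] YZ'[OF t'(4)] elim
        by (simp_all add: linear_add[OF bounded_linear.linear[OF blC(1)]] linear_add[OF bounded_linear.linear[OF blC(2)]])
      then have "D (\<omega>, t) = f0 (\<omega>, t) + (C (J \<omega>) - C' (J' \<omega>)) + (C ?a - C' ?a')"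
        by (simp add: D_def f0_def e0.\<Gamma>_def \<open>\<And>t \<omega>. Y0 t \<omega> = C0 (S0 t (Bin' (v \<omega>))) + Y' t \<omega>\<close>)
      then show ?case unfolding a by (simp add: fN_def)
    qed
    then have "mean_square M (\<lambda>\<omega>. fN (\<omega>, t)) = mean_square M (\<lambda>\<omega>. C (J \<omega>) - C' (J' \<omega>))"
      by (intro nn_integral_cong_AE) auto
    also have "\<dots> \<le> ennreal e2.energy"
      unfolding B2_def B2'_def
      by (rule levy.stochastic_convolution_bound[OF e2.error_system_axioms[unfolded B2_def B2'_def] blK t'(3) J(1) J'(1)])
    finally show ?thesis .
  qed
  have fNb: "mean_square ?N fN \<le> ennreal ((sqrt T * sqrt e2.energy)\<^sup>2)"
  proof -
    have "mean_square ?N fN = (\<integral>\<^sup>+t. \<integral>\<^sup>+\<omega>. ennreal ((norm (fN (\<omega>, t)))\<^sup>2) \<partial>M \<partial>time_interval T)"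
      using P.nn_integral_snd[of "\<lambda>p. ennreal ((norm (fN p))\<^sup>2)"] fNm by simp
    also have "\<dots> \<le> (\<integral>\<^sup>+t. ennreal e2.energy \<partial>time_interval T)"
      using noise by (intro nn_integral_mono) (simp add: space_time_interval)
    also have "\<dots> = ennreal ((sqrt T * sqrt e2.energy)\<^sup>2)"
      using T e2.energy_nonneg by (simp add: emeasure_time_interval power_mult_distrib mult.commute flip: ennreal_mult)
    finally show ?thesis .
  qed

  let ?u = "L2_proc_norm M T u" and ?uu = "L2_proc_norm M T (\<lambda>t \<omega>. u t \<omega> - u' t \<omega>)"
  have pos: "0 \<le> ?u" "0 \<le> ?uu" "0 \<le> L2_norm M v" by (simp_all add: L2_proc_norm_def L2_norm_nonneg)
  note en = e0.energy_nonneg e1.energy_nonneg e2.energy_nonneg e3.energy_nonneg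
  let ?\<alpha> = "((sqrt T * sqrt e2.energy + sqrt T * sqrt e1.energy * ?u) + L2_norm M v * sqrt e0.energy) + sqrt T * sqrt e3.energy * ?uu"
  have "mean_square ?N (\<lambda>p. ((fN p + fU p) + f0 p) + fW p) \<le> ennreal (?\<alpha>\<^sup>2)"
    using pos en T fNm fUm f0m fWm
    by (intro L2_bound_add fNb fUb f0b fWb borel_measurable_add) auto
  moreover have "((fN p + fU p) + f0 p) + fW p = D p" for p by (simp add: fN_def)
  ultimately have "mean_square ?N D \<le> ennreal (?\<alpha>\<^sup>2)" by simp
  from L2_norm_leI[OF Dm this] have final: "L2_fun ?N D \<and> L2_norm ?N D \<le> ?\<alpha>"
    using pos en T by simp
  have "sqrt T * sqrt e2.energy + sqrt T * sqrt e1.energy * ?u \<le> sqrt (2 * T) * max 1 ?u * sqrt (e1.energy + e2.energy)"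
  proof -
    have "sqrt e1.energy + sqrt e2.energy \<le> sqrt 2 * sqrt (e1.energy + e2.energy)"
    proof -
      have "(sqrt e1.energy + sqrt e2.energy)\<^sup>2 \<le> 2 * (e1.energy + e2.energy)"
        using sum_squares_bound[of "sqrt e1.energy" "sqrt e2.energy"] en by (simp add: power2_sum)
      then show ?thesis by (simp add: real_le_rsqrt flip: real_sqrt_mult)
    qed
    then have "(sqrt T * max 1 ?u) * (sqrt e1.energy + sqrt e2.energy) \<le> (sqrt T * max 1 ?u) * (sqrt 2 * sqrt (e1.energy + e2.energy))"
      using T by (intro mult_left_mono) auto
    moreover have "sqrt e2.energy + sqrt e1.energy * ?u \<le> max 1 ?u * (sqrt e1.energy + sqrt e2.energy)"
    proof -
      have "1 * sqrt e2.energy \<le> max 1 ?u * sqrt e2.energy"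
        by (rule mult_right_mono) (use en in auto)
      moreover have "?u * sqrt e1.energy \<le> max 1 ?u * sqrt e1.energy"
        by (rule mult_right_mono) (use en in auto)
      ultimately show ?thesis by (simp add: algebra_simps)
    qed
    then have "sqrt T * (sqrt e2.energy + sqrt e1.energy * ?u) \<le> sqrt T * (max 1 ?u * (sqrt e1.energy + sqrt e2.energy))"
      using T by (intro mult_left_mono) auto
    ultimately show ?thesis by (simp add: real_sqrt_mult algebra_simps)
  qed
  then have "?\<alpha> \<le> sqrt (2 * T) * max 1 ?u * sqrt (e1.energy + e2.energy) + L2_norm M v * sqrt e0.energy + sqrt T * sqrt e3.energy * ?uu"
    by simp
  with final show ?thesis
    unfolding tr0 tr tr3 by (auto simp: L2_proc_def L2_proc_norm_def Omega_T_eq case_prod_beta' D_def[abs_def])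
qed

end
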